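(* Let $(X,\Sigma,\mathbb{P})$ be a separable probability space and let $\Gamma$ be an infinite countable discrete group acting on it by a measure preserving, free and ergodic action $T:\Gamma\to\mathrm{Aut}(X,\Sigma,\mathbb{P})$. Let $\mathcal{M}=L^\infty(X,\mathbb{P})$ act by multiplication on $\mathcal{H}=L^2(X,\mathbb{P})$, let $\alpha:\Gamma\to\mathrm{Aut}(\mathcal{M})$ be the induced action $\alpha_\gamma(f)=f\circ T_\gamma^{-1}$, and let $\mathcal{N}=\mathcal{M}\otimes_\alpha\Gamma$ be the discrete crossed product (a finite factor) acting on $\mathcal{K}=\ell_2(\Gamma)\otimes\mathcal{H}\cong\bigoplus_{\gamma\in\Gamma}\mathcal{H}$. Let $\Omega\in\mathcal{K}$ be the cyclic and separating vector for $\mathcal{N}$ given by $(\Omega)_\gamma=\delta_{e\gamma}\,1$, where $1\in\mathcal{H}$ is the constant function $1$ and $e$ is the identity of $\Gamma$. Then the Tomita operator $S$ associated to the pair $(\mathcal{N},\Omega)$ is an isometry; hence the modular operator and modular conjugation of $(\mathcal{N},\Omega)$ satisfy $\Delta=\mathbb{1}$ and $S=J$. An explicit expression for $S$ is given on the dense set $$\{N\Omega\mid N\in\mathcal{N}\}=\{(A(\gamma))_{\gamma\in\Gamma}\mid A:\Gamma\to\mathcal{M}\ \text{is the function associated to some } N\in\mathcal{N}\}\subset\mathcal{K}$$ by the matrix entries $$S_{\gamma'\gamma}=\delta_{\gamma',\gamma^{-1}}\;\alpha_\gamma(C(\cdot)),\qquad \gamma',\gamma\in\Gamma,$$ where $C$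 denotes complex conjugation in $\mathcal{M}$, i.e. $(S\xi)_{\gamma'}=\sum_{\gamma}S_{\gamma'\gamma}\,\xi_\gamma$. Moreover, the vector state $\omega(N):=\langle\Omega,N\Omega\rangle$, $N\in\mathcal{N}$, is a trace on the finite factor $\mathcal{N}$.
   Context: Group action: an automorphism of $(X,\Sigma,\mathbb{P})$ is a bijection $T:X\to X$ such that $T$ and $T^{-1}$ map $\Sigma$ to $\Sigma$ and preserve null sets in both directions; the action is measure preserving if $\mathbb{P}\circ T_\gamma=\mathbb{P}$ for all $\gamma\in\Gamma$. It is free if $\{x\in X\mid T_\gamma x=x\}$ has measure zero for all $\gamma\neq e$ (on $\mathcal{M}$: for $\gamma\ne e$, $fg=\alpha_\gamma(g)f$ for all $g\in\mathcal{M}$ implies $f=0$). It is ergodic if every $Y\in\Sigma$ with $\mathbb{P}\big((T_\gamma Y\setminus Y)\cup(Y\setminus T_\gamma Y)\big)=0$ for all $\gamma\in\Gamma$ satisfies $\mathbb{P}(Y)=0$ or $\mathbb{P}(X\setminus Y)=0$ (on $\mathcal{M}$: the fixed point algebra of $\alpha$ is $\mathbb{C}1$). Crossed product: for $\xi=(\xi_\gamma)_{\gamma\in\Gamma}\in\mathcal{K}$, $\xi_\gamma\in\mathcal{H}$, define $(\pi(f)\xi)_\gamma:=\alpha_\gamma^{-1}(f)\,\xi_\gamma$ for $f\in\mathcal{M}$ and $(U(\gamma_0)\xi)_\gamma:=\xi_{\gamma_0^{-1}\gamma}$ for $\gamma_0\in\Gamma$. Then $\mathcal{N}=\mathcal{M}\otimes_\alpha\Gamma:=\big(\{\pi(f)\mid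 f\in\mathcal{M}\}\cup\{U(\gamma)\mid\gamma\in\Gamma\}\big)''\subset\mathcal{L}(\mathcal{K})$. Writing operators on $\mathcal{K}$ as matrices indexed by $\Gamma$ with entries operators on $\mathcal{H}$, every $N\in\mathcal{N}$ has the form $N_{\gamma'\gamma}=\alpha_\gamma^{-1}\big(A(\gamma'\gamma^{-1})\big)$ for a function $A:\Gamma\to\mathcal{M}$, called here the function associated to $N$; bounded functions in $\mathcal{M}$ are also regarded as vectors in $\mathcal{H}$. It is known that under the stated hypotheses $\mathcal{N}$ is a finite factor. Modular objects: for a von Neumann algebra $\mathcal{N}$ with cyclic and separating vector $\Omega$, the Tomita operator $S$ is the closure of the antilinear operator $N\Omega\mapsto N^*\Omega$, $N\in\mathcal{N}$. Its polar decomposition is $S=J\Delta^{1/2}$ with $\Delta$ positive self-adjoint (the modular operator) and $J$ antiunitary (the modular conjugation). An antilinear $S$ is an isometry if $\|S\xi\|=\|\xi\|$ for all $\xi$.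
   Formalization: That N is a factor is concluded only if countably many measurable sets separate points mod null or the action is free on L∞; with only a separable measure algebra and pointwise freeness it can fail (a flip that no measurable set detects). All other claims are unconditional. *)

theory Defs
  imports "HOL-Probability.Probability_Measure" "HOL-Library.Nonpos_Ints"
    "HOL-Algebra.Module" "HOL-Algebra.Group_Action"
begin

section \<open>Complex Hilbert spaces with explicit carriers\<close>

text \<open>
  The spaces needed below depend on a measure and on a group, hence cannot be types.  A Hilbert space
  is a record over the library's module record; the inner product is linear in the second argument.
  The ring fields \<open>mult\<close> and \<open>one\<close>, inherited from the module record, are unused.
\<close>

record 'v hilbert = "(complex, 'v) module" +
  cinner :: "'v \<Rightarrow> 'v \<Rightarrow> complex"

definition vnorm :: "('v, 'm) hilbert_scheme \<Rightarrow> 'v \<Rightarrow> real" where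
  "vnorm H x = sqrt (Re (cinner H x x))"

definition vdist :: "('v, 'm) hilbert_scheme \<Rightarrow> 'v \<Rightarrow> 'v \<Rightarrow> real" where
  "vdist H x y = vnorm H (x \<ominus>\<^bsub>H\<^esub> y)"

definition dense_in :: "('v, 'm) hilbert_scheme \<Rightarrow> 'v set \<Rightarrow> bool" where
  "dense_in H A \<longleftrightarrow> A \<subseteq> carrier H \<and> (\<forall>x\<in>carrier H. \<forall>e>0. \<exists>a\<in>A. vdist H a x < e)"

text \<open>Unconditional (net) convergence of a family of vectors in norm.\<close>

definition has_vsum :: "('v, 'm) hilbert_scheme \<Rightarrow> ('i \<Rightarrow> 'v) \<Rightarrow> 'i set \<Rightarrow> 'v \<Rightarrow> bool" where
  "has_vsum H f I s \<longleftrightarrow> f \<in> I \<rightarrow> carrier H \<and> s \<in> carrier H \<and>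
     (\<forall>e>0. \<exists>F0. finite F0 \<and> F0 \<subseteq> I \<and>
        (\<forall>F. finite F \<and> F0 \<subseteq> F \<and> F \<subseteq> I \<longrightarrow> vdist H (finsum H f F) s < e))"

definition hilbert_sum :: "'i set \<Rightarrow> 'v hilbert \<Rightarrow> ('i \<Rightarrow> 'v) hilbert" where
  "hilbert_sum I H =
     \<lparr> carrier = {\<xi> \<in> I \<rightarrow>\<^sub>E carrier H. (\<lambda>i. (vnorm H (\<xi> i))\<^sup>2) summable_on I},
       mult = undefined, one = undefined,
       zero = (\<lambda>i\<in>I. \<zero>\<^bsub>H\<^esub>),
       add = (\<lambda>\<xi> \<eta>. \<lambda>i\<in>I. \<xi> i \<oplus>\<^bsub>H\<^esub> \<eta> i),
       smult = (\<lambda>c \<xi>. \<lambda>i\<in>I. c \<odot>\<^bsub>H\<^esub> \<xi> i),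
       cinner = (\<lambda>\<xi> \<eta>. \<Sum>\<^sub>\<infinity>i\<in>I. cinner H (\<xi> i) (\<eta> i)) \<rparr>"


section \<open>Bounded operators and von Neumann algebras\<close>

text \<open>Bounded operators are extensional, so that HOL equality is equality of operators.\<close>

definition bop :: "('v, 'm) hilbert_scheme \<Rightarrow> ('v \<Rightarrow> 'v) set" where
  "bop H = {A \<in> carrier H \<rightarrow>\<^sub>E carrier H.
     (\<forall>x\<in>carrier H. \<forall>y\<in>carrier H. A (x \<oplus>\<^bsub>H\<^esub> y) = A x \<oplus>\<^bsub>H\<^esub> A y) \<and>
     (\<forall>c. \<forall>x\<in>carrier H. A (c \<odot>\<^bsub>H\<^esub> x) = c \<odot>\<^bsub>H\<^esub> A x) \<and>
     (\<exists>b. \<forall>x\<in>carrier H. vnorm H (A x) \<le> b * vnorm H x)}"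

definition op_id :: "('v, 'm) hilbert_scheme \<Rightarrow> 'v \<Rightarrow> 'v" where
  "op_id H = (\<lambda>x\<in>carrier H. x)"

definition op_zero :: "('v, 'm) hilbert_scheme \<Rightarrow> 'v \<Rightarrow> 'v" where
  "op_zero H = (\<lambda>x\<in>carrier H. \<zero>\<^bsub>H\<^esub>)"

definition op_add :: "('v, 'm) hilbert_scheme \<Rightarrow> ('v \<Rightarrow> 'v) \<Rightarrow> ('v \<Rightarrow> 'v) \<Rightarrow> 'v \<Rightarrow> 'v" where
  "op_add H A B = (\<lambda>x\<in>carrier H. A x \<oplus>\<^bsub>H\<^esub> B x)"

definition op_scale :: "('v, 'm) hilbert_scheme \<Rightarrow> complex \<Rightarrow> ('v \<Rightarrow> 'v) \<Rightarrow> 'v \<Rightarrow> 'v" where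
  "op_scale H c A = (\<lambda>x\<in>carrier H. c \<odot>\<^bsub>H\<^esub> A x)"

definition op_mult :: "('v, 'm) hilbert_scheme \<Rightarrow> ('v \<Rightarrow> 'v) \<Rightarrow> ('v \<Rightarrow> 'v) \<Rightarrow> 'v \<Rightarrow> 'v" where
  "op_mult H A B = compose (carrier H) A B"

definition adj :: "('v, 'm) hilbert_scheme \<Rightarrow> ('v \<Rightarrow> 'v) \<Rightarrow> 'v \<Rightarrow> 'v" where
  "adj H A = (THE B. B \<in> bop H \<and>
     (\<forall>x\<in>carrier H. \<forall>y\<in>carrier H. cinner H x (A y) = cinner H (B x) y))"

definition commutant :: "('v, 'm) hilbert_scheme \<Rightarrow> ('v \<Rightarrow> 'v) set \<Rightarrow> ('v \<Rightarrow> 'v) set" where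
  "commutant H S = {B \<in> bop H. \<forall>A\<in>S. op_mult H A B = op_mult H B A}"

definition von_neumann_algebra :: "('v, 'm) hilbert_scheme \<Rightarrow> ('v \<Rightarrow> 'v) set \<Rightarrow> bool" where
  "von_neumann_algebra H N \<longleftrightarrow>
     N \<subseteq> bop H \<and> (\<forall>A\<in>N. adj H A \<in> N) \<and> commutant H (commutant H N) = N"

definition factor :: "('v, 'm) hilbert_scheme \<Rightarrow> ('v \<Rightarrow> 'v) set \<Rightarrow> bool" where
  "factor H N \<longleftrightarrow> von_neumann_algebra H N \<and>
     N \<inter> commutant H N = {op_scale H c (op_id H) | c. True}"

text \<open>Finiteness: the identity is not equivalent to a proper subprojection of itself.\<close>

definition finite_vna :: "('v, 'm) hilbert_scheme \<Rightarrow> ('v \<Rightarrow> 'v) set \<Rightarrow> bool" where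
  "finite_vna H N \<longleftrightarrow> von_neumann_algebra H N \<and>
     (\<forall>V\<in>N. op_mult H (adj H V) V = op_id H \<longrightarrow> op_mult H V (adj H V) = op_id H)"

definition cyclic :: "('v, 'm) hilbert_scheme \<Rightarrow> ('v \<Rightarrow> 'v) set \<Rightarrow> 'v \<Rightarrow> bool" where
  "cyclic H N \<Omega> \<longleftrightarrow> \<Omega> \<in> carrier H \<and> dense_in H {A \<Omega> | A. A \<in> N}"

definition separating :: "('v, 'm) hilbert_scheme \<Rightarrow> ('v \<Rightarrow> 'v) set \<Rightarrow> 'v \<Rightarrow> bool" where
  "separating H N \<Omega> \<longleftrightarrow> \<Omega> \<in> carrier H \<and> (\<forall>A\<in>N. A \<Omega> = \<zero>\<^bsub>H\<^esub> \<longrightarrow> A = op_zero H)"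

definition vector_state :: "('v, 'm) hilbert_scheme \<Rightarrow> 'v \<Rightarrow> ('v \<Rightarrow> 'v) \<Rightarrow> complex" where
  "vector_state H \<Omega> A = cinner H \<Omega> (A \<Omega>)"

definition tracial_state ::
    "('v, 'm) hilbert_scheme \<Rightarrow> ('v \<Rightarrow> 'v) set \<Rightarrow> (('v \<Rightarrow> 'v) \<Rightarrow> complex) \<Rightarrow> bool" where
  "tracial_state H N \<phi> \<longleftrightarrow>
     (\<forall>A\<in>N. \<forall>B\<in>N. \<phi> (op_add H A B) = \<phi> A + \<phi> B) \<and>
     (\<forall>c. \<forall>A\<in>N. \<phi> (op_scale H c A) = c * \<phi> A) \<and>
     (\<forall>A\<in>N. \<phi> (op_mult H (adj H A) A) \<in> \<real>\<^sub>\<ge>\<^sub>0) \<and>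
     \<phi> (op_id H) = 1 \<and>
     (\<forall>A\<in>N. \<forall>B\<in>N. \<phi> (op_mult H A B) = \<phi> (op_mult H B A))"


section \<open>Unbounded operators as graphs, and modular objects\<close>

text \<open>
  A possibly unbounded, partially defined operator \<open>R\<close> is its graph, with \<open>(x, y) \<in> R\<close> for
  \<open>y = R x\<close>; consequently \<open>R O R'\<close> is the operator \<open>R' \<circ> R\<close> on its natural domain.
\<close>

definition semilinear_op ::
    "(complex \<Rightarrow> complex) \<Rightarrow> ('v, 'm) hilbert_scheme \<Rightarrow> ('v \<times> 'v) set \<Rightarrow> bool" where
  "semilinear_op \<sigma> H R \<longleftrightarrow>
     R \<subseteq> carrier H \<times> carrier H \<and> single_valued R \<and> dense_in H (Domain R) \<and>
     (\<forall>(x, y)\<in>R. \<forall>(x', y')\<in>R. (x \<oplus>\<^bsub>H\<^esub> x', y \<oplus>\<^bsub>H\<^esub> y') \<in> R) \<and>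
     (\<forall>c. \<forall>(x, y)\<in>R. (c \<odot>\<^bsub>H\<^esub> x, \<sigma> c \<odot>\<^bsub>H\<^esub> y) \<in> R)"

abbreviation "linear_op \<equiv> semilinear_op (\<lambda>c. c)"
abbreviation "antilinear_op \<equiv> semilinear_op cnj"

definition antilinear_isometry :: "('v, 'm) hilbert_scheme \<Rightarrow> ('v \<times> 'v) set \<Rightarrow> bool" where
  "antilinear_isometry H R \<longleftrightarrow> antilinear_op H R \<and> (\<forall>(x, y)\<in>R. vnorm H y = vnorm H x)"

definition graph_closure :: "('v, 'm) hilbert_scheme \<Rightarrow> ('v \<times> 'v) set \<Rightarrow> ('v \<times> 'v) set" where
  "graph_closure H R = {(x, y) \<in> carrier H \<times> carrier H.
     \<forall>e>0. \<exists>(a, b)\<in>R. vdist H a x < e \<and> vdist H b y < e}"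

definition adjoint_graph :: "('v, 'm) hilbert_scheme \<Rightarrow> ('v \<times> 'v) set \<Rightarrow> ('v \<times> 'v) set" where
  "adjoint_graph H R = {(y, z) \<in> carrier H \<times> carrier H.
     \<forall>(x, w)\<in>R. cinner H y w = cinner H z x}"

definition positive_selfadjoint :: "('v, 'm) hilbert_scheme \<Rightarrow> ('v \<times> 'v) set \<Rightarrow> bool" where
  "positive_selfadjoint H R \<longleftrightarrow>
     linear_op H R \<and> adjoint_graph H R = R \<and> (\<forall>(x, y)\<in>R. cinner H x y \<in> \<real>\<^sub>\<ge>\<^sub>0)"

definition antiunitary :: "('v, 'm) hilbert_scheme \<Rightarrow> ('v \<times> 'v) set \<Rightarrow> bool" where
  "antiunitary H R \<longleftrightarrow> antilinear_op H R \<and> Domain R = carrier H \<and> Range R = carrier H \<and>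
     (\<forall>(x, y)\<in>R. \<forall>(x', y')\<in>R. cinner H y y' = cinner H x' x)"

definition tomita :: "('v, 'm) hilbert_scheme \<Rightarrow> ('v \<Rightarrow> 'v) set \<Rightarrow> 'v \<Rightarrow> ('v \<times> 'v) set" where
  "tomita H N \<Omega> = graph_closure H {(A \<Omega>, adj H A \<Omega>) | A. A \<in> N}"

text \<open>Below \<open>D\<close> is the positive square root of \<open>\<Delta>\<close>, so the last equation says \<open>S = J \<Delta>\<^sup>1\<^sup>/\<^sup>2\<close>.\<close>

definition modular_objects ::
    "('v, 'm) hilbert_scheme \<Rightarrow> ('v \<Rightarrow> 'v) set \<Rightarrow> 'v \<Rightarrow> ('v \<times> 'v) set \<Rightarrow> ('v \<times> 'v) set \<Rightarrow> bool" where
  "modular_objects H N \<Omega> \<Delta> J \<longleftrightarrow> positive_selfadjoint H \<Delta> \<and> antiunitary H J \<and>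
     (\<exists>D. positive_selfadjoint H D \<and> D O D = \<Delta> \<and> tomita H N \<Omega> = D O J)"


section \<open>Function spaces modulo null sets\<close>

text \<open>
  \<open>L\<^sup>2\<close> and \<open>L\<^sup>\<infinity>\<close> consist of classes of almost everywhere equal measurable functions, so
  on a probability space \<open>Linf M \<subseteq> carrier (L2 M)\<close> holds literally and bounded functions are
  vectors.  Operations on classes are computed with representatives.
\<close>

definition ae_class :: "'x measure \<Rightarrow> ('x \<Rightarrow> complex) \<Rightarrow> ('x \<Rightarrow> complex) set" where
  "ae_class M f = {g \<in> borel_measurable M. AE x in M. g x = f x}"

definition rep :: "('x \<Rightarrow> complex) set \<Rightarrow> 'x \<Rightarrow> complex" where
  "rep F = (SOME f. f \<in> F)"

definition cl_mult ::
    "'x measure \<Rightarrow> ('x \<Rightarrow> complex) set \<Rightarrow> ('x \<Rightarrow> complex) set \<Rightarrow> ('x \<Rightarrow> complex) set" where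
  "cl_mult M F G = ae_class M (\<lambda>x. rep F x * rep G x)"

definition cl_cnj :: "'x measure \<Rightarrow> ('x \<Rightarrow> complex) set \<Rightarrow> ('x \<Rightarrow> complex) set" where
  "cl_cnj M F = ae_class M (\<lambda>x. cnj (rep F x))"

definition L2 :: "'x measure \<Rightarrow> ('x \<Rightarrow> complex) set hilbert" where
  "L2 M =
     \<lparr> carrier = {ae_class M f | f.
         f \<in> borel_measurable M \<and> integrable M (\<lambda>x. (cmod (f x))\<^sup>2)},
       mult = undefined, one = undefined,
       zero = ae_class M (\<lambda>_. 0),
       add = (\<lambda>F G. ae_class M (\<lambda>x. rep F x + rep G x)),
       smult = (\<lambda>c F. ae_class M (\<lambda>x. c * rep F x)),
       cinner = (\<lambda>F G. \<integral>x. cnj (rep F x) * rep G x \<partial>M) \<rparr>"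

definition Linf :: "'x measure \<Rightarrow> ('x \<Rightarrow> complex) set set" where
  "Linf M = {ae_class M f | f.
     f \<in> borel_measurable M \<and> (\<exists>b. AE x in M. cmod (f x) \<le> b)}"


section \<open>Probability spaces and group actions on them\<close>

text \<open>Separability of the measure algebra, equivalently of \<open>L\<^sup>2\<close>.\<close>

definition separable_measure :: "'x measure \<Rightarrow> bool" where
  "separable_measure M \<longleftrightarrow> (\<exists>D. countable D \<and> D \<subseteq> sets M \<and>
     (\<forall>A\<in>sets M. \<forall>e>0. \<exists>B\<in>D. measure M (sym_diff A B) < e))"

text \<open>Countably many measurable sets separate the points outside a null set.\<close>

definition countably_separated :: "'x measure \<Rightarrow> bool" where
  "countably_separated M \<longleftrightarrow> (\<exists>D Z. countable D \<and> D \<subseteq> sets M \<and> Z \<in> null_sets M \<and>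
     (\<forall>x\<in>space M - Z. \<forall>y\<in>space M - Z. x \<noteq> y \<longrightarrow> (\<exists>A\<in>D. (x \<in> A) \<noteq> (y \<in> A))))"

definition measure_aut :: "'x measure \<Rightarrow> ('x \<Rightarrow> 'x) \<Rightarrow> bool" where
  "measure_aut M t \<longleftrightarrow> bij_betw t (space M) (space M) \<and>
     (\<forall>A\<in>sets M. t ` A \<in> sets M \<and> t -` A \<inter> space M \<in> sets M) \<and>
     (\<forall>A\<in>sets M. t ` A \<in> null_sets M \<longleftrightarrow> A \<in> null_sets M)"

definition aut_action :: "('g, 'b) monoid_scheme \<Rightarrow> 'x measure \<Rightarrow> ('g \<Rightarrow> 'x \<Rightarrow> 'x) \<Rightarrow> bool" where
  "aut_action G M T \<longleftrightarrow> group_action G (space M) T \<and> (\<forall>\<gamma>\<in>carrier G. measure_aut M (T \<gamma>))"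

definition measure_preserving_action ::
    "('g, 'b) monoid_scheme \<Rightarrow> 'x measure \<Rightarrow> ('g \<Rightarrow> 'x \<Rightarrow> 'x) \<Rightarrow> bool" where
  "measure_preserving_action G M T \<longleftrightarrow>
     (\<forall>\<gamma>\<in>carrier G. \<forall>A\<in>sets M. measure M (T \<gamma> ` A) = measure M A)"

definition free_action :: "('g, 'b) monoid_scheme \<Rightarrow> 'x measure \<Rightarrow> ('g \<Rightarrow> 'x \<Rightarrow> 'x) \<Rightarrow> bool" where
  "free_action G M T \<longleftrightarrow> (\<forall>\<gamma>\<in>carrier G. \<gamma> \<noteq> \<one>\<^bsub>G\<^esub> \<longrightarrow> (AE x in M. T \<gamma> x \<noteq> x))"

definition ergodic_action :: "('g, 'b) monoid_scheme \<Rightarrow> 'x measure \<Rightarrow> ('g \<Rightarrow> 'x \<Rightarrow> 'x) \<Rightarrow> bool" where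
  "ergodic_action G M T \<longleftrightarrow> (\<forall>Y\<in>sets M.
     (\<forall>\<gamma>\<in>carrier G. measure M (sym_diff (T \<gamma> ` Y) Y) = 0) \<longrightarrow>
     measure M Y = 0 \<or> measure M (space M - Y) = 0)"

text \<open>The induced action \<open>\<alpha>\<^sub>\<gamma>(f) = f \<circ> T\<^sub>\<gamma>\<^sup>-\<^sup>1\<close>.\<close>

definition act :: "('g, 'b) monoid_scheme \<Rightarrow> 'x measure \<Rightarrow> ('g \<Rightarrow> 'x \<Rightarrow> 'x) \<Rightarrow>
    'g \<Rightarrow> ('x \<Rightarrow> complex) set \<Rightarrow> ('x \<Rightarrow> complex) set" where
  "act G M T \<gamma> F = ae_class M (\<lambda>x. rep F (T (inv\<^bsub>G\<^esub> \<gamma>) x))"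

text \<open>
  Freeness of the induced action on \<open>L\<^sup>\<infinity>\<close>.  It follows from \<open>free_action\<close> on
  countably separated spaces, but not on arbitrary ones: a group element may move points that
  no measurable set distinguishes.
\<close>

definition free_on_Linf :: "('g, 'b) monoid_scheme \<Rightarrow> 'x measure \<Rightarrow> ('g \<Rightarrow> 'x \<Rightarrow> 'x) \<Rightarrow> bool" where
  "free_on_Linf G M T \<longleftrightarrow> (\<forall>\<gamma>\<in>carrier G. \<gamma> \<noteq> \<one>\<^bsub>G\<^esub> \<longrightarrow>
     (\<forall>f\<in>Linf M. (\<forall>g\<in>Linf M. cl_mult M f g = cl_mult M (act G M T \<gamma> g) f) \<longrightarrow>
        f = ae_class M (\<lambda>_. 0)))"


section \<open>The discrete crossed product\<close>

definition cp_space :: "('g, 'b) monoid_scheme \<Rightarrow> 'x measure \<Rightarrow> ('g \<Rightarrow> ('x \<Rightarrow> complex) set) hilbert" where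
  "cp_space G M = hilbert_sum (carrier G) (L2 M)"

text \<open>Here and below \<open>\<alpha>\<^sub>\<gamma>\<^sup>-\<^sup>1\<close> is written as the action of the inverse group element.\<close>

definition cp_pi :: "('g, 'b) monoid_scheme \<Rightarrow> 'x measure \<Rightarrow> ('g \<Rightarrow> 'x \<Rightarrow> 'x) \<Rightarrow>
    ('x \<Rightarrow> complex) set \<Rightarrow> ('g \<Rightarrow> ('x \<Rightarrow> complex) set) \<Rightarrow> 'g \<Rightarrow> ('x \<Rightarrow> complex) set" where
  "cp_pi G M T f = (\<lambda>\<xi>\<in>carrier (cp_space G M). \<lambda>\<gamma>\<in>carrier G.
     cl_mult M (act G M T (inv\<^bsub>G\<^esub> \<gamma>) f) (\<xi> \<gamma>))"

definition cp_U :: "('g, 'b) monoid_scheme \<Rightarrow> 'x measure \<Rightarrow>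
    'g \<Rightarrow> ('g \<Rightarrow> ('x \<Rightarrow> complex) set) \<Rightarrow> 'g \<Rightarrow> ('x \<Rightarrow> complex) set" where
  "cp_U G M \<gamma>\<^sub>0 = (\<lambda>\<xi>\<in>carrier (cp_space G M). \<lambda>\<gamma>\<in>carrier G. \<xi> (inv\<^bsub>G\<^esub> \<gamma>\<^sub>0 \<otimes>\<^bsub>G\<^esub> \<gamma>))"

definition crossed_product :: "('g, 'b) monoid_scheme \<Rightarrow> 'x measure \<Rightarrow> ('g \<Rightarrow> 'x \<Rightarrow> 'x) \<Rightarrow>
    (('g \<Rightarrow> ('x \<Rightarrow> complex) set) \<Rightarrow> 'g \<Rightarrow> ('x \<Rightarrow> complex) set) set" where
  "crossed_product G M T =
     commutant (cp_space G M) (commutant (cp_space G M)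
       (cp_pi G M T ` Linf M \<union> cp_U G M ` carrier G))"

definition cp_embed :: "('g, 'b) monoid_scheme \<Rightarrow> 'x measure \<Rightarrow>
    'g \<Rightarrow> ('x \<Rightarrow> complex) set \<Rightarrow> 'g \<Rightarrow> ('x \<Rightarrow> complex) set" where
  "cp_embed G M \<gamma> F = (\<lambda>\<gamma>'\<in>carrier G. if \<gamma>' = \<gamma> then F else \<zero>\<^bsub>L2 M\<^esub>)"

definition cp_Omega :: "('g, 'b) monoid_scheme \<Rightarrow> 'x measure \<Rightarrow> 'g \<Rightarrow> ('x \<Rightarrow> complex) set" where
  "cp_Omega G M = cp_embed G M \<one>\<^bsub>G\<^esub> (ae_class M (\<lambda>_. 1))"

definition mat_entry :: "('g, 'b) monoid_scheme \<Rightarrow> 'x measure \<Rightarrow>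
    (('g \<Rightarrow> ('x \<Rightarrow> complex) set) \<Rightarrow> 'g \<Rightarrow> ('x \<Rightarrow> complex) set) \<Rightarrow>
    'g \<Rightarrow> 'g \<Rightarrow> ('x \<Rightarrow> complex) set \<Rightarrow> ('x \<Rightarrow> complex) set" where
  "mat_entry G M N \<gamma>' \<gamma> F = N (cp_embed G M \<gamma> F) \<gamma>'"

text \<open>\<open>A\<close> is the function associated to \<open>N\<close>: \<open>N\<^sub>\<gamma>\<^sub>'\<^sub>\<gamma>\<close> is multiplication by \<open>\<alpha>\<^sub>\<gamma>\<^sup>-\<^sup>1(A(\<gamma>'\<gamma>\<^sup>-\<^sup>1))\<close>.\<close>

definition associated :: "('g, 'b) monoid_scheme \<Rightarrow> 'x measure \<Rightarrow> ('g \<Rightarrow> 'x \<Rightarrow> 'x) \<Rightarrow>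
    (('g \<Rightarrow> ('x \<Rightarrow> complex) set) \<Rightarrow> 'g \<Rightarrow> ('x \<Rightarrow> complex) set) \<Rightarrow>
    ('g \<Rightarrow> ('x \<Rightarrow> complex) set) \<Rightarrow> bool" where
  "associated G M T N A \<longleftrightarrow> A \<in> carrier G \<rightarrow>\<^sub>E Linf M \<and>
     (\<forall>\<gamma>'\<in>carrier G. \<forall>\<gamma>\<in>carrier G. \<forall>F\<in>carrier (L2 M).
        mat_entry G M N \<gamma>' \<gamma> F =
          cl_mult M (act G M T (inv\<^bsub>G\<^esub> \<gamma>) (A (\<gamma>' \<otimes>\<^bsub>G\<^esub> inv\<^bsub>G\<^esub> \<gamma>))) F)"

text \<open>The matrix entries \<open>\<delta>(\<gamma>', \<gamma>\<^sup>-\<^sup>1) \<alpha>\<^sub>\<gamma>(C(\<cdot>))\<close> of the Tomita operator.\<close>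

definition S_entry :: "('g, 'b) monoid_scheme \<Rightarrow> 'x measure \<Rightarrow> ('g \<Rightarrow> 'x \<Rightarrow> 'x) \<Rightarrow>
    'g \<Rightarrow> 'g \<Rightarrow> ('x \<Rightarrow> complex) set \<Rightarrow> ('x \<Rightarrow> complex) set" where
  "S_entry G M T \<gamma>' \<gamma> F =
     (if \<gamma>' = inv\<^bsub>G\<^esub> \<gamma> then act G M T \<gamma> (cl_cnj M F) else \<zero>\<^bsub>L2 M\<^esub>)"

end

theory Submission
  imports Defs
begin

text \<open>
  The commutant of the crossed product contains the multiplications
  \<open>\<xi>\<^sub>\<gamma> \<mapsto> g \<xi>\<^sub>\<gamma>\<close> and the shifts \<open>\<xi>\<^sub>\<gamma> \<mapsto> \<alpha>\<^sub>\<delta>(\<xi>\<^sub>\<gamma>\<^sub>\<delta>)\<close>.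
  Commuting with them, an element \<open>N\<close> is determined by \<open>A = N \<Omega>\<close>: its matrix entries are
  multiplications by \<open>\<alpha>\<^sub>\<gamma>\<^sup>-\<^sup>1(A(\<gamma>'\<gamma>\<^sup>-\<^sup>1))\<close>, and \<open>A(\<gamma>)\<close> is bounded because
  \<open>N\<close> is. Both algebras move \<open>\<Omega>\<close> onto all finitely supported bounded vectors, so \<open>\<Omega>\<close> is
  cyclic for both, hence separating.

  Reading off the first column of \<open>N\<^sup>*\<close> gives \<open>N\<^sup>* \<Omega> = J N \<Omega>\<close> for the conjugation
  \<open>(J \<xi>)\<^sub>\<gamma> = \<alpha>\<^sub>\<gamma>\<^sup>-\<^sup>1(C \<xi>\<^sub>\<gamma>\<^sup>-\<^sup>1)\<close>, which is antiunitary since the action preserves the measure.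
  Hence \<open>S = J\<close>, and the trace property, finiteness and \<open>\<Delta> = 1\<close> follow formally. For a central \<open>N\<close>,
  commuting with \<open>\<pi>(f)\<close> and freeness give \<open>A(\<gamma>) = 0\<close> for \<open>\<gamma> \<noteq> e\<close>; commuting with
  \<open>U(\<gamma>)\<close> and ergodicity make \<open>A(e)\<close> constant.
\<close>

section \<open>Hilbert spaces\<close>

text \<open>Hilbert space theory is built up as far as completeness because \<open>adj\<close> is a
  definite description: it denotes an adjoint only once the Riesz theorem supplies one, and that
  theorem is applied in a direct sum of copies of L^2, whose completeness has to be established
  before.

  The two families of commuting operators are not guessed. Multiplication by g is J \<pi>(C g) J and
  the shift is J U(\<delta>) J, so the conjugation that turns out to be S also produces the other
  side of the commutation relations. That J takes the right values on N \<Omega> comes from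
  comparing row e of the matrix of N with column e of the matrix of its adjoint.

  Once J is known to be an antiunitary involution with these values, what remains is pure operator
  theory and is isolated in a locale. Uniqueness of the modular objects is reached there without
  spectral theory: if S = K D with S and K antiunitary, then D preserves inner products; with
  self-adjointness this gives D D = 1, and positivity excludes the eigenvalue -1.\<close>

locale inner_space = abelian_group H for H :: "('v, 'm) hilbert_scheme" (structure) +
  assumes smult_closed [simp, intro]: "x \<in> carrier H \<Longrightarrow> c \<odot> x \<in> carrier H"
    and cinner_add_right: "\<lbrakk>x \<in> carrier H; y \<in> carrier H; z \<in> carrier H\<rbrakk>
      \<Longrightarrow> cinner H x (y \<oplus> z) = cinner H x y + cinner H x z"
    and cinner_smult_right: "\<lbrakk>x \<in> carrier H; y \<in> carrier H\<rbrakk>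
      \<Longrightarrow> cinner H x (c \<odot> y) = c * cinner H x y"
    and cinner_commute: "\<lbrakk>x \<in> carrier H; y \<in> carrier H\<rbrakk> \<Longrightarrow> cinner H x y = cnj (cinner H y x)"
    and cinner_self_nonneg: "x \<in> carrier H \<Longrightarrow> 0 \<le> Re (cinner H x x)"
    and cinner_self_eq_0D: "\<lbrakk>x \<in> carrier H; cinner H x x = 0\<rbrakk> \<Longrightarrow> x = \<zero>"
begin

lemma cinner_add_left:
  assumes "x \<in> carrier H" "y \<in> carrier H" "z \<in> carrier H"
  shows "cinner H (y \<oplus> z) x = cinner H y x + cinner H z x"
  using assms by (metis a_closed cinner_add_right cinner_commute complex_cnj_add)

lemma cinner_smult_left:
  assumes "x \<in> carrier H" "y \<in> carrier H"
  shows "cinner H (c \<odot> y) x = cnj c * cinner H y x"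
  using assms by (metis smult_closed cinner_smult_right cinner_commute complex_cnj_mult)

lemma cinner_zero_right: "x \<in> carrier H \<Longrightarrow> cinner H x \<zero> = 0"
  using cinner_add_right[of x \<zero> \<zero>] by simp

lemma cinner_zero_left: "x \<in> carrier H \<Longrightarrow> cinner H \<zero> x = 0"
  using cinner_add_left[of x \<zero> \<zero>] by simp

lemma cinner_a_inv_right:
  assumes "x \<in> carrier H" "y \<in> carrier H"
  shows "cinner H x (\<ominus> y) = - cinner H x y"
  using cinner_add_right[of x y "\<ominus> y"] cinner_zero_right[of x] assms
  by (simp add: r_neg add_eq_0_iff)

lemma cinner_a_inv_left:
  assumes "x \<in> carrier H" "y \<in> carrier H"
  shows "cinner H (\<ominus> y) x = - cinner H y x"
  using cinner_add_left[of x y "\<ominus> y"] cinner_zero_left[of x] assms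
  by (simp add: r_neg add_eq_0_iff)

lemma cinner_minus_right:
  assumes "x \<in> carrier H" "y \<in> carrier H" "z \<in> carrier H"
  shows "cinner H x (y \<ominus> z) = cinner H x y - cinner H x z"
  using assms by (simp add: a_minus_def cinner_add_right cinner_a_inv_right)

lemma cinner_minus_left:
  assumes "x \<in> carrier H" "y \<in> carrier H" "z \<in> carrier H"
  shows "cinner H (y \<ominus> z) x = cinner H y x - cinner H z x"
  using assms by (simp add: a_minus_def cinner_add_left cinner_a_inv_left)

lemmas cinner_simps = cinner_add_right cinner_add_left cinner_smult_right cinner_smult_left
  cinner_zero_right cinner_zero_left cinner_a_inv_right cinner_a_inv_left
  cinner_minus_right cinner_minus_left

lemma minus_in_carrier [simp, intro]: "\<lbrakk>x \<in> carrier H; y \<in> carrier H\<rbrakk> \<Longrightarrow> x \<ominus> y \<in> carrier H"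
  by (simp add: a_minus_def)

lemma minus_eq_zero_iff: "\<lbrakk>x \<in> carrier H; y \<in> carrier H\<rbrakk> \<Longrightarrow> x \<ominus> y = \<zero> \<longleftrightarrow> x = y"
  by (metis a_minus_def add.inv_closed add.inv_inv minus_equality r_neg)

lemma a_minus_zero: "x \<in> carrier H \<Longrightarrow> x \<ominus> \<zero> = x"
  using minus_eq_zero_iff[of \<zero> \<zero>] by (simp add: a_minus_def)

text \<open>The difference is orthogonal to itself. The locale postulates no module laws for
  \<open>\<odot>\<close>; they, and most vector identities below, are obtained by testing both sides
  against all \<open>z\<close>.\<close>

lemma cinner_eqI:
  assumes "x \<in> carrier H" "y \<in> carrier H" "\<And>z. z \<in> carrier H \<Longrightarrow> cinner H z x = cinner H z y"
  shows "x = y"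
proof -
  have "x \<ominus> y = \<zero>"
    by (rule cinner_self_eq_0D) (use assms in \<open>auto simp: cinner_simps\<close>)
  then show ?thesis using assms by (simp add: minus_eq_zero_iff)
qed

lemma power2_vnorm: "x \<in> carrier H \<Longrightarrow> (vnorm H x)\<^sup>2 = Re (cinner H x x)"
  by (simp add: vnorm_def cinner_self_nonneg)

lemma cinner_self: "x \<in> carrier H \<Longrightarrow> cinner H x x = of_real ((vnorm H x)\<^sup>2)"
  using arg_cong[OF cinner_commute, of x x Im] by (simp add: power2_vnorm complex_eq_iff)

lemma vnorm_nonneg [simp]: "x \<in> carrier H \<Longrightarrow> 0 \<le> vnorm H x"
  by (simp add: vnorm_def cinner_self_nonneg)

lemma vnorm_eq_0_iff: "x \<in> carrier H \<Longrightarrow> vnorm H x = 0 \<longleftrightarrow> x = \<zero>"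
  using cinner_self[of x] cinner_self_eq_0D[of x] cinner_zero_right[of x] by auto

lemma vnorm_zero [simp]: "vnorm H \<zero> = 0"
  by (simp add: vnorm_eq_0_iff)

lemma vnorm_smult:
  assumes x: "x \<in> carrier H"
  shows "vnorm H (c \<odot> x) = cmod c * vnorm H x"
proof (rule power2_eq_imp_eq)
  have "cinner H (c \<odot> x) (c \<odot> x) = (c * cnj c) * cinner H x x"
    using x by (simp add: cinner_simps)
  also have "\<dots> = of_real ((cmod c)\<^sup>2 * (vnorm H x)\<^sup>2)"
    using x by (simp only: cinner_self complex_norm_square[symmetric] of_real_mult)
  finally show "(vnorm H (c \<odot> x))\<^sup>2 = (cmod c * vnorm H x)\<^sup>2"
    using x by (simp add: power2_vnorm[of "c \<odot> x"] power_mult_distrib)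
qed (use x in simp_all)

lemma Cauchy_Schwarz:
  assumes x: "x \<in> carrier H" and y: "y \<in> carrier H"
  shows "cmod (cinner H x y) \<le> vnorm H x * vnorm H y"
proof (cases "vnorm H y = 0")
  case True
  with x y show ?thesis by (simp add: vnorm_eq_0_iff cinner_simps)
next
  case False
  define n where "n = (vnorm H y)\<^sup>2"
  have n: "n > 0" using False by (simp add: n_def)
  \<comment> \<open>\<open>c \<odot> y\<close> is the orthogonal projection of \<open>x\<close> onto
    the line through \<open>y\<close>; the claim is that the square norm of the remainder is
    nonnegative.\<close>
  define c where "c = cinner H y x / of_real n"
  have yy: "cinner H y y = of_real n" using y by (simp add: cinner_self n_def)
  have yx: "cinner H y x = cnj (cinner H x y)" by (rule cinner_commute[OF y x])
  have "cinner H (x \<ominus> c \<odot> y) (x \<ominus> c \<odot> y)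
    = cinner H x x - c * cinner H x y - cnj c * cinner H y x + cnj c * c * of_real n"
    using x y by (simp add: cinner_simps yy algebra_simps)
  also have "\<dots> = cinner H x x - cinner H x y * cnj (cinner H x y) / of_real n"
    using n by (simp add: c_def yx field_simps)
  also have "\<dots> = of_real ((vnorm H x)\<^sup>2 - (cmod (cinner H x y))\<^sup>2 / n)"
    using x by (simp add: cinner_self complex_norm_square[symmetric])
  finally have "(cmod (cinner H x y))\<^sup>2 / n \<le> (vnorm H x)\<^sup>2"
    using cinner_self_nonneg[of "x \<ominus> c \<odot> y"] x y by simp
  then have "(cmod (cinner H x y))\<^sup>2 \<le> (vnorm H x * vnorm H y)\<^sup>2"
    using n by (simp add: n_def power_mult_distrib field_simps)
  then show ?thesis using x y by (simp add: power2_le_iff_abs_le)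
qed

lemma vnorm_triangle:
  assumes x: "x \<in> carrier H" and y: "y \<in> carrier H"
  shows "vnorm H (x \<oplus> y) \<le> vnorm H x + vnorm H y"
proof -
  have "(vnorm H (x \<oplus> y))\<^sup>2 = (vnorm H x)\<^sup>2 + (vnorm H y)\<^sup>2 + 2 * Re (cinner H x y)"
    using x y cinner_commute[OF x y] by (simp add: power2_vnorm cinner_simps)
  also have "\<dots> \<le> (vnorm H x + vnorm H y)\<^sup>2"
    using Cauchy_Schwarz[OF x y] abs_Re_le_cmod[of "cinner H x y"]
    by (simp add: power2_sum)
  finally show ?thesis using x y by (simp add: power2_le_iff_abs_le)
qed

text \<open>The form in which a sum of two square summable families is dominated by a summable
  one.\<close>

lemma vnorm_add_power2_le:
  assumes "x \<in> carrier H" "y \<in> carrier H"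
  shows "(vnorm H (x \<oplus> y))\<^sup>2 \<le> 2 * (vnorm H x)\<^sup>2 + 2 * (vnorm H y)\<^sup>2"
proof -
  have "(vnorm H (x \<oplus> y))\<^sup>2 \<le> (vnorm H x + vnorm H y)\<^sup>2"
    using assms vnorm_triangle by (intro power_mono) auto
  then show ?thesis using zero_le_power2[of "vnorm H x - vnorm H y"]
    by (simp add: power2_sum power2_diff)
qed

lemma vdist_nonneg [simp]: "\<lbrakk>x \<in> carrier H; y \<in> carrier H\<rbrakk> \<Longrightarrow> 0 \<le> vdist H x y"
  by (simp add: vdist_def)

lemma vdist_self [simp]: "x \<in> carrier H \<Longrightarrow> vdist H x x = 0"
  by (simp add: vdist_def a_minus_def r_neg)

lemma power2_vdist: "\<lbrakk>x \<in> carrier H; y \<in> carrier H\<rbrakk> \<Longrightarrow>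
    (vdist H x y)\<^sup>2 = (vnorm H x)\<^sup>2 + (vnorm H y)\<^sup>2 - 2 * Re (cinner H x y)"
  using cinner_commute[of x y] by (simp add: vdist_def power2_vnorm cinner_simps)

lemma vdist_commute: "\<lbrakk>x \<in> carrier H; y \<in> carrier H\<rbrakk> \<Longrightarrow> vdist H x y = vdist H y x"
  by (rule power2_eq_imp_eq) (simp_all add: power2_vdist cinner_commute[of x y])

lemma vdist_eq_0_iff: "\<lbrakk>x \<in> carrier H; y \<in> carrier H\<rbrakk> \<Longrightarrow> vdist H x y = 0 \<longleftrightarrow> x = y"
  by (simp add: vdist_def vnorm_eq_0_iff minus_eq_zero_iff)

lemma vdist_triangle:
  assumes "x \<in> carrier H" "y \<in> carrier H" "z \<in> carrier H"
  shows "vdist H x z \<le> vdist H x y + vdist H y z"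
proof -
  have "x \<ominus> z = (x \<ominus> y) \<oplus> (y \<ominus> z)"
    by (rule cinner_eqI) (use assms in \<open>auto simp: cinner_simps\<close>)
  then show ?thesis using assms vnorm_triangle[of "x \<ominus> y" "y \<ominus> z"] by (simp add: vdist_def)
qed

lemma abs_vnorm_diff_le:
  assumes "x \<in> carrier H" "y \<in> carrier H"
  shows "\<bar>vnorm H x - vnorm H y\<bar> \<le> vdist H x y"
proof -
  have *: "vdist H z \<zero> = vnorm H z" if "z \<in> carrier H" for z
    using that a_minus_zero[OF that] by (simp add: vdist_def)
  show ?thesis
    using vdist_triangle[of x y \<zero>] vdist_triangle[of y x \<zero>] assms by (simp add: * vdist_commute)
qed

lemma vdist_eqI:
  assumes "x \<in> carrier H" "y \<in> carrier H" "\<And>e. e > 0 \<Longrightarrow> vdist H x y \<le> e"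
  shows "x = y"
proof -
  have "vdist H x y \<le> 0" by (rule field_le_epsilon) (simp add: assms(3))
  then show ?thesis using assms(1,2) vdist_nonneg[of x y] vdist_eq_0_iff[of x y] by linarith
qed

text \<open>The difference \<open>w\<close> is orthogonal to \<open>A\<close>. If \<open>a\<close>
  in \<open>A\<close> is close to \<open>w\<close>, then the square norm of \<open>w\<close> equals
  \<open>- cinner H (a \<ominus> w) w\<close>, which Cauchy-Schwarz makes small.\<close>

lemma dense_cinner_eqI:
  assumes A: "dense_in H A" and x: "x \<in> carrier H" and y: "y \<in> carrier H"
    and eq: "\<And>a. a \<in> A \<Longrightarrow> cinner H a x = cinner H a y"
  shows "x = y"
proof -
  define w where "w = x \<ominus> y"
  have w: "w \<in> carrier H" using x y by (simp add: w_def)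
  have "vnorm H w \<le> e" if e: "e > 0" for e
  proof -
    obtain a where a: "a \<in> A" "vdist H a w < e" using A w e unfolding dense_in_def by blast
    have aH: "a \<in> carrier H" using A a by (auto simp: dense_in_def)
    have "cinner H a w = 0" using eq[OF a(1)] aH x y by (simp add: w_def cinner_simps)
    then have "cinner H w w = - cinner H (a \<ominus> w) w" using aH w by (simp add: cinner_simps)
    then have "(vnorm H w)\<^sup>2 \<le> cmod (cinner H (a \<ominus> w) w)"
      using cinner_self[OF w] by (metis abs_of_nonneg norm_minus_cancel norm_of_real order_refl zero_le_power2)
    also have "\<dots> \<le> vdist H a w * vnorm H w"
      using Cauchy_Schwarz[of "a \<ominus> w" w] aH w by (simp add: vdist_def)
    finally have "vnorm H w * vnorm H w \<le> vdist H a w * vnorm H w" by (simp add: power2_eq_square)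
    then have "vnorm H w = 0 \<or> vnorm H w \<le> vdist H a w"
      using vnorm_nonneg[OF w] by (auto simp: mult_le_cancel_right)
    then show ?thesis using a(2) e by linarith
  qed
  then have "vnorm H w \<le> 0" using field_le_epsilon[of "vnorm H w" 0] by auto
  then have "vnorm H w = 0" using vnorm_nonneg[OF w] by linarith
  then show ?thesis using w x y by (simp add: vnorm_eq_0_iff w_def minus_eq_zero_iff)
qed

end

section \<open>Completeness and the Riesz representation theorem\<close>

locale hilbert_space = inner_space +
  assumes complete: "\<lbrakk>\<And>n. X n \<in> carrier H;
      \<And>e. e > 0 \<Longrightarrow> \<exists>N. \<forall>m\<ge>N. \<forall>n\<ge>N. vdist H (X m) (X n) < e\<rbrakk>
    \<Longrightarrow> \<exists>x\<in>carrier H. (\<lambda>n. vdist H (X n) x) \<longlonglongrightarrow> (0::real)"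
begin

text \<open>The representing vector minimises \<open>\<parallel>x\<parallel>\<^sup>2 - 2 Re (\<phi> x)\<close>.\<close>

lemma Riesz_representation:
  assumes add: "\<And>x y. \<lbrakk>x \<in> carrier H; y \<in> carrier H\<rbrakk> \<Longrightarrow> \<phi> (x \<oplus> y) = \<phi> x + \<phi> y"
    and scale: "\<And>c x. x \<in> carrier H \<Longrightarrow> \<phi> (c \<odot> x) = c * \<phi> x"
    and bound: "\<And>x. x \<in> carrier H \<Longrightarrow> cmod (\<phi> x) \<le> b * vnorm H x"
  shows "\<exists>z\<in>carrier H. \<forall>x\<in>carrier H. \<phi> x = cinner H z x"
proof -
  define q where "q x = (vnorm H x)\<^sup>2 - 2 * Re (\<phi> x)" for x
  define m where "m = Inf (q ` carrier H)"
  \<comment> \<open>Completing the square: \<open>vnorm H x - b\<close> has a nonnegative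
    square.\<close>
  have q_ge: "- b\<^sup>2 \<le> q x" if "x \<in> carrier H" for x
  proof -
    have "Re (\<phi> x) \<le> b * vnorm H x" using bound[OF that] complex_Re_le_cmod[of "\<phi> x"] by linarith
    then show ?thesis using zero_le_power2[of "vnorm H x - b"]
      by (simp add: q_def power2_diff mult.commute)
  qed
  have bdd: "bdd_below (q ` carrier H)" by (rule bdd_belowI2) (rule q_ge)
  have m_le: "m \<le> q x" if "x \<in> carrier H" for x
    unfolding m_def using bdd that by (auto intro: cInf_lower)
  have "\<exists>x. x \<in> carrier H \<and> q x < m + 1 / real (Suc n)" for n
  proof -
    have "Inf (q ` carrier H) < m + 1 / real (Suc n)" by (simp add: m_def)
    then show ?thesis using bdd cInf_less_iff[of "q ` carrier H"] by (auto intro: exI[of _ \<zero>])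
  qed
  then obtain X where X: "\<And>n. X n \<in> carrier H" "\<And>n. q (X n) < m + 1 / real (Suc n)" by metis
  \<comment> \<open>The midpoint \<open>h\<close> still satisfies \<open>m \<le> q h\<close>. The
    parallelogram law turns this into closeness of \<open>X i\<close> and \<open>X j\<close>, so the
    minimising sequence is Cauchy.\<close>
  have dist2: "(vdist H (X i) (X j))\<^sup>2 \<le> 2 / real (Suc i) + 2 / real (Suc j)" for i j
  proof -
    define h where "h = (1/2) \<odot> (X i \<oplus> X j)"
    have hH: "h \<in> carrier H" using X by (simp add: h_def)
    have h: "\<phi> h = (\<phi> (X i) + \<phi> (X j)) / 2" using X by (simp add: h_def scale add)
    have "4 * (vnorm H h)\<^sup>2 = (vnorm H (X i))\<^sup>2 + (vnorm H (X j))\<^sup>2 + 2 * Re (cinner H (X i) (X j))"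
      using X cinner_commute[of "X i" "X j"]
      by (simp add: h_def power2_vnorm cinner_simps) (simp add: field_simps)
    then have "(vdist H (X i) (X j))\<^sup>2 = 2 * q (X i) + 2 * q (X j) - 4 * q h"
      using X by (simp add: power2_vdist q_def h algebra_simps)
    then show ?thesis using m_le[OF hH] X(2)[of i] X(2)[of j] by simp
  qed
  have "\<exists>N. \<forall>i\<ge>N. \<forall>j\<ge>N. vdist H (X i) (X j) < e" if e: "e > 0" for e
  proof -
    \<comment> \<open>Beyond \<open>N\<close> each of the two terms of \<open>dist2\<close> is at
      most \<open>2 / N\<close>.\<close>
    obtain N where N: "4 / e\<^sup>2 < real N" using reals_Archimedean2 by blast
    have "vdist H (X i) (X j) < e" if "i \<ge> N" "j \<ge> N" for i j
    proof -
      have "N > 0" using N e by (metis divide_pos_pos gr0I of_nat_0 order_less_asym zero_less_numeral zero_less_power)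
      have "2 / real (Suc i) \<le> 2 / real N" "2 / real (Suc j) \<le> 2 / real N"
        using that \<open>N > 0\<close> by (auto intro!: divide_left_mono)
      then have "(vdist H (X i) (X j))\<^sup>2 \<le> 4 / real N" using dist2[of i j] by simp
      also have "\<dots> < e\<^sup>2" using N e \<open>N > 0\<close> by (simp add: field_simps)
      finally show ?thesis using e by (meson power2_less_imp_less less_imp_le)
    qed
    then show ?thesis by blast
  qed
  then obtain z where z: "z \<in> carrier H" and lim: "(\<lambda>n. vdist H (X n) z) \<longlonglongrightarrow> 0"
    using complete[of X] X(1) by blast
  have "(\<lambda>n. vnorm H (X n) - vnorm H z) \<longlonglongrightarrow> 0"
    by (rule tendsto_rabs_zero_cancel, rule tendsto_sandwich[OF _ _ tendsto_const lim])
      (auto simp: abs_vnorm_diff_le X z)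
  then have l1: "(\<lambda>n. vnorm H (X n)) \<longlonglongrightarrow> vnorm H z" by (simp add: LIM_zero_iff)
  have \<phi>_diff: "\<phi> (x \<ominus> y) = \<phi> x - \<phi> y" if "x \<in> carrier H" "y \<in> carrier H" for x y
  proof -
    have "x \<ominus> y = x \<oplus> (-1) \<odot> y" by (rule cinner_eqI) (use that in \<open>auto simp: cinner_simps\<close>)
    then show ?thesis using that by (simp add: add scale)
  qed
  have "(\<lambda>n. \<phi> (X n) - \<phi> z) \<longlonglongrightarrow> 0"
  proof (rule tendsto_norm_zero_cancel, rule tendsto_sandwich[OF _ _ tendsto_const])
    show "(\<lambda>n. b * vdist H (X n) z) \<longlonglongrightarrow> 0" using tendsto_mult_right_zero[OF lim] .
    show "\<forall>\<^sub>F n in sequentially. cmod (\<phi> (X n) - \<phi> z) \<le> b * vdist H (X n) z"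
      using bound[of "X _ \<ominus> z"] X z by (auto simp: \<phi>_diff vdist_def)
  qed auto
  then have l2: "(\<lambda>n. \<phi> (X n)) \<longlonglongrightarrow> \<phi> z" by (simp add: LIM_zero_iff)
  have "(\<lambda>n. q (X n)) \<longlonglongrightarrow> q z" unfolding q_def by (intro tendsto_intros l1 l2)
  moreover have "(\<lambda>n. m + 1 / real (Suc n)) \<longlonglongrightarrow> m + 0"
    using LIMSEQ_inverse_real_of_nat by (intro tendsto_intros) (simp add: inverse_eq_divide)
  ultimately have "q z \<le> m + 0"
    by (rule LIMSEQ_le) (use X(2) in \<open>auto intro: less_imp_le\<close>)
  then have min: "q z \<le> q x" if "x \<in> carrier H" for x using m_le[OF that] by simp
  have Re_eq: "Re (cinner H z h) = Re (\<phi> h)" if h: "h \<in> carrier H" for h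
  proof -
    \<comment> \<open>\<open>2 * r\<close> is the derivative of \<open>q\<close> at the minimiser
      \<open>z\<close> in the direction \<open>h\<close>.\<close>
    define r where "r = Re (cinner H z h) - Re (\<phi> h)"
    have nonneg: "0 \<le> 2 * t * r + t\<^sup>2 * (vnorm H h)\<^sup>2" for t :: real
    proof -
      have "q (z \<oplus> of_real t \<odot> h) = q z + 2 * t * r + t\<^sup>2 * (vnorm H h)\<^sup>2"
        using z h cinner_commute[OF z h]
        by (simp add: q_def power2_vnorm cinner_simps add scale r_def)
          (simp add: algebra_simps power2_eq_square)
      then show ?thesis using min[of "z \<oplus> of_real t \<odot> h"] z h by simp
    qed
    define s where "s = (vnorm H h)\<^sup>2"
    \<comment> \<open>A step against the sign of the derivative. The \<open>+ 1\<close> keeps the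
      denominator positive when \<open>h\<close> is zero, and the value obtained is negative unless
      \<open>r = 0\<close>.\<close>
    have "0 \<le> 2 * (- r / (s + 1)) * r + (- r / (s + 1))\<^sup>2 * s"
      unfolding s_def by (rule nonneg)
    also have "\<dots> = - (r\<^sup>2 * (s + 2)) / (s + 1)\<^sup>2"
    proof -
      have "s + 1 \<noteq> 0" by (smt (verit) s_def zero_le_power2)
      then show ?thesis by (simp add: power2_eq_square divide_simps) (simp add: algebra_simps)
    qed
    finally have *: "r\<^sup>2 * (s + 2) / (s + 1)\<^sup>2 \<le> 0" by simp
    have s: "s \<ge> 0" by (simp add: s_def)
    have "r = 0"
    proof (rule ccontr)
      assume "r \<noteq> 0"
      then have "r\<^sup>2 * (s + 2) / (s + 1)\<^sup>2 > 0" using s by (intro divide_pos_pos mult_pos_pos) auto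
      with * show False by simp
    qed
    then show ?thesis by (simp add: r_def)
  qed
  \<comment> \<open>The real parts at \<open>\<i> \<odot> h\<close> give the imaginary parts at
    \<open>h\<close>.\<close>
  have "\<phi> h = cinner H z h" if h: "h \<in> carrier H" for h
    using Re_eq[OF h] Re_eq[of "\<i> \<odot> h"] h z by (simp add: complex_eq_iff cinner_simps scale)
  with z show ?thesis by blast
qed

end

subsection \<open>Bounded operators\<close>

context inner_space begin

lemma bopI:
  assumes "A \<in> carrier H \<rightarrow>\<^sub>E carrier H"
    and "\<And>x y. \<lbrakk>x \<in> carrier H; y \<in> carrier H\<rbrakk> \<Longrightarrow> A (x \<oplus> y) = A x \<oplus> A y"
    and "\<And>c x. x \<in> carrier H \<Longrightarrow> A (c \<odot> x) = c \<odot> A x"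
    and "\<And>x. x \<in> carrier H \<Longrightarrow> vnorm H (A x) \<le> b * vnorm H x"
  shows "A \<in> bop H"
  unfolding bop_def mem_Collect_eq
  by (intro conjI ballI allI exI[of _ b]) (simp_all only: assms)

lemma bop_closed [intro]: "\<lbrakk>A \<in> bop H; x \<in> carrier H\<rbrakk> \<Longrightarrow> A x \<in> carrier H"
  unfolding bop_def by blast

lemma bop_extensional: "A \<in> bop H \<Longrightarrow> A \<in> extensional (carrier H)"
  unfolding bop_def by (auto simp: PiE_def)

lemma bop_add: "\<lbrakk>A \<in> bop H; x \<in> carrier H; y \<in> carrier H\<rbrakk> \<Longrightarrow> A (x \<oplus> y) = A x \<oplus> A y"
  unfolding bop_def by blast

lemma bop_smult: "\<lbrakk>A \<in> bop H; x \<in> carrier H\<rbrakk> \<Longrightarrow> A (c \<odot> x) = c \<odot> A x"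
  unfolding bop_def by blast

lemma a_minus_eq_smult: "\<lbrakk>x \<in> carrier H; y \<in> carrier H\<rbrakk> \<Longrightarrow> x \<ominus> y = x \<oplus> (-1) \<odot> y"
  by (rule cinner_eqI) (auto simp: cinner_simps)

lemma zero_eq_smult: "x \<in> carrier H \<Longrightarrow> \<zero> = 0 \<odot> x"
  by (rule cinner_eqI) (auto simp: cinner_simps)

lemma bop_minus: "\<lbrakk>A \<in> bop H; x \<in> carrier H; y \<in> carrier H\<rbrakk> \<Longrightarrow> A (x \<ominus> y) = A x \<ominus> A y"
  by (simp add: a_minus_eq_smult bop_closed bop_add bop_smult)

lemma bop_zero: "A \<in> bop H \<Longrightarrow> A \<zero> = \<zero>"
  using bop_smult[of A \<zero> 0] zero_eq_smult[of \<zero>] zero_eq_smult[of "A \<zero>"] by (simp add: bop_closed)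

lemma bop_bound:
  assumes "A \<in> bop H"
  obtains b where "b \<ge> 0" "\<And>x. x \<in> carrier H \<Longrightarrow> vnorm H (A x) \<le> b * vnorm H x"
proof -
  obtain b where b: "\<forall>x\<in>carrier H. vnorm H (A x) \<le> b * vnorm H x"
    using assms by (auto simp: bop_def)
  show thesis
  proof (rule that[of "max b 0"])
    fix x assume x: "x \<in> carrier H"
    have "b * vnorm H x \<le> max b 0 * vnorm H x" using x by (intro mult_right_mono) auto
    with b x show "vnorm H (A x) \<le> max b 0 * vnorm H x" by (meson order_trans)
  qed simp
qed

lemma bop_eqI:
  assumes "A \<in> bop H" "B \<in> bop H" "\<And>x. x \<in> carrier H \<Longrightarrow> A x = B x"
  shows "A = B"
  using assms by (meson bop_extensional extensionalityI)

lemma op_mult_apply [simp]: "x \<in> carrier H \<Longrightarrow> op_mult H A B x = A (B x)"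
  by (simp add: op_mult_def compose_eq)

lemma op_add_apply [simp]: "x \<in> carrier H \<Longrightarrow> op_add H A B x = A x \<oplus> B x"
  by (simp add: op_add_def)

lemma op_scale_apply [simp]: "x \<in> carrier H \<Longrightarrow> op_scale H c A x = c \<odot> A x"
  by (simp add: op_scale_def)

lemma op_id_apply [simp]: "x \<in> carrier H \<Longrightarrow> op_id H x = x"
  by (simp add: op_id_def)

lemma op_zero_apply [simp]: "x \<in> carrier H \<Longrightarrow> op_zero H x = \<zero>"
  by (simp add: op_zero_def)

lemma op_id_in_bop: "op_id H \<in> bop H"
  by (rule bopI[where b = 1]) (auto simp: op_id_def)

lemma op_zero_in_bop: "op_zero H \<in> bop H"
  by (rule bopI[where b = 0])
    (auto simp: op_zero_def simp flip: zero_eq_smult intro!: cinner_eqI simp: cinner_simps)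

lemma op_mult_in_bop:
  assumes A: "A \<in> bop H" and B: "B \<in> bop H"
  shows "op_mult H A B \<in> bop H"
proof -
  obtain a where a: "a \<ge> 0" "\<And>x. x \<in> carrier H \<Longrightarrow> vnorm H (A x) \<le> a * vnorm H x"
    using bop_bound[OF A] by blast
  obtain b where b: "b \<ge> 0" "\<And>x. x \<in> carrier H \<Longrightarrow> vnorm H (B x) \<le> b * vnorm H x"
    using bop_bound[OF B] by blast
  show ?thesis
  proof (rule bopI)
    show "op_mult H A B \<in> carrier H \<rightarrow>\<^sub>E carrier H"
      using A B by (auto simp: op_mult_def compose_def)
    fix x assume x: "x \<in> carrier H"
    have "vnorm H (A (B x)) \<le> a * (b * vnorm H x)"
      using a(2)[of "B x"] mult_left_mono[OF b(2)[OF x] a(1)] bop_closed[OF B x] by linarith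
    then show "vnorm H (op_mult H A B x) \<le> (a * b) * vnorm H x" using x by (simp add: mult.assoc)
  qed (use A B in \<open>auto simp: bop_add bop_smult bop_closed\<close>)
qed

lemma smult_add: "\<lbrakk>x \<in> carrier H; y \<in> carrier H\<rbrakk> \<Longrightarrow> c \<odot> (x \<oplus> y) = c \<odot> x \<oplus> c \<odot> y"
  by (rule cinner_eqI) (auto simp: cinner_simps algebra_simps)

lemma smult_zero: "c \<odot> \<zero> = \<zero>"
  by (rule cinner_eqI) (auto simp: cinner_simps)

lemma smult_smult: "x \<in> carrier H \<Longrightarrow> c \<odot> (d \<odot> x) = (c * d) \<odot> x"
  by (rule cinner_eqI) (auto simp: cinner_simps algebra_simps)

lemma op_add_in_bop:
  assumes A: "A \<in> bop H" and B: "B \<in> bop H"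
  shows "op_add H A B \<in> bop H"
proof -
  obtain a where a: "a \<ge> 0" "\<And>x. x \<in> carrier H \<Longrightarrow> vnorm H (A x) \<le> a * vnorm H x"
    using bop_bound[OF A] by blast
  obtain b where b: "b \<ge> 0" "\<And>x. x \<in> carrier H \<Longrightarrow> vnorm H (B x) \<le> b * vnorm H x"
    using bop_bound[OF B] by blast
  show ?thesis
  proof (rule bopI)
    show "op_add H A B \<in> carrier H \<rightarrow>\<^sub>E carrier H"
      using A B by (auto simp: op_add_def bop_closed)
    fix x assume x: "x \<in> carrier H"
    show "vnorm H (op_add H A B x) \<le> (a + b) * vnorm H x"
      using a(2)[OF x] b(2)[OF x] vnorm_triangle[of "A x" "B x"] A B x
      by (simp add: bop_closed algebra_simps)
  qed (use A B in \<open>auto simp: bop_add bop_smult bop_closed smult_add a_ac\<close>)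
qed

lemma op_scale_in_bop:
  assumes A: "A \<in> bop H"
  shows "op_scale H c A \<in> bop H"
proof -
  obtain a where a: "a \<ge> 0" "\<And>x. x \<in> carrier H \<Longrightarrow> vnorm H (A x) \<le> a * vnorm H x"
    using bop_bound[OF A] by blast
  show ?thesis
  proof (rule bopI)
    show "op_scale H c A \<in> carrier H \<rightarrow>\<^sub>E carrier H"
      using A by (auto simp: op_scale_def bop_closed)
    fix x assume x: "x \<in> carrier H"
    show "vnorm H (op_scale H c A x) \<le> (cmod c * a) * vnorm H x"
      using mult_left_mono[OF a(2)[OF x], of "cmod c"] A x
      by (simp add: bop_closed vnorm_smult algebra_simps)
  qed (use A in \<open>auto simp: bop_add bop_smult bop_closed smult_add smult_smult mult.commute\<close>)
qed


subsection \<open>Commutants\<close>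

lemma commutant_subset_bop: "commutant H S \<subseteq> bop H"
  by (auto simp: commutant_def)

lemma commutantI:
  assumes "B \<in> bop H" "S \<subseteq> bop H" "\<And>A x. \<lbrakk>A \<in> S; x \<in> carrier H\<rbrakk> \<Longrightarrow> A (B x) = B (A x)"
  shows "B \<in> commutant H S"
  using assms unfolding commutant_def by (auto intro!: bop_eqI op_mult_in_bop)

lemma commutantD:
  assumes "B \<in> commutant H S" "A \<in> S" "x \<in> carrier H"
  shows "A (B x) = B (A x)"
proof -
  have "op_mult H A B = op_mult H B A" using assms by (auto simp: commutant_def)
  then show ?thesis using assms(3) by (metis op_mult_apply)
qed

lemma commutant_antimono: "S \<subseteq> S' \<Longrightarrow> commutant H S' \<subseteq> commutant H S"
  by (auto simp: commutant_def)

lemma subset_bicommutant: "S \<subseteq> bop H \<Longrightarrow> S \<subseteq> commutant H (commutant H S)"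
  unfolding commutant_def by auto

lemma commutant_bicommutant:
  "S \<subseteq> bop H \<Longrightarrow> commutant H (commutant H (commutant H S)) = commutant H S"
  using subset_bicommutant[of "commutant H S"] commutant_antimono[OF subset_bicommutant, of S]
  by (simp add: commutant_subset_bop subset_antisym)

lemma op_id_in_commutant: "S \<subseteq> bop H \<Longrightarrow> op_id H \<in> commutant H S"
  by (rule commutantI) (auto simp: op_id_in_bop bop_closed subset_iff)

lemma op_mult_in_commutant:
  assumes "S \<subseteq> bop H" "A \<in> commutant H S" "B \<in> commutant H S"
  shows "op_mult H A B \<in> commutant H S"
proof (rule commutantI)
  have AB: "A \<in> bop H" "B \<in> bop H" using assms commutant_subset_bop by auto
  then show "op_mult H A B \<in> bop H" by (rule op_mult_in_bop)
  fix C x assume *: "C \<in> S" "x \<in> carrier H"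
  then have "C \<in> bop H" using assms by auto
  with * AB show "C (op_mult H A B x) = op_mult H A B (C x)"
    using commutantD[OF assms(2) *(1), of "B x"] commutantD[OF assms(3) *]
    by (simp add: bop_closed)
qed fact

lemma op_add_in_commutant:
  assumes "S \<subseteq> bop H" "A \<in> commutant H S" "B \<in> commutant H S"
  shows "op_add H A B \<in> commutant H S"
proof (rule commutantI)
  have AB: "A \<in> bop H" "B \<in> bop H" using assms commutant_subset_bop by auto
  then show "op_add H A B \<in> bop H" by (rule op_add_in_bop)
  fix C x assume *: "C \<in> S" "x \<in> carrier H"
  then have "C \<in> bop H" using assms by auto
  with * AB show "C (op_add H A B x) = op_add H A B (C x)"
    using commutantD[OF assms(2) *] commutantD[OF assms(3) *]
    by (simp add: bop_closed bop_add)
qed fact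

lemma op_scale_in_commutant:
  assumes "S \<subseteq> bop H" "A \<in> commutant H S"
  shows "op_scale H c A \<in> commutant H S"
proof (rule commutantI)
  have A: "A \<in> bop H" using assms commutant_subset_bop by auto
  then show "op_scale H c A \<in> bop H" by (rule op_scale_in_bop)
  fix C x assume *: "C \<in> S" "x \<in> carrier H"
  then have "C \<in> bop H" using assms by auto
  with * A show "C (op_scale H c A x) = op_scale H c A (C x)"
    using commutantD[OF assms(2) *] by (simp add: bop_closed bop_smult)
qed fact

text \<open>An \<open>A\<close> in \<open>N\<close> that kills \<Omega> also kills
  \<open>B \<Omega>\<close> for every \<open>B\<close> in the commutant, since
  \<open>A (B \<Omega>) = B (A \<Omega>)\<close>. These vectors are dense and \<open>A\<close> is
  bounded.\<close>

lemma separating_if_cyclic_for_commutant: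
  assumes N: "N \<subseteq> bop H" and cyc: "cyclic H (commutant H N) \<Omega>"
  shows "separating H N \<Omega>"
  unfolding separating_def
proof (intro conjI ballI impI)
  show \<Omega>: "\<Omega> \<in> carrier H" using cyc by (simp add: cyclic_def)
  fix A assume A: "A \<in> N" "A \<Omega> = \<zero>"
  have AH: "A \<in> bop H" using A N by auto
  obtain b where b: "b \<ge> 0" "\<And>x. x \<in> carrier H \<Longrightarrow> vnorm H (A x) \<le> b * vnorm H x"
    using bop_bound[OF AH] by blast
  have "A x = \<zero>" if x: "x \<in> carrier H" for x
  proof (rule vdist_eqI)
    fix e :: real assume e: "e > 0"
    \<comment> \<open>Dividing by \<open>b + 1\<close> also covers a bound
      \<open>b = 0\<close>.\<close>
    then obtain B where B: "B \<in> commutant H N" "vdist H (B \<Omega>) x < e / (b + 1)"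
      using cyc x b(1) unfolding cyclic_def dense_in_def by (smt (verit) divide_pos_pos mem_Collect_eq)
    have BH: "B \<in> bop H" using B commutant_subset_bop by auto
    have "A (B \<Omega>) = \<zero>" using commutantD[OF B(1) A(1) \<Omega>] A(2) bop_zero[OF BH] by simp
    then have "A x = A (x \<ominus> B \<Omega>)" using x AH BH \<Omega> by (simp add: bop_minus bop_closed a_minus_zero)
    then have "vdist H (A x) \<zero> \<le> b * vdist H x (B \<Omega>)"
      using b(2)[of "x \<ominus> B \<Omega>"] x BH \<Omega> AH by (simp add: vdist_def bop_closed a_minus_zero)
    also have "\<dots> \<le> b * (e / (b + 1))"
      using B(2) b(1) x BH \<Omega> by (intro mult_left_mono) (auto simp: vdist_commute bop_closed)
    also have "\<dots> \<le> e" using b(1) e by (simp add: field_simps)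
    finally show "vdist H (A x) \<zero> \<le> e" .
  qed (use x AH in auto)
  then show "A = op_zero H" using AH by (intro bop_eqI) (auto simp: op_zero_in_bop)
qed

end


subsection \<open>Adjoints\<close>

context hilbert_space begin

text \<open>\<open>B x\<close> is the Riesz vector of the functional
  \<open>y \<mapsto> cinner H x (A y)\<close>. Linearity of \<open>B\<close> is then a matter of
  testing, because \<open>B\<close> is already characterised by its inner products.\<close>

lemma ex_adjoint:
  assumes A: "A \<in> bop H"
  shows "\<exists>B\<in>bop H. \<forall>x\<in>carrier H. \<forall>y\<in>carrier H. cinner H x (A y) = cinner H (B x) y"
proof -
  obtain b where b: "b \<ge> 0" "\<And>x. x \<in> carrier H \<Longrightarrow> vnorm H (A x) \<le> b * vnorm H x"
    using bop_bound[OF A] by blast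
  have "\<exists>z\<in>carrier H. \<forall>y\<in>carrier H. cinner H x (A y) = cinner H z y" if x: "x \<in> carrier H" for x
  proof (rule Riesz_representation)
    fix y assume y: "y \<in> carrier H"
    have "cmod (cinner H x (A y)) \<le> vnorm H x * vnorm H (A y)"
      using Cauchy_Schwarz x y A by (auto simp: bop_closed)
    also have "\<dots> \<le> vnorm H x * (b * vnorm H y)" using b(2)[OF y] x by (intro mult_left_mono) auto
    finally show "cmod (cinner H x (A y)) \<le> (vnorm H x * b) * vnorm H y" by (simp add: mult.assoc)
  qed (use x A in \<open>auto simp: bop_add bop_smult bop_closed cinner_simps\<close>)
  then obtain B0 where B0: "\<And>x. x \<in> carrier H \<Longrightarrow> B0 x \<in> carrier H"
    "\<And>x y. \<lbrakk>x \<in> carrier H; y \<in> carrier H\<rbrakk> \<Longrightarrow> cinner H x (A y) = cinner H (B0 x) y" by metis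
  define B where "B = restrict B0 (carrier H)"
  have B: "B x \<in> carrier H" "cinner H y (B x) = cinner H (A y) x"
    if "x \<in> carrier H" "y \<in> carrier H" for x y
    using that B0 A cinner_commute[of "B0 x" y] cinner_commute[of "A y" x]
    by (auto simp: B_def bop_closed cinner_commute[of y "B0 x"])
  have "B \<in> bop H"
  proof (rule bopI)
    fix x y assume xy: "x \<in> carrier H" "y \<in> carrier H"
    show "B (x \<oplus> y) = B x \<oplus> B y"
      by (rule cinner_eqI) (use xy A in \<open>auto simp: B cinner_simps bop_closed\<close>)
  next
    fix c x assume x: "x \<in> carrier H"
    show "B (c \<odot> x) = c \<odot> B x"
      by (rule cinner_eqI) (use x A in \<open>auto simp: B cinner_simps bop_closed\<close>)
    \<comment> \<open>The square norm of \<open>B x\<close> is a product containing the norm of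
      \<open>B x\<close>; cancelling this factor gives the bound of \<open>A\<close> for
      \<open>B\<close>.\<close>
    have "(vnorm H (B x))\<^sup>2 = Re (cinner H (A (B x)) x)" using x by (simp add: power2_vnorm B)
    also have "\<dots> \<le> vnorm H (A (B x)) * vnorm H x"
      using Cauchy_Schwarz[of "A (B x)" x] complex_Re_le_cmod[of "cinner H (A (B x)) x"] x A
      by (simp add: B bop_closed)
    also have "\<dots> \<le> b * vnorm H (B x) * vnorm H x" using b(2)[of "B x"] x
      by (intro mult_right_mono) (auto simp: B)
    finally have "vnorm H (B x) * vnorm H (B x) \<le> vnorm H (B x) * (b * vnorm H x)"
      by (simp add: power2_eq_square mult_ac)
    then show "vnorm H (B x) \<le> b * vnorm H x"
      using x b(1) vnorm_nonneg[of "B x"] mult_le_cancel_left[of "vnorm H (B x)"]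
      by (cases "vnorm H (B x) = 0") (auto simp: B less_le)
  qed (auto simp: B_def B0)
  then show ?thesis using B0(2) by (intro bexI[of _ B]) (auto simp: B_def)
qed

lemma adj_unique:
  assumes "B \<in> bop H" "B' \<in> bop H"
    and "\<And>x y. \<lbrakk>x \<in> carrier H; y \<in> carrier H\<rbrakk> \<Longrightarrow> cinner H x (A y) = cinner H (B x) y"
    and "\<And>x y. \<lbrakk>x \<in> carrier H; y \<in> carrier H\<rbrakk> \<Longrightarrow> cinner H x (A y) = cinner H (B' x) y"
  shows "B = B'"
proof (rule bop_eqI)
  fix x assume x: "x \<in> carrier H"
  show "B x = B' x"
  proof (rule cinner_eqI)
    fix z assume z: "z \<in> carrier H"
    have "cinner H (B x) z = cinner H (B' x) z" using assms(3,4) x z by metis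
    then show "cinner H z (B x) = cinner H z (B' x)"
      using x z assms(1,2) by (metis bop_closed cinner_commute)
  qed (use x assms in auto)
qed fact+

lemma adjI:
  assumes "B \<in> bop H"
    and "\<And>x y. \<lbrakk>x \<in> carrier H; y \<in> carrier H\<rbrakk> \<Longrightarrow> cinner H x (A y) = cinner H (B x) y"
  shows "adj H A = B"
  unfolding adj_def by (rule the_equality) (use assms adj_unique in blast)+

lemma
  assumes A: "A \<in> bop H"
  shows adj_in_bop: "adj H A \<in> bop H"
    and cinner_adj: "\<lbrakk>x \<in> carrier H; y \<in> carrier H\<rbrakk> \<Longrightarrow> cinner H (adj H A x) y = cinner H x (A y)"
proof -
  obtain B where B: "B \<in> bop H" "\<forall>x\<in>carrier H. \<forall>y\<in>carrier H. cinner H x (A y) = cinner H (B x) y"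
    using ex_adjoint[OF A] by blast
  then have "adj H A = B" by (intro adjI) auto
  with B show "adj H A \<in> bop H"
    "\<lbrakk>x \<in> carrier H; y \<in> carrier H\<rbrakk> \<Longrightarrow> cinner H (adj H A x) y = cinner H x (A y)" by auto
qed

lemma cinner_adj_right:
  assumes "A \<in> bop H" "x \<in> carrier H" "y \<in> carrier H"
  shows "cinner H x (adj H A y) = cinner H (A x) y"
  using cinner_adj[OF assms(1,3,2)] assms adj_in_bop[OF assms(1)]
    cinner_commute[of x "adj H A y"] cinner_commute[of "A x" y] by (simp add: bop_closed)

lemma adj_adj: "A \<in> bop H \<Longrightarrow> adj H (adj H A) = A"
  by (rule adjI) (auto simp: cinner_adj_right)

text \<open>Passing to adjoints replaces a continuity argument: for \<open>d\<close> in
  \<open>D\<close> the value \<open>cinner H d (adj H A y)\<close> depends only on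
  \<open>A d\<close>, so the adjoints agree by \<open>dense_cinner_eqI\<close>.\<close>

lemma bop_eq_on_dense:
  assumes A: "A \<in> bop H" and B: "B \<in> bop H" and D: "dense_in H D"
    and eq: "\<And>x. x \<in> D \<Longrightarrow> A x = B x"
  shows "A = B"
proof -
  have "adj H A = adj H B"
  proof (rule bop_eqI)
    fix y assume y: "y \<in> carrier H"
    show "adj H A y = adj H B y"
    proof (rule dense_cinner_eqI[OF D])
      fix d assume d: "d \<in> D"
      then have "d \<in> carrier H" using D by (auto simp: dense_in_def)
      then show "cinner H d (adj H A y) = cinner H d (adj H B y)"
        using A B y eq[OF d] by (simp add: cinner_adj_right)
    qed (use A B y adj_in_bop bop_closed in auto)
  qed (use A B adj_in_bop in auto)
  then show ?thesis using A B adj_adj by metis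
qed

text \<open>Moving everything to the left slot leaves \<open>B (adj H A z)\<close>. As
  \<open>adj H A\<close> is again in \<open>S\<close>, it commutes with \<open>B\<close>.\<close>

lemma adj_in_commutant:
  assumes S: "S \<subseteq> bop H" and adj: "\<And>A. A \<in> S \<Longrightarrow> adj H A \<in> S" and B: "B \<in> commutant H S"
  shows "adj H B \<in> commutant H S"
proof (rule commutantI)
  have BH: "B \<in> bop H" using B commutant_subset_bop by auto
  then show B': "adj H B \<in> bop H" by (rule adj_in_bop)
  fix A x assume A: "A \<in> S" and x: "x \<in> carrier H"
  have AH: "A \<in> bop H" using A S by auto
  show "A (adj H B x) = adj H B (A x)"
  proof (rule cinner_eqI)
    fix z assume z: "z \<in> carrier H"
    have "cinner H z (A (adj H B x)) = cinner H (B (adj H A z)) x"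
      using z x B' AH BH cinner_adj[OF AH z, of "adj H B x"] cinner_adj_right[OF BH, of "adj H A z" x]
      by (simp add: bop_closed adj_in_bop)
    also have "B (adj H A z) = adj H A (B z)" using commutantD[OF B adj[OF A] z] by simp
    also have "cinner H (adj H A (B z)) x = cinner H z (adj H B (A x))"
      using z x AH BH by (simp add: cinner_adj cinner_adj_right bop_closed)
    finally show "cinner H z (A (adj H B x)) = cinner H z (adj H B (A x))" .
  qed (use AH B' x in auto)
qed fact

lemma von_neumann_algebra_bicommutant:
  assumes S: "S \<subseteq> bop H" and adj: "\<And>A. A \<in> S \<Longrightarrow> adj H A \<in> S"
  shows "von_neumann_algebra H (commutant H (commutant H S))"
  unfolding von_neumann_algebra_def
  by (auto simp: commutant_bicommutant S commutant_subset_bop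
      intro!: adj_in_commutant[OF commutant_subset_bop] adj_in_commutant[OF S] adj
      dest: subsetD[OF commutant_subset_bop])

end

subsection \<open>Modular objects of a tracial vector\<close>

text \<open>\<open>J\<close> is an everywhere defined antiunitary involution that extends the map
  whose closure is the Tomita operator. The modular statements, the trace property and finiteness
  are consequences of these assumptions alone.\<close>

locale tracial_vector = hilbert_space H for H :: "('v, 'm) hilbert_scheme" (structure) +
  fixes N :: "('v \<Rightarrow> 'v) set" and \<Omega> :: 'v and J :: "'v \<Rightarrow> 'v"
  assumes vna: "von_neumann_algebra H N"
    and cyclic: "cyclic H N \<Omega>" and separating: "separating H N \<Omega>"
    and unit: "cinner H \<Omega> \<Omega> = 1"
    and J_closed: "x \<in> carrier H \<Longrightarrow> J x \<in> carrier H"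
    and J_add: "\<lbrakk>x \<in> carrier H; y \<in> carrier H\<rbrakk> \<Longrightarrow> J (x \<oplus> y) = J x \<oplus> J y"
    and J_smult: "x \<in> carrier H \<Longrightarrow> J (c \<odot> x) = cnj c \<odot> J x"
    and J_J: "x \<in> carrier H \<Longrightarrow> J (J x) = x"
    and cinner_J: "\<lbrakk>x \<in> carrier H; y \<in> carrier H\<rbrakk> \<Longrightarrow> cinner H (J x) (J y) = cinner H y x"
    and J_Omega: "A \<in> N \<Longrightarrow> J (A \<Omega>) = adj H A \<Omega>"
begin

lemma Omega_closed [simp, intro]: "\<Omega> \<in> carrier H"
  using cyclic by (simp add: cyclic_def)

lemma N_bop: "A \<in> N \<Longrightarrow> A \<in> bop H"
  using vna by (auto simp: von_neumann_algebra_def)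

lemma N_adj: "A \<in> N \<Longrightarrow> adj H A \<in> N"
  using vna by (auto simp: von_neumann_algebra_def)

lemma N_bicommutant: "commutant H (commutant H N) = N"
  using vna by (auto simp: von_neumann_algebra_def)

lemma N_op_id: "op_id H \<in> N"
  using op_id_in_commutant[OF commutant_subset_bop, of N] by (simp add: N_bicommutant)

lemma N_op_mult: "\<lbrakk>A \<in> N; B \<in> N\<rbrakk> \<Longrightarrow> op_mult H A B \<in> N"
  using op_mult_in_commutant[OF commutant_subset_bop, of A N B] by (simp add: N_bicommutant)

lemma N_op_add: "\<lbrakk>A \<in> N; B \<in> N\<rbrakk> \<Longrightarrow> op_add H A B \<in> N"
  using op_add_in_commutant[OF commutant_subset_bop, of A N B] by (simp add: N_bicommutant)

lemma N_op_scale: "A \<in> N \<Longrightarrow> op_scale H c A \<in> N"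
  using op_scale_in_commutant[OF commutant_subset_bop, of A N c] by (simp add: N_bicommutant)

lemma dense_N_Omega: "dense_in H {A \<Omega> | A. A \<in> N}"
  using cyclic by (simp add: cyclic_def)

lemma separatingD:
  assumes "A \<in> N" "B \<in> N" "A \<Omega> = B \<Omega>"
  shows "A = B"
proof -
  define C where "C = op_add H A (op_scale H (-1) B)"
  have C: "C \<in> N" using assms by (simp add: C_def N_op_add N_op_scale)
  have Cx: "C x = A x \<ominus> B x" if "x \<in> carrier H" for x
    using that assms by (simp add: C_def a_minus_eq_smult bop_closed N_bop)
  have "C \<Omega> = \<zero>" using assms by (simp add: Cx minus_eq_zero_iff bop_closed N_bop)
  then have "C = op_zero H" using C separating by (auto simp: separating_def)
  then have "A x = B x" if "x \<in> carrier H" for x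
    using Cx[OF that] that assms minus_eq_zero_iff[of "A x" "B x"] by (simp add: bop_closed N_bop)
  then show ?thesis using assms by (intro bop_eqI N_bop) auto
qed

lemma vnorm_J: "x \<in> carrier H \<Longrightarrow> vnorm H (J x) = vnorm H x"
  by (simp add: vnorm_def cinner_J)

lemma J_minus: "\<lbrakk>x \<in> carrier H; y \<in> carrier H\<rbrakk> \<Longrightarrow> J (x \<ominus> y) = J x \<ominus> J y"
  by (simp add: a_minus_eq_smult J_add J_smult J_closed)

lemma vdist_J: "\<lbrakk>x \<in> carrier H; y \<in> carrier H\<rbrakk> \<Longrightarrow> vdist H (J x) (J y) = vdist H x y"
  by (simp add: vdist_def J_minus[symmetric] vnorm_J)

text \<open>The pairs before closure lie on the graph of \<open>J\<close>. Since \<open>J\<close> is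
  isometric this graph is closed, and density of the vectors \<open>A \<Omega>\<close> makes the
  closure fill it.\<close>

lemma tomita_eq: "tomita H N \<Omega> = {(x, J x) | x. x \<in> carrier H}"
proof (intro Set.set_eqI iffI)
  fix p assume "p \<in> tomita H N \<Omega>"
  then obtain x y where p: "p = (x, y)" and x: "x \<in> carrier H" and y: "y \<in> carrier H"
    and lim: "\<And>e. e > 0 \<Longrightarrow> \<exists>A\<in>N. vdist H (A \<Omega>) x < e \<and> vdist H (J (A \<Omega>)) y < e"
    unfolding tomita_def graph_closure_def by (auto simp: J_Omega) blast
  have "y = J x"
  proof (rule vdist_eqI)
    fix e :: real assume "e > 0"
    then obtain A where A: "A \<in> N" "vdist H (A \<Omega>) x < e / 2" "vdist H (J (A \<Omega>)) y < e / 2"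
      using lim[of "e / 2"] by auto
    have AO: "A \<Omega> \<in> carrier H" using A N_bop by auto
    have "vdist H y (J x) \<le> vdist H y (J (A \<Omega>)) + vdist H (J (A \<Omega>)) (J x)"
      using AO x y by (intro vdist_triangle) (auto simp: J_closed)
    also have "\<dots> \<le> e" using A AO x y by (simp add: vdist_J vdist_commute[of y] J_closed)
    finally show "vdist H y (J x) \<le> e" .
  qed (use x y J_closed in auto)
  with p x show "p \<in> {(x, J x) | x. x \<in> carrier H}" by simp
next
  fix p assume "p \<in> {(x, J x) | x. x \<in> carrier H}"
  then obtain x where p: "p = (x, J x)" and x: "x \<in> carrier H" by auto
  have "\<exists>(a, b)\<in>{(A \<Omega>, adj H A \<Omega>) | A. A \<in> N}. vdist H a x < e \<and> vdist H b (J x) < e"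
    if e: "e > 0" for e
  proof -
    obtain A where A: "A \<in> N" "vdist H (A \<Omega>) x < e"
      using dense_N_Omega x e unfolding dense_in_def by blast
    have "vdist H (adj H A \<Omega>) (J x) < e"
      using A x N_bop by (simp add: J_Omega[symmetric] vdist_J bop_closed)
    with A show ?thesis by (intro bexI[of _ "(A \<Omega>, adj H A \<Omega>)"]) auto
  qed
  then show "p \<in> tomita H N \<Omega>"
    unfolding tomita_def graph_closure_def using p x by (simp add: J_closed)
qed

lemma dense_carrier: "dense_in H (carrier H)"
  unfolding dense_in_def by (auto intro!: bexI)

lemma antilinear_op_tomita: "antilinear_op H (tomita H N \<Omega>)"
proof -
  have "Domain (tomita H N \<Omega>) = carrier H" by (auto simp: tomita_eq)
  then show ?thesis
    unfolding semilinear_op_def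
    by (auto simp: tomita_eq J_closed J_add J_smult dense_carrier intro!: single_valuedI)
qed

lemma antilinear_isometry_tomita: "antilinear_isometry H (tomita H N \<Omega>)"
  using antilinear_op_tomita by (auto simp: antilinear_isometry_def tomita_eq vnorm_J)

lemma antiunitary_tomita: "antiunitary H (tomita H N \<Omega>)"
proof -
  have "Range (tomita H N \<Omega>) = carrier H" using J_J J_closed by (force simp: tomita_eq)
  then show ?thesis
    using antilinear_op_tomita by (auto simp: antiunitary_def tomita_eq cinner_J)
qed

lemma positive_selfadjoint_Id: "positive_selfadjoint H (Id_on (carrier H))"
proof -
  have "y = z" if "y \<in> carrier H" "z \<in> carrier H"
    "\<forall>x\<in>carrier H. cinner H y x = cinner H z x" for y z
    by (rule cinner_eqI) (use that in \<open>metis cinner_commute\<close>)+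
  then have "adjoint_graph H (Id_on (carrier H)) = Id_on (carrier H)"
    by (auto simp: adjoint_graph_def Id_on_def split_beta)
  then show ?thesis
    unfolding positive_selfadjoint_def semilinear_op_def
    by (auto simp: Domain_Id_on dense_carrier cinner_self nonneg_Reals_of_real_iff
        intro!: single_valuedI)
qed

text \<open>Existence takes \<open>D\<close> to be the identity. For uniqueness, any admissible
  \<open>D\<close> is shown to be everywhere defined and isometric, then its own inverse by
  self-adjointness, and finally the identity by positivity.\<close>

lemma modular_objects_iff:
  "modular_objects H N \<Omega> \<Delta> K \<longleftrightarrow> \<Delta> = Id_on (carrier H) \<and> K = tomita H N \<Omega>"
proof
  assume "\<Delta> = Id_on (carrier H) \<and> K = tomita H N \<Omega>"
  moreover have "Id_on (carrier H) O Id_on (carrier H) = Id_on (carrier H)"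
    "Id_on (carrier H) O tomita H N \<Omega> = tomita H N \<Omega>"
    by (auto simp: tomita_eq)
  ultimately show "modular_objects H N \<Omega> \<Delta> K"
    unfolding modular_objects_def using positive_selfadjoint_Id antiunitary_tomita by metis
next
  assume "modular_objects H N \<Omega> \<Delta> K"
  then obtain D where K: "antiunitary H K" and D: "positive_selfadjoint H D" "D O D = \<Delta>"
    and S: "tomita H N \<Omega> = D O K" by (auto simp: modular_objects_def)
  have D_sub: "D \<subseteq> carrier H \<times> carrier H" and D_sv: "single_valued D"
    and D_adj: "adjoint_graph H D = D"
    and D_pos: "\<And>x y. (x, y) \<in> D \<Longrightarrow> cinner H x y \<in> \<real>\<^sub>\<ge>\<^sub>0"
    and D_add: "\<And>x y x' y'. \<lbrakk>(x, y) \<in> D; (x', y') \<in> D\<rbrakk> \<Longrightarrow> (x \<oplus> x', y \<oplus> y') \<in> D"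
    and D_smult: "\<And>c x y. (x, y) \<in> D \<Longrightarrow> (c \<odot> x, c \<odot> y) \<in> D"
    using D(1) unfolding positive_selfadjoint_def semilinear_op_def by blast+
  \<comment> \<open>The Tomita operator is everywhere defined and factors through \<open>D\<close>,
    so \<open>D\<close> is everywhere defined too.\<close>
  have total: "\<exists>y\<in>carrier H. (x, y) \<in> D \<and> (y, J x) \<in> K" if "x \<in> carrier H" for x
  proof -
    have "(x, J x) \<in> D O K" using that by (simp add: S[symmetric] tomita_eq)
    then show ?thesis using D_sub by blast
  qed
  text \<open>\<open>D\<close> preserves inner products because both \<open>J\<close> and \<open>K\<close> reverse them.\<close>
  have iso: "cinner H y y' = cinner H x x'" if D: "(x, y) \<in> D" "(x', y') \<in> D" for x y x' y'
  proof -
    have C: "x \<in> carrier H" "x' \<in> carrier H" "y \<in> carrier H" "y' \<in> carrier H"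
      using that D_sub by auto
    obtain z z' where z: "(x, z) \<in> D" "(z, J x) \<in> K" "(x', z') \<in> D" "(z', J x') \<in> K"
      using total C by metis
    have "z = y" "z' = y'" using z D D_sv by (auto dest: single_valuedD)
    then have "cinner H (J x) (J x') = cinner H y' y"
      using K z by (auto simp: antiunitary_def)
    then have "cinner H y' y = cinner H x' x" using C by (simp add: cinner_J)
    then show ?thesis using C cinner_commute by metis
  qed
  have D_id: "y = x" if xy: "(x, y) \<in> D" for x y
  proof -
    have C: "x \<in> carrier H" "y \<in> carrier H" using xy D_sub by auto
    obtain w where w: "w \<in> carrier H" "(y, w) \<in> D" using total C by metis
    \<comment> \<open>Self-adjointness and \<open>iso\<close> give
      \<open>cinner H a (D (D x)) = cinner H (D a) (D x) = cinner H a x\<close> for all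
      \<open>a\<close>.\<close>
    have "w = x"
    proof (rule dense_cinner_eqI[OF dense_carrier])
      fix a assume a: "a \<in> carrier H"
      obtain b where b: "b \<in> carrier H" "(a, b) \<in> D" using total a by metis
      have "(a, b) \<in> adjoint_graph H D" using b D_adj by simp
      then have "cinner H a w = cinner H b y" using w unfolding adjoint_graph_def by blast
      then show "cinner H a w = cinner H a x" using iso b xy by metis
    qed fact+
    \<comment> \<open>\<open>D\<close> maps \<open>z = x - D x\<close> to \<open>- z\<close>;
      positivity at this vector forces it to vanish.\<close>
    define z where "z = x \<oplus> (-1) \<odot> y"
    have zH: "z \<in> carrier H" using C by (simp add: z_def)
    have "(z, y \<oplus> (-1) \<odot> x) \<in> D" unfolding z_def using D_add D_smult xy w \<open>w = x\<close> by blast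
    moreover have "y \<oplus> (-1) \<odot> x = (-1) \<odot> z"
      by (rule cinner_eqI) (use C in \<open>auto simp: z_def cinner_simps\<close>)
    ultimately have "cinner H z ((-1) \<odot> z) \<in> \<real>\<^sub>\<ge>\<^sub>0" using D_pos by simp
    then have "(vnorm H z)\<^sup>2 \<le> 0"
      using zH by (simp add: cinner_simps cinner_self complex_nonneg_Reals_iff)
    then have "z = \<zero>" using zH by (simp add: vnorm_eq_0_iff)
    then show ?thesis using C by (simp add: z_def a_minus_eq_smult[symmetric] minus_eq_zero_iff)
  qed
  have "D = Id_on (carrier H)"
    using D_id D_sub total by (auto simp: Id_on_def) blast
  moreover have "Id_on (carrier H) O K = K"
    using K by (auto simp: antiunitary_def semilinear_op_def)
  ultimately show "\<Delta> = Id_on (carrier H) \<and> K = tomita H N \<Omega>" using D(2) S by auto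
qed

text \<open>\<open>adj H A \<Omega>\<close> is \<open>J (A \<Omega>)\<close> and
  \<open>B \<Omega>\<close> is \<open>J (adj H B \<Omega>)\<close>; antiunitarity removes both
  \<open>J\<close> and swaps the two slots.\<close>

lemma vector_state_trace:
  assumes A: "A \<in> N" and B: "B \<in> N"
  shows "vector_state H \<Omega> (op_mult H A B) = vector_state H \<Omega> (op_mult H B A)"
proof -
  have "cinner H \<Omega> (A (B \<Omega>)) = cinner H (adj H A \<Omega>) (B \<Omega>)"
    using A B by (simp add: cinner_adj N_bop bop_closed)
  also have "\<dots> = cinner H (J (A \<Omega>)) (J (adj H B \<Omega>))"
    using A B by (simp add: J_Omega N_adj adj_adj N_bop)
  also have "\<dots> = cinner H (adj H B \<Omega>) (A \<Omega>)"
    using A B by (simp add: cinner_J N_adj N_bop bop_closed)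
  also have "\<dots> = cinner H \<Omega> (B (A \<Omega>))"
    using A B by (simp add: cinner_adj N_bop bop_closed)
  finally show ?thesis by (simp add: vector_state_def)
qed

lemma vector_state_adj_mult:
  "A \<in> N \<Longrightarrow> vector_state H \<Omega> (op_mult H (adj H A) A) = cinner H (A \<Omega>) (A \<Omega>)"
  by (simp add: vector_state_def cinner_adj_right N_bop bop_closed)

lemma tracial_state_vector_state: "tracial_state H N (vector_state H \<Omega>)"
  unfolding tracial_state_def
  by (auto simp: vector_state_trace vector_state_adj_mult cinner_self N_bop bop_closed
      nonneg_Reals_of_real_iff)
    (simp_all add: vector_state_def cinner_simps N_bop bop_closed unit)

text \<open>By the trace property the range projection of the isometry \<open>V\<close> has value 1
  in the vector state. This is equality in Cauchy-Schwarz, so the projection fixes \<Omega>, and a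
  separating vector leaves only the identity.\<close>

lemma finite_vna: "finite_vna H N"
  unfolding finite_vna_def
proof (intro conjI ballI impI vna)
  fix V assume V: "V \<in> N" and iso: "op_mult H (adj H V) V = op_id H"
  have VH: "V \<in> bop H" "adj H V \<in> bop H" using V N_bop N_adj by auto
  define x where "x = adj H V \<Omega>"
  have x: "x \<in> carrier H" using VH by (auto simp: x_def)
  have VV: "adj H V (V y) = y" if "y \<in> carrier H" for y
    using that arg_cong[OF iso, of "\<lambda>A. A y"] by simp
  have xx: "cinner H x x = 1"
  proof -
    have "cinner H x x = vector_state H \<Omega> (op_mult H V (adj H V))"
      using VH by (simp add: vector_state_def x_def cinner_adj bop_closed)
    also have "\<dots> = cinner H \<Omega> \<Omega>"
      using vector_state_trace[OF V N_adj[OF V]] by (simp add: iso) (simp add: vector_state_def)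
    finally show ?thesis by (simp add: unit)
  qed
  have 1: "cinner H (V x) (V x) = 1"
    using cinner_adj_right[OF VH(1) x, of "V x"] x VH by (simp add: VV xx bop_closed)
  have 2: "cinner H (V x) \<Omega> = 1" "cinner H \<Omega> (V x) = 1"
    using cinner_adj_right[OF VH(1) x, of \<Omega>] cinner_adj[OF VH(1), of \<Omega> x] x
    by (simp_all add: x_def[symmetric] xx)
  \<comment> \<open>All four inner products in the expansion equal 1, with signs that
    cancel.\<close>
  have "cinner H (V x \<ominus> \<Omega>) (V x \<ominus> \<Omega>) = 0"
    using x VH by (simp add: cinner_simps bop_closed 1 2 unit)
  then have "V x = \<Omega>"
    using x VH cinner_self_eq_0D[of "V x \<ominus> \<Omega>"] by (simp add: minus_eq_zero_iff bop_closed)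
  then show "op_mult H V (adj H V) = op_id H"
    using V by (intro separatingD) (auto simp: N_op_mult N_adj N_op_id x_def)
qed

end

section \<open>Direct sums of Hilbert spaces\<close>

locale hilbert_direct_sum = hilbert_space H for H :: "'v hilbert" (structure) and I :: "'i set"
begin

abbreviation K :: "('i \<Rightarrow> 'v) hilbert" where "K \<equiv> hilbert_sum I H"

definition single :: "'i \<Rightarrow> 'v \<Rightarrow> 'i \<Rightarrow> 'v" where
  "single i x = (\<lambda>j\<in>I. if j = i then x else \<zero>)"

lemma in_carrier_sum_iff:
  "\<xi> \<in> carrier K \<longleftrightarrow> \<xi> \<in> I \<rightarrow>\<^sub>E carrier H \<and> (\<lambda>i. (vnorm H (\<xi> i))\<^sup>2) summable_on I"
  by (simp add: hilbert_sum_def)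

lemma component_closed [intro]: "\<lbrakk>\<xi> \<in> carrier K; i \<in> I\<rbrakk> \<Longrightarrow> \<xi> i \<in> carrier H"
  by (auto simp: in_carrier_sum_iff)

lemma summable_vnorm: "\<xi> \<in> carrier K \<Longrightarrow> (\<lambda>i. (vnorm H (\<xi> i))\<^sup>2) summable_on I"
  by (simp add: in_carrier_sum_iff)

lemma add_sum_apply [simp]: "i \<in> I \<Longrightarrow> (\<xi> \<oplus>\<^bsub>K\<^esub> \<eta>) i = \<xi> i \<oplus> \<eta> i"
  by (simp add: hilbert_sum_def)

lemma smult_sum_apply [simp]: "i \<in> I \<Longrightarrow> (c \<odot>\<^bsub>K\<^esub> \<xi>) i = c \<odot> \<xi> i"
  by (simp add: hilbert_sum_def)

lemma zero_sum_apply [simp]: "i \<in> I \<Longrightarrow> \<zero>\<^bsub>K\<^esub> i = \<zero>"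
  by (simp add: hilbert_sum_def)

lemma cinner_sum: "cinner K \<xi> \<eta> = (\<Sum>\<^sub>\<infinity>i\<in>I. cinner H (\<xi> i) (\<eta> i))"
  by (simp add: hilbert_sum_def)

lemma carrier_sum_eqI:
  assumes "\<xi> \<in> carrier K" "\<eta> \<in> carrier K" "\<And>i. i \<in> I \<Longrightarrow> \<xi> i = \<eta> i"
  shows "\<xi> = \<eta>"
  using assms by (auto simp: in_carrier_sum_iff intro: PiE_ext)

lemma add_sum_closed:
  assumes x: "\<xi> \<in> carrier K" and y: "\<eta> \<in> carrier K"
  shows "\<xi> \<oplus>\<^bsub>K\<^esub> \<eta> \<in> carrier K"
  unfolding in_carrier_sum_iff
proof
  show "\<xi> \<oplus>\<^bsub>K\<^esub> \<eta> \<in> I \<rightarrow>\<^sub>E carrier H"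
    using x y by (auto simp: hilbert_sum_def)
  have "(\<lambda>i. 2 * (vnorm H (\<xi> i))\<^sup>2 + 2 * (vnorm H (\<eta> i))\<^sup>2) summable_on I"
    using x y by (intro summable_on_add summable_on_cmult_right summable_vnorm)
  then show "(\<lambda>i. (vnorm H ((\<xi> \<oplus>\<^bsub>K\<^esub> \<eta>) i))\<^sup>2) summable_on I"
    by (rule summable_on_comparison_test) (use x y in \<open>auto intro!: vnorm_add_power2_le\<close>)
qed

lemma smult_sum_closed:
  assumes x: "\<xi> \<in> carrier K"
  shows "c \<odot>\<^bsub>K\<^esub> \<xi> \<in> carrier K"
  unfolding in_carrier_sum_iff
proof
  show "c \<odot>\<^bsub>K\<^esub> \<xi> \<in> I \<rightarrow>\<^sub>E carrier H"
    using x by (auto simp: hilbert_sum_def)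
  have "(\<lambda>i. (cmod c)\<^sup>2 * (vnorm H (\<xi> i))\<^sup>2) summable_on I"
    using x by (intro summable_on_cmult_right summable_vnorm)
  moreover have "(vnorm H ((c \<odot>\<^bsub>K\<^esub> \<xi>) i))\<^sup>2 = (cmod c)\<^sup>2 * (vnorm H (\<xi> i))\<^sup>2" if "i \<in> I" for i
    using that x by (simp add: vnorm_smult component_closed power_mult_distrib)
  ultimately show "(\<lambda>i. (vnorm H ((c \<odot>\<^bsub>K\<^esub> \<xi>) i))\<^sup>2) summable_on I"
    by (simp cong: summable_on_cong)
qed

lemma zero_sum_closed: "\<zero>\<^bsub>K\<^esub> \<in> carrier K"
  unfolding in_carrier_sum_iff by (auto simp: hilbert_sum_def cong: summable_on_cong)

lemma summable_cinner:
  assumes x: "\<xi> \<in> carrier K" and y: "\<eta> \<in> carrier K"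
  shows "(\<lambda>i. cinner H (\<xi> i) (\<eta> i)) summable_on I"
proof (rule abs_summable_summable, rule Infinite_Sum.abs_summable_on_comparison_test')
  show "(\<lambda>i. (vnorm H (\<xi> i))\<^sup>2 + (vnorm H (\<eta> i))\<^sup>2) summable_on I"
    using x y by (intro summable_on_add summable_vnorm)
  fix i assume i: "i \<in> I"
  have "cmod (cinner H (\<xi> i) (\<eta> i)) \<le> vnorm H (\<xi> i) * vnorm H (\<eta> i)"
    using Cauchy_Schwarz x y i by auto
  moreover have "2 * (vnorm H (\<xi> i) * vnorm H (\<eta> i)) \<le> (vnorm H (\<xi> i))\<^sup>2 + (vnorm H (\<eta> i))\<^sup>2"
    using zero_le_power2[of "vnorm H (\<xi> i) - vnorm H (\<eta> i)"] by (simp add: power2_diff)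
  moreover have "0 \<le> vnorm H (\<xi> i) * vnorm H (\<eta> i)"
    using x y i by (auto simp: component_closed)
  ultimately show "cmod (cinner H (\<xi> i) (\<eta> i)) \<le> (vnorm H (\<xi> i))\<^sup>2 + (vnorm H (\<eta> i))\<^sup>2"
    by linarith
qed

lemma cinner_sum_self:
  assumes "\<xi> \<in> carrier K"
  shows "cinner K \<xi> \<xi> = of_real (\<Sum>\<^sub>\<infinity>i\<in>I. (vnorm H (\<xi> i))\<^sup>2)"
proof -
  have "((\<lambda>i. complex_of_real ((vnorm H (\<xi> i))\<^sup>2)) has_sum of_real (\<Sum>\<^sub>\<infinity>i\<in>I. (vnorm H (\<xi> i))\<^sup>2)) I"
    using has_sum_infsum[OF summable_vnorm[OF assms]] by (rule has_sum_of_real)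
  moreover have "complex_of_real ((vnorm H (\<xi> i))\<^sup>2) = cinner H (\<xi> i) (\<xi> i)" if "i \<in> I" for i
    using assms that by (simp add: cinner_self component_closed)
  ultimately have "((\<lambda>i. cinner H (\<xi> i) (\<xi> i)) has_sum of_real (\<Sum>\<^sub>\<infinity>i\<in>I. (vnorm H (\<xi> i))\<^sup>2)) I"
    by (simp cong: has_sum_cong)
  then show ?thesis unfolding cinner_sum by (rule infsumI)
qed

lemma inner_space_sum: "inner_space K"
proof (intro inner_space.intro inner_space_axioms.intro)
  show "abelian_group K"
  proof (rule abelian_groupI)
    fix x assume x: "x \<in> carrier K"
    show "\<exists>y\<in>carrier K. y \<oplus>\<^bsub>K\<^esub> x = \<zero>\<^bsub>K\<^esub>"
    proof
      show m: "(-1) \<odot>\<^bsub>K\<^esub> x \<in> carrier K" using x by (rule smult_sum_closed)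
      show "(-1) \<odot>\<^bsub>K\<^esub> x \<oplus>\<^bsub>K\<^esub> x = \<zero>\<^bsub>K\<^esub>"
      proof (rule carrier_sum_eqI)
        fix i assume i: "i \<in> I"
        then have xi: "x i \<in> carrier H" using x by auto
        have "(-1) \<odot> x i \<oplus> x i = \<zero>" by (rule cinner_eqI) (use xi in \<open>auto simp: cinner_simps\<close>)
        with i show "((-1) \<odot>\<^bsub>K\<^esub> x \<oplus>\<^bsub>K\<^esub> x) i = \<zero>\<^bsub>K\<^esub> i" by simp
      qed (use x m in \<open>auto intro: add_sum_closed zero_sum_closed\<close>)
    qed
  qed (auto intro!: carrier_sum_eqI add_sum_closed zero_sum_closed a_assoc a_comm simp: component_closed)
next
  fix x y z assume "x \<in> carrier K" "y \<in> carrier K" "z \<in> carrier K"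
  then show "cinner K x (y \<oplus>\<^bsub>K\<^esub> z) = cinner K x y + cinner K x z"
    by (simp add: cinner_sum infsum_add[symmetric] summable_cinner cinner_add_right component_closed
        cong: infsum_cong)
next
  fix x y c assume "x \<in> carrier K" "y \<in> carrier K"
  then show "cinner K x (c \<odot>\<^bsub>K\<^esub> y) = c * cinner K x y"
    by (simp add: cinner_sum infsum_cmult_right'[symmetric] cinner_smult_right component_closed
        cong: infsum_cong)
next
  fix x y assume xy: "x \<in> carrier K" "y \<in> carrier K"
  have "(\<Sum>\<^sub>\<infinity>i\<in>I. cinner H (x i) (y i)) = (\<Sum>\<^sub>\<infinity>i\<in>I. cnj (cinner H (y i) (x i)))"
    by (intro infsum_cong cinner_commute) (use xy in auto)
  then show "cinner K x y = cnj (cinner K y x)" by (simp add: cinner_sum)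
next
  fix x assume x: "x \<in> carrier K"
  show "0 \<le> Re (cinner K x x)" by (simp add: cinner_sum_self[OF x] infsum_nonneg)
  assume "cinner K x x = 0"
  then have s: "(\<Sum>\<^sub>\<infinity>i\<in>I. (vnorm H (x i))\<^sup>2) \<le> 0" by (simp add: cinner_sum_self[OF x])
  show "x = \<zero>\<^bsub>K\<^esub>"
  proof (rule carrier_sum_eqI)
    fix i assume i: "i \<in> I"
    have "(vnorm H (x i))\<^sup>2 = 0"
      by (rule nonneg_infsum_le_0D[OF s summable_vnorm[OF x]]) (use i in auto)
    then show "x i = \<zero>\<^bsub>K\<^esub> i" using i x by (simp add: vnorm_eq_0_iff component_closed)
  qed (use x zero_sum_closed in auto)
qed (auto intro: smult_sum_closed)

section \<open>Completeness of the direct sum\<close>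

interpretation K: inner_space K by (rule inner_space_sum)

lemma power2_vnorm_sum: "\<xi> \<in> carrier K \<Longrightarrow> (vnorm K \<xi>)\<^sup>2 = (\<Sum>\<^sub>\<infinity>i\<in>I. (vnorm H (\<xi> i))\<^sup>2)"
  by (simp add: K.power2_vnorm cinner_sum_self)

lemma minus_sum_apply:
  "\<lbrakk>\<xi> \<in> carrier K; \<eta> \<in> carrier K; i \<in> I\<rbrakk> \<Longrightarrow> (\<xi> \<ominus>\<^bsub>K\<^esub> \<eta>) i = \<xi> i \<ominus> \<eta> i"
  by (simp add: K.a_minus_eq_smult a_minus_eq_smult component_closed)

lemma sum_vnorm_le:
  assumes "\<xi> \<in> carrier K" "finite F" "F \<subseteq> I"
  shows "(\<Sum>i\<in>F. (vnorm H (\<xi> i))\<^sup>2) \<le> (vnorm K \<xi>)\<^sup>2"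
  using assms by (simp add: power2_vnorm_sum finite_sum_le_infsum summable_vnorm)

lemma vnorm_component_le:
  assumes "\<xi> \<in> carrier K" "i \<in> I"
  shows "vnorm H (\<xi> i) \<le> vnorm K \<xi>"
  using sum_vnorm_le[of \<xi> "{i}"] assms by (auto intro: power2_le_imp_le)

text \<open>Components converge because they are dominated by the norm of the sum. To place the
  limit in the space, the Cauchy bound is restricted to a finite \<open>F\<close>, where one index
  may tend to infinity, and only afterwards is \<open>F\<close> enlarged.\<close>

lemma hilbert_space_sum: "hilbert_space K"
proof (intro hilbert_space.intro hilbert_space_axioms.intro inner_space_sum)
  fix X :: "nat \<Rightarrow> 'i \<Rightarrow> 'v"
  assume X: "\<And>n. X n \<in> carrier K"
    and Cauchy: "\<And>e. e > 0 \<Longrightarrow> \<exists>N. \<forall>m\<ge>N. \<forall>n\<ge>N. vdist K (X m) (X n) < e"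
  have comp: "vdist H (X m i) (X n i) \<le> vdist K (X m) (X n)" if "i \<in> I" for m n i
    using vnorm_component_le[of "X m \<ominus>\<^bsub>K\<^esub> X n" i] X that by (simp add: vdist_def minus_sum_apply)
  have "\<exists>x\<in>carrier H. (\<lambda>n. vdist H (X n i) x) \<longlonglongrightarrow> 0" if i: "i \<in> I" for i
  proof (rule complete)
    fix e :: real assume "e > 0"
    then show "\<exists>N. \<forall>m\<ge>N. \<forall>n\<ge>N. vdist H (X m i) (X n i) < e"
      using Cauchy comp[OF i] by (meson order_le_less_trans)
  qed (use X i in auto)
  then obtain L0 where L0: "\<And>i. i \<in> I \<Longrightarrow> L0 i \<in> carrier H"
    "\<And>i. i \<in> I \<Longrightarrow> (\<lambda>n. vdist H (X n i) (L0 i)) \<longlonglongrightarrow> 0" by metis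
  define L where "L = restrict L0 I"
  \<comment> \<open>Componentwise, since the limit family is not yet known to be square summable and
    hence not yet a vector to subtract.\<close>
  define D where "D m = (\<lambda>i\<in>I. X m i \<ominus> L0 i)" for m
  have bound: "(\<Sum>i\<in>F. (vnorm H (D m i))\<^sup>2) \<le> e\<^sup>2"
    if e: "e > 0" "\<forall>m\<ge>N. \<forall>n\<ge>N. vdist K (X m) (X n) < e" and m: "m \<ge> N" and F: "finite F" "F \<subseteq> I"
    for e m F N
  proof -
    have "(\<lambda>n. \<Sum>i\<in>F. (vdist H (X m i) (X n i))\<^sup>2) \<longlonglongrightarrow> (\<Sum>i\<in>F. (vdist H (X m i) (L0 i))\<^sup>2)"
    proof (intro tendsto_sum tendsto_power)
      fix i assume "i \<in> F"
      then have i: "i \<in> I" using F by auto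
      have "\<bar>vdist H (X m i) (X n i) - vdist H (X m i) (L0 i)\<bar> \<le> vdist H (X n i) (L0 i)" for n
        using vdist_triangle[of "X m i" "X n i" "L0 i"] vdist_triangle[of "X m i" "L0 i" "X n i"] X i
        by (simp add: component_closed L0 vdist_commute[of "L0 i"])
      then have "(\<lambda>n. vdist H (X m i) (X n i) - vdist H (X m i) (L0 i)) \<longlonglongrightarrow> 0"
        by (intro tendsto_rabs_zero_cancel[OF tendsto_sandwich[OF _ _ tendsto_const L0(2)[OF i]]]) auto
      then show "(\<lambda>n. vdist H (X m i) (X n i)) \<longlonglongrightarrow> vdist H (X m i) (L0 i)"
        by (simp add: LIM_zero_iff)
    qed
    moreover have "(\<Sum>i\<in>F. (vdist H (X m i) (X n i))\<^sup>2) \<le> e\<^sup>2" if "n \<ge> N" for n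
    proof -
      have "(\<Sum>i\<in>F. (vdist H (X m i) (X n i))\<^sup>2) = (\<Sum>i\<in>F. (vnorm H ((X m \<ominus>\<^bsub>K\<^esub> X n) i))\<^sup>2)"
        using F X by (intro sum.cong) (auto simp: vdist_def minus_sum_apply)
      also have "\<dots> \<le> (vdist K (X m) (X n))\<^sup>2" unfolding vdist_def using F X by (intro sum_vnorm_le) auto
      also have "\<dots> \<le> e\<^sup>2" using e(2) m that X by (intro power_mono) (auto intro: less_imp_le)
      finally show ?thesis .
    qed
    ultimately have "(\<Sum>i\<in>F. (vdist H (X m i) (L0 i))\<^sup>2) \<le> e\<^sup>2"
      by (intro LIMSEQ_le_const2) auto
    also have "(\<Sum>i\<in>F. (vdist H (X m i) (L0 i))\<^sup>2) = (\<Sum>i\<in>F. (vnorm H (D m i))\<^sup>2)"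
      using F by (intro sum.cong) (auto simp: D_def vdist_def)
    finally show ?thesis .
  qed
  have DK: "D m \<in> carrier K \<and> vnorm K (D m) \<le> e"
    if e: "e > 0" "\<forall>m\<ge>N. \<forall>n\<ge>N. vdist K (X m) (X n) < e" and m: "m \<ge> N" for e m N
  proof
    have "(\<lambda>i. (vnorm H (D m i))\<^sup>2) summable_on I"
      using bound[OF e m] by (intro nonneg_bdd_above_summable_on bdd_aboveI2) auto
    then show D: "D m \<in> carrier K"
      using X L0 by (auto simp: in_carrier_sum_iff D_def component_closed)
    have "(vnorm K (D m))\<^sup>2 \<le> e\<^sup>2"
      unfolding power2_vnorm_sum[OF D] by (rule infsum_le_finite_sums[OF summable_vnorm[OF D] bound[OF e m]])
    then show "vnorm K (D m) \<le> e" using e(1) by (auto intro: power2_le_imp_le)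
  qed
  \<comment> \<open>A single square summable difference suffices: the limit is \<open>X N1\<close>
    minus \<open>D N1\<close>.\<close>
  obtain N1 where N1: "\<forall>m\<ge>N1. \<forall>n\<ge>N1. vdist K (X m) (X n) < 1" using Cauchy[of 1] by auto
  have D1: "D N1 \<in> carrier K" using DK[OF _ N1, of N1] by simp
  have "L = X N1 \<ominus>\<^bsub>K\<^esub> D N1"
  proof (rule PiE_ext)
    show "L \<in> I \<rightarrow>\<^sub>E carrier H" using L0 by (auto simp: L_def)
    show "X N1 \<ominus>\<^bsub>K\<^esub> D N1 \<in> I \<rightarrow>\<^sub>E carrier H"
      using K.minus_in_carrier[OF X[of N1] D1] by (simp add: in_carrier_sum_iff)
    fix i assume i: "i \<in> I"
    have "L0 i = X N1 i \<ominus> (X N1 i \<ominus> L0 i)"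
      by (rule cinner_eqI) (use X L0 i in \<open>auto simp: cinner_simps component_closed\<close>)
    then show "L i = (X N1 \<ominus>\<^bsub>K\<^esub> D N1) i"
      using X D1 i by (simp add: minus_sum_apply) (simp add: D_def L_def)
  qed
  then have L: "L \<in> carrier K" using X D1 by simp
  have D_eq: "X m \<ominus>\<^bsub>K\<^esub> L = D m" for m
  proof (rule PiE_ext)
    show "X m \<ominus>\<^bsub>K\<^esub> L \<in> I \<rightarrow>\<^sub>E carrier H"
      using K.minus_in_carrier[OF X[of m] L] by (simp add: in_carrier_sum_iff)
    show "D m \<in> I \<rightarrow>\<^sub>E carrier H" using X L0 by (auto simp: D_def component_closed)
  qed (use X L in \<open>simp add: minus_sum_apply D_def L_def\<close>)
  have "(\<lambda>n. vdist K (X n) L) \<longlonglongrightarrow> 0"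
  proof (rule LIMSEQ_I)
    fix e :: real assume e: "e > 0"
    \<comment> \<open>Halved because \<open>DK\<close> yields only a non-strict bound.\<close>
    then obtain N where N: "\<forall>m\<ge>N. \<forall>n\<ge>N. vdist K (X m) (X n) < e / 2" using Cauchy[of "e / 2"] by auto
    have "norm (vdist K (X n) L - 0) < e" if "n \<ge> N" for n
      using DK[OF _ N that] e X L by (simp add: vdist_def D_eq)
    then show "\<exists>N. \<forall>n\<ge>N. norm (vdist K (X n) L - 0) < e" by blast
  qed
  with L show "\<exists>x\<in>carrier K. (\<lambda>n. vdist K (X n) x) \<longlonglongrightarrow> 0" by blast
qed

section \<open>Finitely supported vectors and density\<close>

lemma single_apply [simp]: "j \<in> I \<Longrightarrow> single i x j = (if j = i then x else \<zero>)"
  by (simp add: single_def)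

lemma single_closed:
  assumes x: "x \<in> carrier H"
  shows "single i x \<in> carrier K"
  unfolding in_carrier_sum_iff
proof
  show "single i x \<in> I \<rightarrow>\<^sub>E carrier H" using x by (auto simp: single_def)
  have "(\<lambda>j. (vnorm H (single i x j))\<^sup>2) summable_on I
      \<longleftrightarrow> (\<lambda>j. (vnorm H (single i x j))\<^sup>2) summable_on (I \<inter> {i})"
    by (rule summable_on_cong_neutral) auto
  then show "(\<lambda>j. (vnorm H (single i x j))\<^sup>2) summable_on I" by (simp add: summable_on_finite)
qed

lemma cinner_single_left:
  assumes "x \<in> carrier H" "\<xi> \<in> carrier K" "i \<in> I"
  shows "cinner K (single i x) \<xi> = cinner H x (\<xi> i)"
proof -
  have "cinner K (single i x) \<xi> = (\<Sum>\<^sub>\<infinity>j\<in>{i}. cinner H (single i x j) (\<xi> j))"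
    unfolding cinner_sum
    by (rule infsum_cong_neutral) (use assms in \<open>auto simp: cinner_zero_left component_closed\<close>)
  then show ?thesis using assms by simp
qed

lemma vnorm_single: "\<lbrakk>x \<in> carrier H; i \<in> I\<rbrakk> \<Longrightarrow> vnorm K (single i x) = vnorm H x"
  by (simp add: vnorm_def cinner_single_left single_closed)

lemma single_minus:
  assumes "x \<in> carrier H" "y \<in> carrier H" "i \<in> I"
  shows "single i x \<ominus>\<^bsub>K\<^esub> single i y = single i (x \<ominus> y)"
  by (rule carrier_sum_eqI) (use assms in \<open>auto simp: minus_sum_apply single_closed a_minus_zero\<close>)

lemma vdist_single:
  assumes "x \<in> carrier H" "y \<in> carrier H" "i \<in> I"
  shows "vdist K (single i x) (single i y) = vdist H x y"
  using assms by (simp add: vdist_def single_minus vnorm_single)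

definition truncate :: "'i set \<Rightarrow> ('i \<Rightarrow> 'v) \<Rightarrow> 'i \<Rightarrow> 'v" where
  "truncate F \<xi> = (\<lambda>i\<in>I. if i \<in> F then \<xi> i else \<zero>)"

lemma truncate_apply: "i \<in> I \<Longrightarrow> truncate F \<xi> i = (if i \<in> F then \<xi> i else \<zero>)"
  by (simp add: truncate_def)

lemma truncate_closed:
  assumes x: "\<xi> \<in> carrier K"
  shows "truncate F \<xi> \<in> carrier K"
  unfolding in_carrier_sum_iff
proof
  show "truncate F \<xi> \<in> I \<rightarrow>\<^sub>E carrier H" using x by (auto simp: truncate_def)
  show "(\<lambda>i. (vnorm H (truncate F \<xi> i))\<^sup>2) summable_on I"
    by (rule summable_on_comparison_test[OF summable_vnorm[OF x]]) (auto simp: truncate_def)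
qed

lemma truncate_approx:
  assumes x: "\<xi> \<in> carrier K" and e: "e > 0"
  obtains F where "finite F" "F \<subseteq> I" "vdist K (truncate F \<xi>) \<xi> < e"
proof -
  define f where "f = (\<lambda>i. (vnorm H (\<xi> i))\<^sup>2)"
  have f: "f summable_on I" unfolding f_def by (rule summable_vnorm[OF x])
  \<comment> \<open>The squared distance from the truncation is exactly the missing part of the sum
    of squares. Half of the squared \<open>e\<close> leaves room for a strict inequality.\<close>
  obtain F where F: "finite F" "F \<subseteq> I" "dist (sum f F) (infsum f I) \<le> e\<^sup>2 / 2"
    using infsum_finite_approximation[OF f, of "e\<^sup>2 / 2"] e by auto
  have t: "truncate F \<xi> \<in> carrier K" using x by (rule truncate_closed)
  have "(vnorm K (truncate F \<xi>))\<^sup>2 = (\<Sum>\<^sub>\<infinity>i\<in>F. f i)"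
    unfolding power2_vnorm_sum[OF t]
    by (rule infsum_cong_neutral) (use F in \<open>auto simp: truncate_def f_def\<close>)
  then have 1: "(vnorm K (truncate F \<xi>))\<^sup>2 = sum f F" using F by simp
  have "cinner K (truncate F \<xi>) \<xi> = (\<Sum>\<^sub>\<infinity>i\<in>F. of_real (f i))"
    unfolding cinner_sum
    by (rule infsum_cong_neutral)
      (use F x in \<open>auto simp: truncate_def f_def cinner_zero_left cinner_self component_closed\<close>)
  then have 2: "cinner K (truncate F \<xi>) \<xi> = of_real (sum f F)" using F by simp
  have "(vdist K (truncate F \<xi>) \<xi>)\<^sup>2 = infsum f I - sum f F"
    using x t 1 by (simp add: K.power2_vdist 2 power2_vnorm_sum[OF x] f_def[symmetric])
  also have "\<dots> < e\<^sup>2" using F(3) e zero_less_power[OF e, of 2] unfolding dist_real_def by linarith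
  finally show thesis using that F e by (meson power2_less_imp_less less_imp_le)
qed

text \<open>The closure of \<open>D\<close> contains every one-component vector by density of
  \<open>B\<close> and is stable under addition. It therefore contains all finite truncations, and
  these approximate everything.\<close>

lemma dense_in_sumI:
  assumes D: "D \<subseteq> carrier K" and zero: "\<zero>\<^bsub>K\<^esub> \<in> D"
    and add: "\<And>\<xi> \<eta>. \<lbrakk>\<xi> \<in> D; \<eta> \<in> D\<rbrakk> \<Longrightarrow> \<xi> \<oplus>\<^bsub>K\<^esub> \<eta> \<in> D"
    and B: "dense_in H B" and single: "\<And>i b. \<lbrakk>i \<in> I; b \<in> B\<rbrakk> \<Longrightarrow> single i b \<in> D"
  shows "dense_in K D"
proof -
  define C where "C = {\<xi> \<in> carrier K. \<forall>e>0. \<exists>a\<in>D. vdist K a \<xi> < e}"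
  have C_approx: "\<exists>a\<in>D. vdist K a \<xi> < e" if "\<xi> \<in> C" "e > 0" for \<xi> e
    using that by (simp add: C_def)
  have C_zero: "\<zero>\<^bsub>K\<^esub> \<in> C"
    using zero D by (auto simp: C_def intro!: bexI[of _ "\<zero>\<^bsub>K\<^esub>"])
  have C_single: "single i x \<in> C" if "i \<in> I" "x \<in> carrier H" for i x
  proof -
    have "\<exists>a\<in>D. vdist K a (single i x) < e" if e: "e > 0" for e
    proof -
      obtain b where b: "b \<in> B" "vdist H b x < e" using B e \<open>x \<in> carrier H\<close> unfolding dense_in_def by blast
      then have "b \<in> carrier H" using B by (auto simp: dense_in_def)
      then show ?thesis using b single \<open>i \<in> I\<close> \<open>x \<in> carrier H\<close>
        by (intro bexI[of _ "single i b"]) (auto simp: vdist_single)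
    qed
    with that show ?thesis by (simp add: C_def single_closed)
  qed
  have C_add: "\<xi> \<oplus>\<^bsub>K\<^esub> \<eta> \<in> C" if "\<xi> \<in> C" "\<eta> \<in> C" for \<xi> \<eta>
  proof -
    have "\<exists>a\<in>D. vdist K a (\<xi> \<oplus>\<^bsub>K\<^esub> \<eta>) < e" if e: "e > 0" for e
    proof -
      obtain a b where ab: "a \<in> D" "b \<in> D" "vdist K a \<xi> < e / 2" "vdist K b \<eta> < e / 2"
        using C_approx[OF \<open>\<xi> \<in> C\<close>, of "e / 2"] C_approx[OF \<open>\<eta> \<in> C\<close>, of "e / 2"] e by auto
      have C: "a \<in> carrier K" "b \<in> carrier K" "\<xi> \<in> carrier K" "\<eta> \<in> carrier K"
        using ab D \<open>\<xi> \<in> C\<close> \<open>\<eta> \<in> C\<close> by (auto simp: C_def)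
      have "(a \<oplus>\<^bsub>K\<^esub> b) \<ominus>\<^bsub>K\<^esub> (\<xi> \<oplus>\<^bsub>K\<^esub> \<eta>) = (a \<ominus>\<^bsub>K\<^esub> \<xi>) \<oplus>\<^bsub>K\<^esub> (b \<ominus>\<^bsub>K\<^esub> \<eta>)"
        by (rule K.cinner_eqI) (use C in \<open>auto simp: K.cinner_simps\<close>)
      then have "vdist K (a \<oplus>\<^bsub>K\<^esub> b) (\<xi> \<oplus>\<^bsub>K\<^esub> \<eta>) \<le> vdist K a \<xi> + vdist K b \<eta>"
        using C K.vnorm_triangle[of "a \<ominus>\<^bsub>K\<^esub> \<xi>" "b \<ominus>\<^bsub>K\<^esub> \<eta>"] by (simp add: vdist_def)
      with ab add show ?thesis by (intro bexI[of _ "a \<oplus>\<^bsub>K\<^esub> b"]) auto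
    qed
    with that show ?thesis by (simp add: C_def add_sum_closed)
  qed
  have C_truncate: "truncate F \<xi> \<in> C" if "finite F" "F \<subseteq> I" "\<xi> \<in> carrier K" for F \<xi>
    using that
  proof (induction F rule: finite_induct)
    case empty
    have "truncate {} \<xi> = \<zero>\<^bsub>K\<^esub>"
      by (rule carrier_sum_eqI)
        (use empty truncate_closed zero_sum_closed in \<open>auto simp: truncate_apply\<close>)
    then show ?case using C_zero by simp
  next
    case (insert i F)
    have "truncate (insert i F) \<xi> = truncate F \<xi> \<oplus>\<^bsub>K\<^esub> single i (\<xi> i)"
      by (rule carrier_sum_eqI)
        (use insert in \<open>auto simp: truncate_closed add_sum_closed single_closed component_closed
          truncate_apply\<close>)
    then show ?case using insert C_add C_single by (auto simp: component_closed)
  qed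
  have "\<exists>a\<in>D. vdist K a \<xi> < e" if x: "\<xi> \<in> carrier K" and e: "e > 0" for \<xi> e
  proof -
    obtain F where F: "finite F" "F \<subseteq> I" "vdist K (truncate F \<xi>) \<xi> < e / 2"
      using truncate_approx[OF x, of "e / 2"] e by auto
    obtain a where a: "a \<in> D" "vdist K a (truncate F \<xi>) < e / 2"
      using C_approx[OF C_truncate[OF F(1,2) x], of "e / 2"] e by auto
    then have "vdist K a \<xi> < e"
      using K.vdist_triangle[of a "truncate F \<xi>" \<xi>] F(3) x D truncate_closed[OF x] by auto
    with a show ?thesis by blast
  qed
  with D show ?thesis unfolding dense_in_def by blast
qed

section \<open>Operators that permute coordinates and act in each of them\<close>

interpretation K: hilbert_space K by (rule hilbert_space_sum)

text \<open>The common shape of \<open>cp_pi\<close>, \<open>cp_U\<close>, the operators commuting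
  with them and the conjugation \<open>J\<close>. The maps \<open>b i\<close> may be antilinear, as
  they are for \<open>J\<close>.\<close>

definition componentwise :: "('i \<Rightarrow> 'v \<Rightarrow> 'v) \<Rightarrow> ('i \<Rightarrow> 'i) \<Rightarrow> ('i \<Rightarrow> 'v) \<Rightarrow> 'i \<Rightarrow> 'v" where
  "componentwise b \<sigma> = (\<lambda>\<xi>\<in>carrier K. \<lambda>i\<in>I. b i (\<xi> (\<sigma> i)))"

lemma componentwise_apply [simp]:
  "\<lbrakk>\<xi> \<in> carrier K; i \<in> I\<rbrakk> \<Longrightarrow> componentwise b \<sigma> \<xi> i = b i (\<xi> (\<sigma> i))"
  by (simp add: componentwise_def)

lemma
  assumes \<sigma>: "bij_betw \<sigma> I I"
    and b: "\<And>i x. \<lbrakk>i \<in> I; x \<in> carrier H\<rbrakk> \<Longrightarrow> b i x \<in> carrier H"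
    and bound: "\<And>i x. \<lbrakk>i \<in> I; x \<in> carrier H\<rbrakk> \<Longrightarrow> vnorm H (b i x) \<le> c * vnorm H x"
    and \<xi>: "\<xi> \<in> carrier K"
  shows componentwise_closed: "componentwise b \<sigma> \<xi> \<in> carrier K"
    and vnorm_componentwise_le: "vnorm K (componentwise b \<sigma> \<xi>) \<le> \<bar>c\<bar> * vnorm K \<xi>"
proof -
  have \<sigma>I: "\<sigma> i \<in> I" if "i \<in> I" for i using \<sigma> that by (rule bij_betw_apply)
  have le: "(vnorm H (b i (\<xi> (\<sigma> i))))\<^sup>2 \<le> c\<^sup>2 * (vnorm H (\<xi> (\<sigma> i)))\<^sup>2" if i: "i \<in> I" for i
  proof -
    have "\<xi> (\<sigma> i) \<in> carrier H" using \<xi> \<sigma>I[OF i] by auto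
    then have "(vnorm H (b i (\<xi> (\<sigma> i))))\<^sup>2 \<le> (c * vnorm H (\<xi> (\<sigma> i)))\<^sup>2"
      using bound b i by (intro power_mono) auto
    then show ?thesis by (simp add: power_mult_distrib)
  qed
  have sum: "(\<lambda>i. c\<^sup>2 * (vnorm H (\<xi> (\<sigma> i)))\<^sup>2) summable_on I"
    using summable_vnorm[OF \<xi>] summable_on_reindex_bij_betw[OF \<sigma>, of "\<lambda>i. (vnorm H (\<xi> i))\<^sup>2"]
    by (intro summable_on_cmult_right) auto
  have "(\<lambda>i. (vnorm H (componentwise b \<sigma> \<xi> i))\<^sup>2) summable_on I"
    by (rule summable_on_comparison_test[OF sum]) (use \<xi> le in auto)
  then show closed: "componentwise b \<sigma> \<xi> \<in> carrier K"
    using \<xi> b \<sigma>I by (auto simp: in_carrier_sum_iff componentwise_def PiE_iff)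
  have "(vnorm K (componentwise b \<sigma> \<xi>))\<^sup>2 \<le> (\<Sum>\<^sub>\<infinity>i\<in>I. c\<^sup>2 * (vnorm H (\<xi> (\<sigma> i)))\<^sup>2)"
    unfolding power2_vnorm_sum[OF closed]
    by (rule infsum_mono[OF summable_vnorm[OF closed] sum]) (use \<xi> le in auto)
  also have "\<dots> = c\<^sup>2 * (\<Sum>\<^sub>\<infinity>i\<in>I. (vnorm H (\<xi> i))\<^sup>2)"
    using infsum_reindex_bij_betw[OF \<sigma>, of "\<lambda>i. (vnorm H (\<xi> i))\<^sup>2"] by (simp add: infsum_cmult_right')
  also have "\<dots> = (\<bar>c\<bar> * vnorm K \<xi>)\<^sup>2" by (simp add: power_mult_distrib power2_vnorm_sum[OF \<xi>])
  finally show "vnorm K (componentwise b \<sigma> \<xi>) \<le> \<bar>c\<bar> * vnorm K \<xi>"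
    by (rule power2_le_imp_le) (use \<xi> in simp)
qed

lemma componentwise_in_bop:
  assumes \<sigma>: "bij_betw \<sigma> I I"
    and b: "\<And>i x. \<lbrakk>i \<in> I; x \<in> carrier H\<rbrakk> \<Longrightarrow> b i x \<in> carrier H"
    and bound: "\<And>i x. \<lbrakk>i \<in> I; x \<in> carrier H\<rbrakk> \<Longrightarrow> vnorm H (b i x) \<le> c * vnorm H x"
    and add: "\<And>i x y. \<lbrakk>i \<in> I; x \<in> carrier H; y \<in> carrier H\<rbrakk> \<Longrightarrow> b i (x \<oplus> y) = b i x \<oplus> b i y"
    and smult: "\<And>i d x. \<lbrakk>i \<in> I; x \<in> carrier H\<rbrakk> \<Longrightarrow> b i (d \<odot> x) = d \<odot> b i x"
  shows "componentwise b \<sigma> \<in> bop K"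
proof (rule K.bopI[where b = "\<bar>c\<bar>"])
  have \<sigma>I: "\<sigma> i \<in> I" if "i \<in> I" for i using \<sigma> that by (rule bij_betw_apply)
  note closed = componentwise_closed[where b = b, OF \<sigma> b bound]
  show "componentwise b \<sigma> \<in> carrier K \<rightarrow>\<^sub>E carrier K"
    using closed by (auto simp: componentwise_def)
  fix \<xi> assume \<xi>: "\<xi> \<in> carrier K"
  show "vnorm K (componentwise b \<sigma> \<xi>) \<le> \<bar>c\<bar> * vnorm K \<xi>"
    by (rule vnorm_componentwise_le[where b = b, OF \<sigma> b bound \<xi>])
  show "componentwise b \<sigma> (d \<odot>\<^bsub>K\<^esub> \<xi>) = d \<odot>\<^bsub>K\<^esub> componentwise b \<sigma> \<xi>" for d
    by (rule carrier_sum_eqI) (use \<xi> \<sigma>I smult in \<open>auto simp: closed component_closed\<close>)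
  fix \<eta> assume \<eta>: "\<eta> \<in> carrier K"
  show "componentwise b \<sigma> (\<xi> \<oplus>\<^bsub>K\<^esub> \<eta>) = componentwise b \<sigma> \<xi> \<oplus>\<^bsub>K\<^esub> componentwise b \<sigma> \<eta>"
    by (rule carrier_sum_eqI) (use \<xi> \<eta> \<sigma>I add in \<open>auto simp: closed component_closed\<close>)
qed

text \<open>Reindexing the sum by \<open>\<sigma>\<close> moves the permutation to the other slot,
  so the block at \<open>i\<close> has its adjoint at position \<open>\<sigma> i\<close>.\<close>

lemma adj_componentwise:
  assumes \<sigma>: "bij_betw \<sigma> I I" and \<tau>: "\<And>i. i \<in> I \<Longrightarrow> \<tau> (\<sigma> i) = i"
    and bop: "componentwise b' \<tau> \<in> bop K"
    and adj: "\<And>i x y. \<lbrakk>i \<in> I; x \<in> carrier H; y \<in> carrier H\<rbrakk> \<Longrightarrow>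
      cinner H x (b i y) = cinner H (b' (\<sigma> i) x) y"
  shows "adj K (componentwise b \<sigma>) = componentwise b' \<tau>"
proof (rule K.adjI[OF bop])
  fix \<xi> \<eta> assume \<xi>: "\<xi> \<in> carrier K" and \<eta>: "\<eta> \<in> carrier K"
  have \<sigma>I: "\<sigma> i \<in> I" if "i \<in> I" for i using \<sigma> that by (rule bij_betw_apply)
  have "cinner K \<xi> (componentwise b \<sigma> \<eta>)
      = (\<Sum>\<^sub>\<infinity>i\<in>I. cinner H (componentwise b' \<tau> \<xi> (\<sigma> i)) (\<eta> (\<sigma> i)))"
    unfolding cinner_sum by (rule infsum_cong) (use \<xi> \<eta> \<sigma>I \<tau> adj in \<open>auto simp: component_closed\<close>)
  also have "\<dots> = cinner K (componentwise b' \<tau> \<xi>) \<eta>"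
    unfolding cinner_sum by (rule infsum_reindex_bij_betw[OF \<sigma>])
  finally show "cinner K \<xi> (componentwise b \<sigma> \<eta>) = cinner K (componentwise b' \<tau> \<xi>) \<eta>" .
qed

lemma single_add:
  "\<lbrakk>x \<in> carrier H; y \<in> carrier H\<rbrakk> \<Longrightarrow> single i (x \<oplus> y) = single i x \<oplus>\<^bsub>K\<^esub> single i y"
  by (rule carrier_sum_eqI) (auto simp: single_closed)

lemma single_smult: "x \<in> carrier H \<Longrightarrow> single i (c \<odot> x) = c \<odot>\<^bsub>K\<^esub> single i x"
  by (rule carrier_sum_eqI) (auto simp: single_closed smult_zero)

end

section \<open>Classes of measurable functions\<close>

lemma borel_measurable_cnj [measurable]:
  "f \<in> borel_measurable M \<Longrightarrow> (\<lambda>x. cnj (f x)) \<in> borel_measurable M"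
  by (rule borel_measurable_continuous_on[of cnj]) (auto intro: continuous_intros)

lemma in_ae_class: "f \<in> borel_measurable M \<Longrightarrow> f \<in> ae_class M f"
  by (simp add: ae_class_def)

lemma ae_class_eqI:
  assumes "AE x in M. f x = g x"
  shows "ae_class M f = ae_class M g"
  using assms unfolding ae_class_def by (auto elim: eventually_elim2)

lemma ae_class_eqD:
  assumes "f \<in> borel_measurable M" "ae_class M f = ae_class M g"
  shows "AE x in M. f x = g x"
proof -
  have "f \<in> ae_class M g" using in_ae_class[OF assms(1)] assms(2) by simp
  then show ?thesis by (simp add: ae_class_def)
qed

lemma
  assumes "f \<in> borel_measurable M"
  shows rep_measurable [measurable]: "rep (ae_class M f) \<in> borel_measurable M"
    and rep_AE: "AE x in M. rep (ae_class M f) x = f x"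
proof -
  have "rep (ae_class M f) \<in> ae_class M f"
    unfolding rep_def using in_ae_class[OF assms] by (rule someI[where P = "\<lambda>g. g \<in> ae_class M f"])
  then show "rep (ae_class M f) \<in> borel_measurable M" "AE x in M. rep (ae_class M f) x = f x"
    by (auto simp: ae_class_def)
qed

text \<open>This and its analogues for the other operations eliminate the representatives chosen by
  \<open>rep\<close>: identities of classes become pointwise identities of arbitrary measurable
  representatives.\<close>

lemma cl_mult_class:
  assumes f: "f \<in> borel_measurable M" and g: "g \<in> borel_measurable M"
  shows "cl_mult M (ae_class M f) (ae_class M g) = ae_class M (\<lambda>x. f x * g x)"
  unfolding cl_mult_def using rep_AE[OF f] rep_AE[OF g] by (intro ae_class_eqI) auto

lemma cl_cnj_class:
  assumes f: "f \<in> borel_measurable M"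
  shows "cl_cnj M (ae_class M f) = ae_class M (\<lambda>x. cnj (f x))"
  unfolding cl_cnj_def using rep_AE[OF f] by (intro ae_class_eqI) auto

section \<open>Square integrable functions and the inner product of L^2\<close>

definition square_integrable :: "'x measure \<Rightarrow> ('x \<Rightarrow> complex) \<Rightarrow> bool" where
  "square_integrable M f \<longleftrightarrow> f \<in> borel_measurable M \<and> integrable M (\<lambda>x. (cmod (f x))\<^sup>2)"

lemma square_integrable_measurable: "square_integrable M f \<Longrightarrow> f \<in> borel_measurable M"
  by (simp add: square_integrable_def)

lemma square_integrable_bound:
  assumes "integrable M h" "f \<in> borel_measurable M" "AE x in M. (cmod (f x))\<^sup>2 \<le> h x"
  shows "square_integrable M f"
  unfolding square_integrable_def
  using assms by (auto intro!: Bochner_Integration.integrable_bound[OF assms(1)])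

lemma square_integrable_add:
  assumes f: "square_integrable M f" and g: "square_integrable M g"
  shows "square_integrable M (\<lambda>x. f x + g x)"
proof (rule square_integrable_bound)
  show "integrable M (\<lambda>x. 2 * (cmod (f x))\<^sup>2 + 2 * (cmod (g x))\<^sup>2)"
    using f g by (simp add: square_integrable_def)
  have "(cmod (a + b))\<^sup>2 \<le> 2 * (cmod a)\<^sup>2 + 2 * (cmod b)\<^sup>2" for a b :: complex
  proof -
    have "(cmod (a + b))\<^sup>2 \<le> (cmod a + cmod b)\<^sup>2" by (intro power_mono norm_triangle_ineq) simp
    then show ?thesis using zero_le_power2[of "cmod a - cmod b"]
      by (simp add: power2_sum power2_diff)
  qed
  then show "AE x in M. (cmod (f x + g x))\<^sup>2 \<le> 2 * (cmod (f x))\<^sup>2 + 2 * (cmod (g x))\<^sup>2" by simp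
qed (use f g in \<open>auto simp: square_integrable_def\<close>)

lemma square_integrable_mult_bounded:
  assumes f: "square_integrable M f" and a: "a \<in> borel_measurable M" "AE x in M. cmod (a x) \<le> b"
  shows "square_integrable M (\<lambda>x. a x * f x)"
proof (rule square_integrable_bound)
  show "integrable M (\<lambda>x. b\<^sup>2 * (cmod (f x))\<^sup>2)"
    using f by (simp add: square_integrable_def)
  show "AE x in M. (cmod (a x * f x))\<^sup>2 \<le> b\<^sup>2 * (cmod (f x))\<^sup>2"
    using a(2) by eventually_elim (auto simp: norm_mult power_mult_distrib intro!: mult_right_mono power_mono)
qed (use f a in \<open>auto simp: square_integrable_def\<close>)

lemma square_integrable_smult: "square_integrable M f \<Longrightarrow> square_integrable M (\<lambda>x. c * f x)"
  by (rule square_integrable_mult_bounded) auto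

lemma integrable_cnj_mult:
  assumes f: "square_integrable M f" and g: "square_integrable M g"
  shows "integrable M (\<lambda>x. cnj (f x) * g x)"
proof (rule Bochner_Integration.integrable_bound)
  show "integrable M (\<lambda>x. (cmod (f x))\<^sup>2 + (cmod (g x))\<^sup>2)"
    using f g by (simp add: square_integrable_def)
  have "cmod a * cmod b \<le> (cmod a)\<^sup>2 + (cmod b)\<^sup>2" for a b
  proof -
    have "2 * (cmod a * cmod b) \<le> (cmod a)\<^sup>2 + (cmod b)\<^sup>2"
      using zero_le_power2[of "cmod a - cmod b"] by (simp add: power2_diff)
    moreover have "0 \<le> cmod a * cmod b" by simp
    ultimately show ?thesis by linarith
  qed
  then show "AE x in M. norm (cnj (f x) * g x) \<le> norm ((cmod (f x))\<^sup>2 + (cmod (g x))\<^sup>2)"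
    by (simp add: norm_mult)
qed (use f g in \<open>auto simp: square_integrable_def\<close>)

lemma carrier_L2: "carrier (L2 M) = {ae_class M f | f. square_integrable M f}"
  by (simp add: L2_def square_integrable_def)

lemma in_carrier_L2: "square_integrable M f \<Longrightarrow> ae_class M f \<in> carrier (L2 M)"
  by (auto simp: carrier_L2)

lemma carrier_L2E:
  assumes "F \<in> carrier (L2 M)"
  obtains f where "square_integrable M f" "F = ae_class M f"
  using assms by (auto simp: carrier_L2)

lemma LinfE:
  assumes "F \<in> Linf M"
  obtains f b where "f \<in> borel_measurable M" "AE x in M. cmod (f x) \<le> b" "F = ae_class M f"
  using assms by (auto simp: Linf_def)

lemma LinfI: "\<lbrakk>f \<in> borel_measurable M; AE x in M. cmod (f x) \<le> b\<rbrakk> \<Longrightarrow> ae_class M f \<in> Linf M"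
  by (auto simp: Linf_def)

lemma zero_L2: "\<zero>\<^bsub>L2 M\<^esub> = ae_class M (\<lambda>_. 0)"
  by (simp add: L2_def)

lemma add_L2_class:
  assumes f: "f \<in> borel_measurable M" and g: "g \<in> borel_measurable M"
  shows "ae_class M f \<oplus>\<^bsub>L2 M\<^esub> ae_class M g = ae_class M (\<lambda>x. f x + g x)"
proof -
  have "ae_class M f \<oplus>\<^bsub>L2 M\<^esub> ae_class M g = ae_class M (\<lambda>x. rep (ae_class M f) x + rep (ae_class M g) x)"
    by (simp add: L2_def)
  also have "\<dots> = ae_class M (\<lambda>x. f x + g x)"
    using rep_AE[OF f] rep_AE[OF g] by (intro ae_class_eqI) auto
  finally show ?thesis .
qed

lemma smult_L2_class:
  assumes f: "f \<in> borel_measurable M"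
  shows "c \<odot>\<^bsub>L2 M\<^esub> ae_class M f = ae_class M (\<lambda>x. c * f x)"
proof -
  have "c \<odot>\<^bsub>L2 M\<^esub> ae_class M f = ae_class M (\<lambda>x. c * rep (ae_class M f) x)"
    by (simp add: L2_def)
  also have "\<dots> = ae_class M (\<lambda>x. c * f x)"
    using rep_AE[OF f] by (intro ae_class_eqI) auto
  finally show ?thesis .
qed

lemma cinner_L2_class:
  assumes f [measurable]: "f \<in> borel_measurable M" and g [measurable]: "g \<in> borel_measurable M"
  shows "cinner (L2 M) (ae_class M f) (ae_class M g) = (\<integral>x. cnj (f x) * g x \<partial>M)"
proof -
  have "cinner (L2 M) (ae_class M f) (ae_class M g)
      = (\<integral>x. cnj (rep (ae_class M f) x) * rep (ae_class M g) x \<partial>M)"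
    by (simp add: L2_def)
  also have "\<dots> = (\<integral>x. cnj (f x) * g x \<partial>M)"
    using rep_AE[OF f] rep_AE[OF g] by (intro integral_cong_AE) auto
  finally show ?thesis .
qed

lemma cinner_L2_self:
  assumes f: "f \<in> borel_measurable M"
  shows "cinner (L2 M) (ae_class M f) (ae_class M f) = of_real (\<integral>x. (cmod (f x))\<^sup>2 \<partial>M)"
proof -
  have "(\<integral>x. cnj (f x) * f x \<partial>M) = (\<integral>x. complex_of_real ((cmod (f x))\<^sup>2) \<partial>M)"
    by (intro Bochner_Integration.integral_cong refl) (metis complex_norm_square mult.commute of_real_power)
  also have "\<dots> = of_real (\<integral>x. (cmod (f x))\<^sup>2 \<partial>M)" by (rule integral_complex_of_real)
  finally show ?thesis using f by (simp add: cinner_L2_class)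
qed

lemma power2_vnorm_L2:
  "f \<in> borel_measurable M \<Longrightarrow> (vnorm (L2 M) (ae_class M f))\<^sup>2 = (\<integral>x. (cmod (f x))\<^sup>2 \<partial>M)"
  by (simp add: vnorm_def cinner_L2_self)

lemma inner_space_L2: "inner_space (L2 M)"
proof (intro inner_space.intro inner_space_axioms.intro)
  note [simp] = add_L2_class smult_L2_class cinner_L2_class zero_L2
    and [intro] = square_integrable_measurable in_carrier_L2 square_integrable_add square_integrable_smult
  have zero: "square_integrable M (\<lambda>_. 0)" by (simp add: square_integrable_def)
  show "abelian_group (L2 M)"
  proof (rule abelian_groupI)
    fix x assume "x \<in> carrier (L2 M)"
    then obtain f where f: "square_integrable M f" "x = ae_class M f" by (rule carrier_L2E)
    have m: "f \<in> borel_measurable M" using f by auto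
    show "\<exists>y\<in>carrier (L2 M). y \<oplus>\<^bsub>L2 M\<^esub> x = \<zero>\<^bsub>L2 M\<^esub>"
    proof
      show "ae_class M (\<lambda>x. (-1) * f x) \<in> carrier (L2 M)" using f by (intro in_carrier_L2 square_integrable_smult)
      have "(\<lambda>x. (-1) * f x) \<in> borel_measurable M" using m by measurable
      then show "ae_class M (\<lambda>x. (-1) * f x) \<oplus>\<^bsub>L2 M\<^esub> x = \<zero>\<^bsub>L2 M\<^esub>" using m f by simp
    qed
  next
    fix x y z assume "x \<in> carrier (L2 M)" "y \<in> carrier (L2 M)" "z \<in> carrier (L2 M)"
    then obtain f g h where *: "square_integrable M f" "x = ae_class M f" "square_integrable M g"
      "y = ae_class M g" "square_integrable M h" "z = ae_class M h" by (meson carrier_L2E)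
    then have [simp, measurable]: "f \<in> borel_measurable M" "g \<in> borel_measurable M" "h \<in> borel_measurable M"
      by auto
    show "x \<oplus>\<^bsub>L2 M\<^esub> y \<oplus>\<^bsub>L2 M\<^esub> z = x \<oplus>\<^bsub>L2 M\<^esub> (y \<oplus>\<^bsub>L2 M\<^esub> z)"
      using * by (simp add: add.assoc)
  qed (use zero in \<open>auto elim!: carrier_L2E simp: square_integrable_measurable add.commute
      intro!: in_carrier_L2 square_integrable_add\<close>)
next
  fix x c assume "x \<in> carrier (L2 M)"
  then show "c \<odot>\<^bsub>L2 M\<^esub> x \<in> carrier (L2 M)"
    by (auto elim!: carrier_L2E simp: smult_L2_class square_integrable_measurable
        intro!: in_carrier_L2 square_integrable_smult)
next
  fix x y z assume "x \<in> carrier (L2 M)" "y \<in> carrier (L2 M)" "z \<in> carrier (L2 M)"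
  then obtain f g h where *: "square_integrable M f" "x = ae_class M f" "square_integrable M g"
    "y = ae_class M g" "square_integrable M h" "z = ae_class M h" by (meson carrier_L2E)
  then have [simp, measurable]: "f \<in> borel_measurable M" "g \<in> borel_measurable M" "h \<in> borel_measurable M"
    by (auto simp: square_integrable_measurable)
  show "cinner (L2 M) x (y \<oplus>\<^bsub>L2 M\<^esub> z) = cinner (L2 M) x y + cinner (L2 M) x z"
    using * by (simp add: add_L2_class cinner_L2_class distrib_left integrable_cnj_mult)
next
  fix x y c assume "x \<in> carrier (L2 M)" "y \<in> carrier (L2 M)"
  then obtain f g where *: "square_integrable M f" "x = ae_class M f" "square_integrable M g"
    "y = ae_class M g" by (meson carrier_L2E)
  then have [simp, measurable]: "f \<in> borel_measurable M" "g \<in> borel_measurable M"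
    by (auto simp: square_integrable_measurable)
  show "cinner (L2 M) x (c \<odot>\<^bsub>L2 M\<^esub> y) = c * cinner (L2 M) x y"
    using * by (simp add: smult_L2_class cinner_L2_class mult.left_commute[of _ c])
next
  fix x y assume "x \<in> carrier (L2 M)" "y \<in> carrier (L2 M)"
  then obtain f g where *: "square_integrable M f" "x = ae_class M f" "square_integrable M g"
    "y = ae_class M g" by (meson carrier_L2E)
  then have [simp, measurable]: "f \<in> borel_measurable M" "g \<in> borel_measurable M"
    by (auto simp: square_integrable_measurable)
  show "cinner (L2 M) x y = cnj (cinner (L2 M) y x)"
    using * Bochner_Integration.integral_cnj[of M "\<lambda>x. cnj (g x) * f x"] by (simp add: cinner_L2_class mult.commute)
next
  fix x assume "x \<in> carrier (L2 M)"
  then obtain f where f: "square_integrable M f" "x = ae_class M f" by (rule carrier_L2E)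
  then show "0 \<le> Re (cinner (L2 M) x x)"
    by (simp add: cinner_L2_self square_integrable_measurable)
  assume "cinner (L2 M) x x = 0"
  then have "(\<integral>x. (cmod (f x))\<^sup>2 \<partial>M) = 0"
    using f by (simp add: cinner_L2_self square_integrable_measurable)
  then have "AE x in M. (cmod (f x))\<^sup>2 = 0"
    using f by (subst (asm) integral_nonneg_eq_0_iff_AE) (auto simp: square_integrable_def)
  then show "x = \<zero>\<^bsub>L2 M\<^esub>" using f by (auto simp: zero_L2 intro!: ae_class_eqI)
qed

interpretation L2: inner_space "L2 M" for M :: "'x measure" by (rule inner_space_L2)

lemma square_integrable_diff:
  "\<lbrakk>square_integrable M f; square_integrable M g\<rbrakk> \<Longrightarrow> square_integrable M (\<lambda>x. f x - g x)"
  using square_integrable_add[of M f "\<lambda>x. (-1) * g x"] square_integrable_smult[of M g "-1"] by simp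

lemma minus_L2_class:
  assumes f: "square_integrable M f" and g: "square_integrable M g"
  shows "ae_class M f \<ominus>\<^bsub>L2 M\<^esub> ae_class M g = ae_class M (\<lambda>x. f x - g x)"
proof -
  have [measurable]: "f \<in> borel_measurable M" "g \<in> borel_measurable M"
    using f g by (auto simp: square_integrable_measurable)
  have "ae_class M f \<ominus>\<^bsub>L2 M\<^esub> ae_class M g = ae_class M f \<oplus>\<^bsub>L2 M\<^esub> (-1) \<odot>\<^bsub>L2 M\<^esub> ae_class M g"
    using f g by (intro L2.a_minus_eq_smult in_carrier_L2)
  also have "\<dots> = ae_class M (\<lambda>x. f x + (-1) * g x)"
    by (simp only: smult_L2_class add_L2_class borel_measurable_times borel_measurable_const
        \<open>f \<in> borel_measurable M\<close> \<open>g \<in> borel_measurable M\<close>)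
  finally show ?thesis by simp
qed

lemma power2_vdist_L2:
  assumes "square_integrable M f" "square_integrable M g"
  shows "(vdist (L2 M) (ae_class M f) (ae_class M g))\<^sup>2 = (\<integral>x. (cmod (f x - g x))\<^sup>2 \<partial>M)"
  using assms square_integrable_measurable[OF square_integrable_diff[OF assms]]
  by (simp add: vdist_def minus_L2_class power2_vnorm_L2)

section \<open>Completeness of L^2 over a probability space\<close>

context prob_space begin

lemma square_integrable_imp_integrable_norm:
  assumes f: "square_integrable M f"
  shows "integrable M (\<lambda>x. cmod (f x))"
proof (rule Bochner_Integration.integrable_bound)
  show "integrable M (\<lambda>x. 1 + (cmod (f x))\<^sup>2)" using f by (simp add: square_integrable_def)
  have "r \<le> 1 + r\<^sup>2" for r :: real using zero_le_power2[of "r - 1/2"]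
    by (simp add: power2_diff power_divide)
  then show "AE x in M. norm (cmod (f x)) \<le> norm (1 + (cmod (f x))\<^sup>2)" by simp
qed (use f in \<open>auto simp: square_integrable_def\<close>)

lemma square_integrable_imp_integrable: "square_integrable M f \<Longrightarrow> integrable M f"
  using square_integrable_imp_integrable_norm[of f] integrable_norm_cancel[of M f]
  by (simp add: square_integrable_measurable)

text \<open>Integrate \<open>(cmod (f x) - e)\<^sup>2 \<ge> 0\<close> over a space of mass 1. It
  makes a Cauchy sequence of L^2 one of L^1, for which almost everywhere convergent subsequences are
  available.\<close>

lemma L1_less_if_L2_less:
  assumes f: "square_integrable M f" and e: "e > 0" and le: "(\<integral>x. (cmod (f x))\<^sup>2 \<partial>M) < e\<^sup>2"
  shows "(\<integral>x. cmod (f x) \<partial>M) < e"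
proof -
  have 2: "integrable M (\<lambda>x. (cmod (f x))\<^sup>2)" using f by (simp add: square_integrable_def)
  have "2 * e * (\<integral>x. cmod (f x) \<partial>M) = (\<integral>x. 2 * e * cmod (f x) \<partial>M)" by simp
  also have "\<dots> \<le> (\<integral>x. (cmod (f x))\<^sup>2 + e\<^sup>2 \<partial>M)"
  proof (rule integral_mono)
    fix x show "2 * e * cmod (f x) \<le> (cmod (f x))\<^sup>2 + e\<^sup>2"
      using zero_le_power2[of "cmod (f x) - e"] by (simp add: power2_diff mult_ac)
  qed (use 2 f in \<open>auto simp: square_integrable_imp_integrable_norm\<close>)
  also have "\<dots> = (\<integral>x. (cmod (f x))\<^sup>2 \<partial>M) + e\<^sup>2" using 2 by (simp add: prob_space)
  also have "\<dots> < 2 * e * e" using le by (simp add: power2_eq_square)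
  finally show ?thesis using e by simp
qed

text \<open>Riesz-Fischer: a subsequence converges almost everywhere, and Fatou's lemma carries the
  Cauchy estimate over to its limit. This shows both that the limit is square integrable and that
  the whole sequence tends to it.\<close>

lemma hilbert_space_L2: "hilbert_space (L2 M)"
proof (intro hilbert_space.intro hilbert_space_axioms.intro inner_space_L2)
  fix X :: "nat \<Rightarrow> ('a \<Rightarrow> complex) set"
  assume X: "\<And>n. X n \<in> carrier (L2 M)"
    and Cauchy: "\<And>e. e > 0 \<Longrightarrow> \<exists>N. \<forall>m\<ge>N. \<forall>n\<ge>N. vdist (L2 M) (X m) (X n) < e"
  have "\<exists>f. square_integrable M f \<and> X n = ae_class M f" for n using X[of n] by (auto simp: carrier_L2)
  then obtain f where f: "\<And>n. square_integrable M (f n)" and X_eq: "\<And>n. X n = ae_class M (f n)" by metis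
  have [measurable]: "f n \<in> borel_measurable M" for n using f by (rule square_integrable_measurable)
  have f_Cauchy: "\<exists>N. \<forall>m\<ge>N. \<forall>n\<ge>N. (\<integral>x. (cmod (f m x - f n x))\<^sup>2 \<partial>M) < e\<^sup>2" if e: "e > 0" for e
  proof -
    obtain N where N: "\<forall>m\<ge>N. \<forall>n\<ge>N. vdist (L2 M) (X m) (X n) < e" using Cauchy[OF e] by blast
    have "(\<integral>x. (cmod (f m x - f n x))\<^sup>2 \<partial>M) < e\<^sup>2" if "m \<ge> N" "n \<ge> N" for m n
    proof -
      have "(vdist (L2 M) (X m) (X n))\<^sup>2 < e\<^sup>2"
        using N that X by (intro power_strict_mono) auto
      then show ?thesis by (simp add: X_eq power2_vdist_L2 f)
    qed
    then show ?thesis by blast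
  qed
  obtain r where r: "strict_mono r" and AE: "AE x in M. Cauchy (\<lambda>i. f (r i) x)"
  proof (rule cauchy_L1_AE_cauchy_subseq[of M f])
    show "integrable M (f n)" for n using f by (rule square_integrable_imp_integrable)
    fix e :: real assume e: "e > 0"
    show "\<exists>N. \<forall>i\<ge>N. \<forall>j\<ge>N. (LINT x|M. norm (f i x - f j x)) < e"
      using f_Cauchy[OF e] L1_less_if_L2_less[OF square_integrable_diff[OF f f] e] by metis
  qed blast
  \<comment> \<open>Where the subsequence diverges the value is arbitrary; measurability holds
    everywhere and the rest is needed only almost everywhere.\<close>
  define g where "g x = lim (\<lambda>i. f (r i) x)" for x
  have [measurable]: "g \<in> borel_measurable M" unfolding g_def by measurable
  have lim: "AE x in M. (\<lambda>i. f (r i) x) \<longlonglongrightarrow> g x"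
    using AE by eventually_elim (simp add: g_def Cauchy_convergent_iff convergent_LIMSEQ_iff)
  have bound: "integrable M (\<lambda>x. (cmod (f m x - g x))\<^sup>2) \<and> (\<integral>x. (cmod (f m x - g x))\<^sup>2 \<partial>M) \<le> e\<^sup>2"
    if N: "\<forall>m\<ge>N. \<forall>n\<ge>N. (\<integral>x. (cmod (f m x - f n x))\<^sup>2 \<partial>M) < e\<^sup>2" and m: "m \<ge> N" for m N e
  proof -
    have "(\<integral>\<^sup>+x. ennreal ((cmod (f m x - g x))\<^sup>2) \<partial>M)
        = (\<integral>\<^sup>+x. liminf (\<lambda>i. ennreal ((cmod (f m x - f (r i) x))\<^sup>2)) \<partial>M)"
    proof (rule nn_integral_cong_AE)
      show "AE x in M. ennreal ((cmod (f m x - g x))\<^sup>2)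
          = liminf (\<lambda>i. ennreal ((cmod (f m x - f (r i) x))\<^sup>2))"
        using lim
      proof eventually_elim
        case (elim x)
        then have "(\<lambda>i. ennreal ((cmod (f m x - f (r i) x))\<^sup>2)) \<longlonglongrightarrow> ennreal ((cmod (f m x - g x))\<^sup>2)"
          by (intro tendsto_ennrealI tendsto_intros)
        then show ?case by (rule lim_imp_Liminf[OF sequentially_bot, symmetric])
      qed
    qed
    also have "\<dots> \<le> liminf (\<lambda>i. \<integral>\<^sup>+x. ennreal ((cmod (f m x - f (r i) x))\<^sup>2) \<partial>M)"
      by (rule nn_integral_liminf) measurable
    also have "\<dots> \<le> ennreal (e\<^sup>2)"
    proof (rule Liminf_le)
      have "(\<integral>\<^sup>+x. ennreal ((cmod (f m x - f (r i) x))\<^sup>2) \<partial>M) \<le> ennreal (e\<^sup>2)" if "i \<ge> N" for i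
      proof -
        \<comment> \<open>A strictly increasing index sequence satisfies
          \<open>i \<le> r i\<close>.\<close>
        have "r i \<ge> N" using strict_mono_imp_increasing[OF r, of i] that by simp
        then have "(\<integral>x. (cmod (f m x - f (r i) x))\<^sup>2 \<partial>M) \<le> e\<^sup>2" using N m by (auto intro: less_imp_le)
        then show ?thesis
          using square_integrable_diff[OF f f, of m "r i"]
          by (subst nn_integral_eq_integral) (auto simp: square_integrable_def ennreal_leI)
      qed
      then show "\<forall>\<^sub>F i in sequentially.
          (\<integral>\<^sup>+x. ennreal ((cmod (f m x - f (r i) x))\<^sup>2) \<partial>M) \<le> ennreal (e\<^sup>2)"
        by (auto simp: eventually_sequentially)
    qed simp
    finally have le: "(\<integral>\<^sup>+x. ennreal ((cmod (f m x - g x))\<^sup>2) \<partial>M) \<le> ennreal (e\<^sup>2)" .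
    then have int: "integrable M (\<lambda>x. (cmod (f m x - g x))\<^sup>2)"
      by (intro integrableI_bounded) (auto simp: order_le_less_trans)
    with le have "ennreal (\<integral>x. (cmod (f m x - g x))\<^sup>2 \<partial>M) \<le> ennreal (e\<^sup>2)"
      by (subst (asm) nn_integral_eq_integral) auto
    with int show ?thesis by (simp add: ennreal_le_iff)
  qed
  have g: "square_integrable M g"
  proof -
    obtain N where "\<forall>m\<ge>N. \<forall>n\<ge>N. (\<integral>x. (cmod (f m x - f n x))\<^sup>2 \<partial>M) < 1\<^sup>2" using f_Cauchy[of 1] by auto
    then have "square_integrable M (\<lambda>x. f N x - g x)"
      using bound[of N 1 N] by (simp add: square_integrable_def)
    from square_integrable_diff[OF f[of N] this] show ?thesis by simp
  qed
  have "(\<lambda>n. vdist (L2 M) (X n) (ae_class M g)) \<longlonglongrightarrow> 0"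
  proof (rule LIMSEQ_I)
    fix e :: real assume e: "e > 0"
    \<comment> \<open>Halved because the Fatou bound is non-strict.\<close>
    then obtain N where N: "\<forall>m\<ge>N. \<forall>n\<ge>N. (\<integral>x. (cmod (f m x - f n x))\<^sup>2 \<partial>M) < (e / 2)\<^sup>2"
      using f_Cauchy[of "e / 2"] by auto
    have "norm (vdist (L2 M) (X n) (ae_class M g) - 0) < e" if "n \<ge> N" for n
    proof -
      have "(vdist (L2 M) (X n) (ae_class M g))\<^sup>2 \<le> (e / 2)\<^sup>2"
        using bound[OF N that] by (simp add: X_eq power2_vdist_L2 f g)
      then have "vdist (L2 M) (X n) (ae_class M g) \<le> e / 2" by (rule power2_le_imp_le) (use e in simp)
      then show ?thesis using e X g by (simp add: in_carrier_L2)
    qed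
    then show "\<exists>N. \<forall>n\<ge>N. norm (vdist (L2 M) (X n) (ae_class M g) - 0) < e" by blast
  qed
  with g show "\<exists>x\<in>carrier (L2 M). (\<lambda>n. vdist (L2 M) (X n) x) \<longlonglongrightarrow> 0"
    by (auto intro: in_carrier_L2)
qed

section \<open>Bounded functions: density, and a criterion by multiplication\<close>

lemma square_integrable_bounded:
  assumes "f \<in> borel_measurable M" "AE x in M. cmod (f x) \<le> b"
  shows "square_integrable M f"
proof (rule square_integrable_bound)
  show "AE x in M. (cmod (f x))\<^sup>2 \<le> b\<^sup>2" using assms(2) by eventually_elim (auto intro: power_mono)
qed (use assms in auto)

lemma Linf_subset_L2: "Linf M \<subseteq> carrier (L2 M)"
  by (auto elim!: LinfE intro!: in_carrier_L2 square_integrable_bounded)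

lemma dense_Linf: "dense_in (L2 M) (Linf M)"
  unfolding dense_in_def
proof (intro conjI Linf_subset_L2 ballI allI impI)
  fix F and e :: real assume "F \<in> carrier (L2 M)" and e: "e > 0"
  then obtain f where f: "square_integrable M f" and F: "F = ae_class M f" by (elim carrier_L2E)
  have [measurable]: "f \<in> borel_measurable M" using f by (rule square_integrable_measurable)
  \<comment> \<open>Cutting off at height \<open>n\<close> leaves an error that is either 0 or
    \<open>- f x\<close>, so it is dominated by \<open>f\<close> and vanishes at each point for
    large \<open>n\<close>.\<close>
  define g where "g n x = (if cmod (f x) \<le> real n then f x else 0)" for n x
  have [measurable]: "g n \<in> borel_measurable M" for n unfolding g_def by measurable
  have g_bd: "cmod (g n x) \<le> real n" for n x by (simp add: g_def)
  have "(\<lambda>n. \<integral>x. (cmod (g n x - f x))\<^sup>2 \<partial>M) \<longlonglongrightarrow> (\<integral>x. 0 \<partial>M)"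
  proof (rule integral_dominated_convergence)
    show "integrable M (\<lambda>x. (cmod (f x))\<^sup>2)" using f by (simp add: square_integrable_def)
    show "AE x in M. norm ((cmod (g n x - f x))\<^sup>2) \<le> (cmod (f x))\<^sup>2" for n by (simp add: g_def)
    show "AE x in M. (\<lambda>n. (cmod (g n x - f x))\<^sup>2) \<longlonglongrightarrow> 0"
    proof (intro AE_I2 tendsto_eventually)
      fix x
      obtain N where "cmod (f x) \<le> real N" using real_arch_simple by blast
      then have "\<forall>n\<ge>N. (cmod (g n x - f x))\<^sup>2 = 0" by (auto simp: g_def)
      then show "\<forall>\<^sub>F n in sequentially. (cmod (g n x - f x))\<^sup>2 = 0"
        unfolding eventually_sequentially by blast
    qed
  qed auto
  then have "\<forall>\<^sub>F n in sequentially. (\<integral>x. (cmod (g n x - f x))\<^sup>2 \<partial>M) < e\<^sup>2"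
    using e by (intro order_tendstoD) auto
  then obtain n where n: "(\<integral>x. (cmod (g n x - f x))\<^sup>2 \<partial>M) < e\<^sup>2"
    by (auto simp: eventually_sequentially)
  have g: "square_integrable M (g n)" using g_bd by (intro square_integrable_bounded[of _ "real n"]) auto
  have "(vdist (L2 M) (ae_class M (g n)) F)\<^sup>2 < e\<^sup>2"
    unfolding F power2_vdist_L2[OF g f] by (rule n)
  then have "vdist (L2 M) (ae_class M (g n)) F < e" using e by (meson power2_less_imp_less less_imp_le)
  moreover have "ae_class M (g n) \<in> Linf M" using g_bd by (intro LinfI[of _ _ "real n"]) auto
  ultimately show "\<exists>a\<in>Linf M. vdist (L2 M) a F < e" by blast
qed

text \<open>Testing on the indicator of \<open>{\<bar>f\<bar> > b}\<close>.\<close>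

lemma Linf_if_multiplication_bounded:
  assumes F: "F \<in> carrier (L2 M)"
    and bd: "\<And>g. g \<in> Linf M \<Longrightarrow> vnorm (L2 M) (cl_mult M g F) \<le> b * vnorm (L2 M) g"
  shows "F \<in> Linf M"
proof -
  obtain f where f: "square_integrable M f" and F: "F = ae_class M f" using F by (rule carrier_L2E)
  have [measurable]: "f \<in> borel_measurable M" using f by (rule square_integrable_measurable)
  \<comment> \<open>The absolute value because no sign is known for \<open>b\<close>.\<close>
  define E where "E = {x \<in> space M. \<bar>b\<bar> < cmod (f x)}"
  have [measurable]: "E \<in> sets M" unfolding E_def by measurable
  define g where "g x = (indicator E x :: complex)" for x
  have [measurable]: "g \<in> borel_measurable M" unfolding g_def by measurable
  have g: "ae_class M g \<in> Linf M" by (rule LinfI[of _ _ 1]) (auto simp: g_def indicator_def)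
  have "(vnorm (L2 M) (cl_mult M (ae_class M g) F))\<^sup>2 \<le> (\<bar>b\<bar> * vnorm (L2 M) (ae_class M g))\<^sup>2"
  proof (rule power_mono)
    have v: "0 \<le> vnorm (L2 M) (ae_class M g)" using g Linf_subset_L2 by auto
    have "b * vnorm (L2 M) (ae_class M g) \<le> \<bar>b\<bar> * vnorm (L2 M) (ae_class M g)"
      using v by (intro mult_right_mono) auto
    with bd[OF g] show "vnorm (L2 M) (cl_mult M (ae_class M g) F) \<le> \<bar>b\<bar> * vnorm (L2 M) (ae_class M g)"
      by linarith
    have "square_integrable M (\<lambda>x. g x * f x)"
      by (rule square_integrable_mult_bounded[OF f, of _ 1]) (auto simp: g_def indicator_def)
    then show "0 \<le> vnorm (L2 M) (cl_mult M (ae_class M g) F)"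
      by (simp add: F cl_mult_class in_carrier_L2)
  qed
  then have le: "(\<integral>x. (cmod (g x * f x))\<^sup>2 \<partial>M) \<le> b\<^sup>2 * (\<integral>x. (cmod (g x))\<^sup>2 \<partial>M)"
    by (simp add: F cl_mult_class power2_vnorm_L2 power_mult_distrib)
  \<comment> \<open>\<open>h\<close> is positive exactly on \<open>E\<close>, while the assumed
    bound makes its integral at most 0; hence \<open>E\<close> is a null set.\<close>
  define h where "h x = indicator E x * ((cmod (f x))\<^sup>2 - b\<^sup>2)" for x
  have h_eq: "h x = (cmod (g x * f x))\<^sup>2 - b\<^sup>2 * (cmod (g x))\<^sup>2" for x
    by (simp add: h_def g_def indicator_def)
  have i1: "integrable M (\<lambda>x. (cmod (g x * f x))\<^sup>2)"
    using square_integrable_mult_bounded[OF f, of g 1] by (simp add: square_integrable_def g_def indicator_def)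
  have i2: "integrable M (\<lambda>x. (cmod (g x))\<^sup>2)"
    using square_integrable_bounded[of g 1] by (simp add: square_integrable_def g_def indicator_def)
  have ih: "integrable M h" unfolding h_eq using i1 i2 by simp
  have h_nonneg: "0 \<le> h x" for x
    using power_mono[of "\<bar>b\<bar>" "cmod (f x)" 2] by (auto simp: h_def E_def indicator_def)
  have "(\<integral>x. h x \<partial>M) \<le> 0" unfolding h_eq using i1 i2 le by simp
  then have "(\<integral>x. h x \<partial>M) = 0" using h_nonneg by (simp add: integral_nonneg_AE antisym)
  then have "AE x in M. h x = 0" using ih h_nonneg by (simp add: integral_nonneg_eq_0_iff_AE)
  then have "AE x in M. cmod (f x) \<le> \<bar>b\<bar>"
    using AE_space
  proof eventually_elim
    case (elim x)
    show ?case
    proof (rule ccontr)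
      assume "\<not> cmod (f x) \<le> \<bar>b\<bar>"
      then have "b\<^sup>2 < (cmod (f x))\<^sup>2" "x \<in> E"
        using elim(2) power_strict_mono[of "\<bar>b\<bar>" "cmod (f x)" 2] by (auto simp: E_def)
      then show False using elim(1) by (simp add: h_def)
    qed
  qed
  then show ?thesis unfolding F by (intro LinfI) auto
qed

end

section \<open>Multiplication by bounded functions and conjugation of classes\<close>

lemma carrier_L2_measurableE:
  assumes "F \<in> carrier (L2 M)"
  obtains f where "square_integrable M f" "f \<in> borel_measurable M" "F = ae_class M f"
  using assms by (auto elim: carrier_L2E simp: square_integrable_measurable)

text \<open>The bound is kept visible because \<open>cp_pi\<close> multiplies its components by all
  translates of one function, and boundedness of the operator asks for one constant that serves them
  all.\<close>

definition Linf_bound :: "'x measure \<Rightarrow> real \<Rightarrow> ('x \<Rightarrow> complex) set \<Rightarrow> bool" where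
  "Linf_bound M b F \<longleftrightarrow>
     (\<exists>f. f \<in> borel_measurable M \<and> (AE x in M. cmod (f x) \<le> b) \<and> F = ae_class M f)"

lemma Linf_iff: "F \<in> Linf M \<longleftrightarrow> (\<exists>b. Linf_bound M b F)"
  by (auto simp: Linf_def Linf_bound_def)

lemma cl_mult_commute: "cl_mult M F F' = cl_mult M F' F"
  by (simp add: cl_mult_def mult.commute)

lemma cl_mult_L2:
  assumes "a \<in> Linf M" "F \<in> carrier (L2 M)"
  shows "cl_mult M a F \<in> carrier (L2 M)"
  using assms
  by (auto elim!: LinfE carrier_L2_measurableE simp: cl_mult_class intro!: in_carrier_L2 square_integrable_mult_bounded)

lemma vnorm_cl_mult_le:
  assumes a: "Linf_bound M b a" and F: "F \<in> carrier (L2 M)"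
  shows "vnorm (L2 M) (cl_mult M a F) \<le> \<bar>b\<bar> * vnorm (L2 M) F"
proof -
  obtain f where f: "square_integrable M f" "f \<in> borel_measurable M" "F = ae_class M f"
    using F by (rule carrier_L2_measurableE)
  obtain g where g: "g \<in> borel_measurable M" "AE x in M. cmod (g x) \<le> b" "a = ae_class M g"
    using a by (auto simp: Linf_bound_def)
  have "(vnorm (L2 M) (cl_mult M a F))\<^sup>2 = (\<integral>x. (cmod (g x * f x))\<^sup>2 \<partial>M)"
    using f g by (simp add: cl_mult_class power2_vnorm_L2)
  also have "\<dots> \<le> (\<integral>x. b\<^sup>2 * (cmod (f x))\<^sup>2 \<partial>M)"
  proof (rule integral_mono_AE)
    show "integrable M (\<lambda>x. (cmod (g x * f x))\<^sup>2)"
      using square_integrable_mult_bounded[OF f(1) g(1,2)] by (simp add: square_integrable_def)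
    show "integrable M (\<lambda>x. b\<^sup>2 * (cmod (f x))\<^sup>2)" using f by (simp add: square_integrable_def)
    show "AE x in M. (cmod (g x * f x))\<^sup>2 \<le> b\<^sup>2 * (cmod (f x))\<^sup>2"
      using g(2) by eventually_elim (auto simp: norm_mult power_mult_distrib intro!: mult_right_mono power_mono)
  qed
  also have "\<dots> = (\<bar>b\<bar> * vnorm (L2 M) F)\<^sup>2" using f by (simp add: power_mult_distrib power2_vnorm_L2)
  finally show ?thesis by (rule power2_le_imp_le) (use F in simp)
qed

lemma cl_mult_add:
  assumes "a \<in> Linf M" "F \<in> carrier (L2 M)" "F' \<in> carrier (L2 M)"
  shows "cl_mult M a (F \<oplus>\<^bsub>L2 M\<^esub> F') = cl_mult M a F \<oplus>\<^bsub>L2 M\<^esub> cl_mult M a F'"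
  using assms by (auto elim!: LinfE carrier_L2_measurableE simp: cl_mult_class add_L2_class distrib_left)

lemma cl_mult_smult:
  assumes "a \<in> Linf M" "F \<in> carrier (L2 M)"
  shows "cl_mult M a (c \<odot>\<^bsub>L2 M\<^esub> F) = c \<odot>\<^bsub>L2 M\<^esub> cl_mult M a F"
  using assms by (auto elim!: LinfE carrier_L2_measurableE simp: cl_mult_class smult_L2_class mult_ac)

lemma cl_mult_zero: "a \<in> Linf M \<Longrightarrow> cl_mult M a \<zero>\<^bsub>L2 M\<^esub> = \<zero>\<^bsub>L2 M\<^esub>"
  by (auto elim!: LinfE simp: zero_L2 cl_mult_class)

lemma cl_mult_one: "a \<in> Linf M \<Longrightarrow> cl_mult M a (ae_class M (\<lambda>_. 1)) = a"
  by (auto elim!: LinfE simp: cl_mult_class)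

lemma cl_mult_left_commute:
  assumes "a \<in> Linf M" "b \<in> Linf M" "F \<in> carrier (L2 M)"
  shows "cl_mult M a (cl_mult M b F) = cl_mult M b (cl_mult M a F)"
  using assms by (auto elim!: LinfE carrier_L2_measurableE simp: cl_mult_class mult_ac)

lemma cl_cnj_Linf_bound:
  assumes "Linf_bound M b a"
  shows "Linf_bound M b (cl_cnj M a)"
proof -
  obtain f where f: "f \<in> borel_measurable M" "AE x in M. cmod (f x) \<le> b" "a = ae_class M f"
    using assms by (auto simp: Linf_bound_def)
  then show ?thesis unfolding Linf_bound_def
    by (intro exI[of _ "\<lambda>x. cnj (f x)"]) (simp add: cl_cnj_class borel_measurable_cnj)
qed

lemma cl_cnj_Linf: "a \<in> Linf M \<Longrightarrow> cl_cnj M a \<in> Linf M"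
  by (auto simp: Linf_iff intro: cl_cnj_Linf_bound)

lemma cl_cnj_L2: "F \<in> carrier (L2 M) \<Longrightarrow> cl_cnj M F \<in> carrier (L2 M)"
  by (auto elim!: carrier_L2_measurableE simp: cl_cnj_class square_integrable_def intro!: in_carrier_L2)

lemma cl_cnj_add:
  assumes "F \<in> carrier (L2 M)" "F' \<in> carrier (L2 M)"
  shows "cl_cnj M (F \<oplus>\<^bsub>L2 M\<^esub> F') = cl_cnj M F \<oplus>\<^bsub>L2 M\<^esub> cl_cnj M F'"
  using assms by (auto elim!: carrier_L2_measurableE simp: cl_cnj_class add_L2_class)

lemma cl_cnj_smult:
  "F \<in> carrier (L2 M) \<Longrightarrow> cl_cnj M (c \<odot>\<^bsub>L2 M\<^esub> F) = cnj c \<odot>\<^bsub>L2 M\<^esub> cl_cnj M F"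
  by (auto elim!: carrier_L2_measurableE simp: cl_cnj_class smult_L2_class)

lemma cl_cnj_cl_cnj: "F \<in> carrier (L2 M) \<Longrightarrow> cl_cnj M (cl_cnj M F) = F"
  by (auto elim!: carrier_L2_measurableE simp: cl_cnj_class)

lemma cinner_cl_cnj:
  assumes "F \<in> carrier (L2 M)" "F' \<in> carrier (L2 M)"
  shows "cinner (L2 M) (cl_cnj M F) (cl_cnj M F') = cinner (L2 M) F' F"
  using assms by (auto elim!: carrier_L2_measurableE simp: cl_cnj_class cinner_L2_class mult.commute)

lemma cinner_cl_mult:
  assumes "a \<in> Linf M" "F \<in> carrier (L2 M)" "F' \<in> carrier (L2 M)"
  shows "cinner (L2 M) F (cl_mult M a F') = cinner (L2 M) (cl_mult M (cl_cnj M a) F) F'"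
  using assms by (auto elim!: LinfE carrier_L2_measurableE simp: cl_cnj_class cl_mult_class cinner_L2_class mult_ac)

lemma one_Linf: "ae_class M (\<lambda>_. 1) \<in> Linf M"
  by (rule LinfI[of _ _ 1]) auto


section \<open>Measure preserving actions on classes of functions\<close>

locale pmp_action = prob_space M + group G
  for M :: "'x measure" and G :: "('g, 'b) monoid_scheme" (structure) +
  fixes T :: "'g \<Rightarrow> 'x \<Rightarrow> 'x"
  assumes aut_action: "aut_action G M T" and measure_preserving: "measure_preserving_action G M T"
begin

lemma group_action_T: "group_action G (space M) T"
  using aut_action by (simp add: aut_action_def)

lemma T_mult:
  "\<lbrakk>x \<in> space M; \<gamma> \<in> carrier G; \<delta> \<in> carrier G\<rbrakk> \<Longrightarrow> T (\<gamma> \<otimes> \<delta>) x = T \<gamma> (T \<delta> x)"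
  using group_action.composition_rule[OF group_action_T] .

lemma T_one: "x \<in> space M \<Longrightarrow> T \<one> x = x"
  using fun_cong[OF group_action.id_eq_one[OF group_action_T], of x] by simp

lemma bij_T: "\<gamma> \<in> carrier G \<Longrightarrow> bij_betw (T \<gamma>) (space M) (space M)"
  using aut_action by (simp add: aut_action_def measure_aut_def)

lemma T_measurable [measurable]: "\<gamma> \<in> carrier G \<Longrightarrow> T \<gamma> \<in> measurable M M"
  using aut_action bij_betw_apply[OF bij_T] by (auto simp: aut_action_def measure_aut_def measurable_def)

text \<open>Invariance is assumed for images of sets, whereas \<open>distr\<close> measures
  preimages; surjectivity of \<open>T \<gamma>\<close> makes the image of the preimage of
  \<open>A\<close> equal to \<open>A\<close>.\<close>

lemma distr_T:
  assumes \<gamma>: "\<gamma> \<in> carrier G"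
  shows "distr M M (T \<gamma>) = M"
proof (rule measure_eqI)
  fix A assume "A \<in> sets (distr M M (T \<gamma>))"
  then have A [measurable]: "A \<in> sets M" by simp
  define B where "B = T \<gamma> -` A \<inter> space M"
  have B: "B \<in> sets M" unfolding B_def using \<gamma> by measurable
  have "T \<gamma> ` B = A"
  proof -
    have "T \<gamma> ` (T \<gamma> -` A \<inter> space M) = A \<inter> T \<gamma> ` space M" by auto
    then show ?thesis
      using bij_T[OF \<gamma>] sets.sets_into_space[OF A] by (simp add: B_def bij_betw_def Int_absorb2)
  qed
  then have "measure M B = measure M A"
    using measure_preserving \<gamma> B by (auto simp: measure_preserving_action_def)
  then show "emeasure (distr M M (T \<gamma>)) A = emeasure M A"
    using \<gamma> by (simp add: emeasure_distr B_def[symmetric] emeasure_eq_measure)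
qed simp

lemma AE_T:
  assumes \<gamma>: "\<gamma> \<in> carrier G" and P: "AE x in M. P x"
  shows "AE x in M. P (T \<gamma> x)"
proof (rule AE_distrD[OF T_measurable[OF \<gamma>]])
  show "AE x in distr M M (T \<gamma>). P x" unfolding distr_T[OF \<gamma>] by (rule P)
qed

lemma integral_T:
  fixes f :: "'x \<Rightarrow> 'c::{banach, second_countable_topology}"
  assumes "\<gamma> \<in> carrier G" "f \<in> borel_measurable M"
  shows "(\<integral>x. f (T \<gamma> x) \<partial>M) = (\<integral>x. f x \<partial>M)"
  using integral_distr[of "T \<gamma>" M M f] assms by (simp add: distr_T)

lemma integrable_T:
  fixes f :: "'x \<Rightarrow> 'c::{banach, second_countable_topology}"
  assumes "\<gamma> \<in> carrier G" "integrable M f"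
  shows "integrable M (\<lambda>x. f (T \<gamma> x))"
  using integrable_distr[of "T \<gamma>" M M f] assms by (simp add: distr_T)

lemma comp_T_measurable:
  assumes "\<gamma> \<in> carrier G" "f \<in> borel_measurable M"
  shows "(\<lambda>x. f (T \<gamma> x)) \<in> borel_measurable M"
  using measurable_compose[OF T_measurable] assms by blast

text \<open>A representative differs from \<open>f\<close> on a null set only, and the translate of
  a null set is null by \<open>AE_T\<close>.\<close>

lemma act_class:
  assumes \<gamma>: "\<gamma> \<in> carrier G" and f: "f \<in> borel_measurable M"
  shows "act G M T \<gamma> (ae_class M f) = ae_class M (\<lambda>x. f (T (inv \<gamma>) x))"
  unfolding act_def using AE_T[OF _ rep_AE[OF f], of "inv \<gamma>"] \<gamma> by (intro ae_class_eqI) auto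

lemma act_L2:
  assumes \<gamma>: "\<gamma> \<in> carrier G" and F: "F \<in> carrier (L2 M)"
  shows "act G M T \<gamma> F \<in> carrier (L2 M)"
proof -
  obtain f where f: "square_integrable M f" "f \<in> borel_measurable M" "F = ae_class M f"
    using F by (rule carrier_L2_measurableE)
  then have "square_integrable M (\<lambda>x. f (T (inv \<gamma>) x))"
    using \<gamma> integrable_T[of "inv \<gamma>" "\<lambda>x. (cmod (f x))\<^sup>2"]
    by (simp add: square_integrable_def comp_T_measurable)
  then show ?thesis using f \<gamma> by (simp add: act_class in_carrier_L2)
qed

lemma act_Linf_bound:
  assumes \<gamma>: "\<gamma> \<in> carrier G" and a: "Linf_bound M b a"
  shows "Linf_bound M b (act G M T \<gamma> a)"
proof -
  obtain f where f: "f \<in> borel_measurable M" "AE x in M. cmod (f x) \<le> b" "a = ae_class M f"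
    using a by (auto simp: Linf_bound_def)
  have "AE x in M. cmod (f (T (inv \<gamma>) x)) \<le> b" using AE_T[OF _ f(2), of "inv \<gamma>"] \<gamma> by simp
  then show ?thesis unfolding Linf_bound_def
    using f \<gamma> by (intro exI[of _ "\<lambda>x. f (T (inv \<gamma>) x)"]) (simp add: act_class comp_T_measurable)
qed

lemma act_Linf: "\<lbrakk>\<gamma> \<in> carrier G; a \<in> Linf M\<rbrakk> \<Longrightarrow> act G M T \<gamma> a \<in> Linf M"
  by (auto simp: Linf_iff intro: act_Linf_bound)

lemma act_act:
  assumes \<gamma>: "\<gamma> \<in> carrier G" and \<delta>: "\<delta> \<in> carrier G" and F: "F \<in> carrier (L2 M)"
  shows "act G M T \<gamma> (act G M T \<delta> F) = act G M T (\<gamma> \<otimes> \<delta>) F"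
proof -
  obtain f where f: "f \<in> borel_measurable M" "F = ae_class M f" using F by (rule carrier_L2_measurableE)
  show ?thesis using f \<gamma> \<delta>
    by (auto simp: act_class comp_T_measurable inv_mult_group T_mult intro!: ae_class_eqI AE_I2)
qed

lemma act_one:
  assumes F: "F \<in> carrier (L2 M)"
  shows "act G M T \<one> F = F"
proof -
  obtain f where f: "f \<in> borel_measurable M" "F = ae_class M f" using F by (rule carrier_L2_measurableE)
  have "ae_class M (\<lambda>x. f (T \<one> x)) = ae_class M f" by (rule ae_class_eqI) (simp add: T_one)
  with f show ?thesis by (simp add: act_class)
qed

lemma act_add:
  assumes "\<gamma> \<in> carrier G" "F \<in> carrier (L2 M)" "F' \<in> carrier (L2 M)"
  shows "act G M T \<gamma> (F \<oplus>\<^bsub>L2 M\<^esub> F') = act G M T \<gamma> F \<oplus>\<^bsub>L2 M\<^esub> act G M T \<gamma> F'"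
  using assms by (auto elim!: carrier_L2_measurableE simp: act_class add_L2_class comp_T_measurable)

lemma act_smult:
  assumes "\<gamma> \<in> carrier G" "F \<in> carrier (L2 M)"
  shows "act G M T \<gamma> (c \<odot>\<^bsub>L2 M\<^esub> F) = c \<odot>\<^bsub>L2 M\<^esub> act G M T \<gamma> F"
  using assms by (auto elim!: carrier_L2_measurableE simp: act_class smult_L2_class comp_T_measurable)

lemma act_zero: "\<gamma> \<in> carrier G \<Longrightarrow> act G M T \<gamma> \<zero>\<^bsub>L2 M\<^esub> = \<zero>\<^bsub>L2 M\<^esub>"
  by (simp add: zero_L2 act_class)

lemma act_const: "\<gamma> \<in> carrier G \<Longrightarrow> act G M T \<gamma> (ae_class M (\<lambda>_. c)) = ae_class M (\<lambda>_. c)"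
  by (simp add: act_class)

lemma act_cl_cnj:
  assumes "\<gamma> \<in> carrier G" "F \<in> carrier (L2 M)"
  shows "act G M T \<gamma> (cl_cnj M F) = cl_cnj M (act G M T \<gamma> F)"
  using assms by (auto elim!: carrier_L2_measurableE simp: act_class cl_cnj_class comp_T_measurable)

lemma act_cl_mult:
  assumes "\<gamma> \<in> carrier G" "a \<in> Linf M" "F \<in> carrier (L2 M)"
  shows "act G M T \<gamma> (cl_mult M a F) = cl_mult M (act G M T \<gamma> a) (act G M T \<gamma> F)"
  using assms by (auto elim!: LinfE carrier_L2_measurableE simp: act_class cl_mult_class comp_T_measurable)

lemma cinner_act:
  assumes \<gamma>: "\<gamma> \<in> carrier G" and "F \<in> carrier (L2 M)" "F' \<in> carrier (L2 M)"
  shows "cinner (L2 M) (act G M T \<gamma> F) (act G M T \<gamma> F') = cinner (L2 M) F F'"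
proof -
  obtain f g where fg [measurable]: "f \<in> borel_measurable M" "g \<in> borel_measurable M"
    and eq: "F = ae_class M f" "F' = ae_class M g" using assms(2,3) by (metis carrier_L2_measurableE)
  have "(\<lambda>x. cnj (f x) * g x) \<in> borel_measurable M" by measurable
  then show ?thesis using \<gamma> integral_T[of "inv \<gamma>" "\<lambda>x. cnj (f x) * g x"]
    by (simp add: eq act_class cinner_L2_class comp_T_measurable)
qed

lemma vnorm_act: "\<lbrakk>\<gamma> \<in> carrier G; F \<in> carrier (L2 M)\<rbrakk> \<Longrightarrow> vnorm (L2 M) (act G M T \<gamma> F) = vnorm (L2 M) F"
  by (simp add: vnorm_def cinner_act)

end

section \<open>The crossed product\<close>

context pmp_action begin

sublocale L: hilbert_space "L2 M" by (rule hilbert_space_L2)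
sublocale S: hilbert_direct_sum "L2 M" "carrier G" ..
sublocale K: hilbert_space S.K by (rule S.hilbert_space_sum)

abbreviation unit_class :: "('x \<Rightarrow> complex) set" where "unit_class \<equiv> ae_class M (\<lambda>_. 1)"
abbreviation \<alpha> :: "'g \<Rightarrow> ('x \<Rightarrow> complex) set \<Rightarrow> ('x \<Rightarrow> complex) set" where "\<alpha> \<equiv> act G M T"
abbreviation generators where "generators \<equiv> cp_pi G M T ` Linf M \<union> cp_U G M ` carrier G"
abbreviation \<N> where "\<N> \<equiv> commutant S.K (commutant S.K generators)"
abbreviation \<Omega> where "\<Omega> \<equiv> S.single \<one> unit_class"

lemma cp_embed_eq: "cp_embed G M = S.single"
  by (simp add: fun_eq_iff cp_embed_def S.single_def)

lemma cp_Omega_eq: "cp_Omega G M = \<Omega>"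
  by (simp add: cp_Omega_def cp_embed_eq)

lemma Linf_L2 [simp, intro]: "a \<in> Linf M \<Longrightarrow> a \<in> carrier (L2 M)"
  using Linf_subset_L2 by auto

lemma Omega_closed [simp]: "\<Omega> \<in> carrier S.K"
  by (simp add: S.single_closed one_Linf)

lemma cp_pi_eq: "cp_pi G M T f = S.componentwise (\<lambda>\<gamma>. cl_mult M (\<alpha> (inv \<gamma>) f)) (\<lambda>\<gamma>. \<gamma>)"
  by (simp add: cp_pi_def S.componentwise_def cp_space_def)

lemma cp_U_eq: "cp_U G M \<gamma>\<^sub>0 = S.componentwise (\<lambda>_ x. x) (\<lambda>\<gamma>. inv \<gamma>\<^sub>0 \<otimes> \<gamma>)"
  by (simp add: cp_U_def S.componentwise_def cp_space_def)

text \<open>With \<open>J\<close> as defined below, this is the conjugate by \<open>J\<close> of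
  \<open>cp_pi\<close> at the complex conjugate of \<open>g\<close>; likewise
  \<open>right_shift \<delta>\<close> is the conjugate by \<open>J\<close> of
  \<open>cp_U G M \<delta>\<close>.\<close>

definition right_mult :: "('x \<Rightarrow> complex) set \<Rightarrow> ('g \<Rightarrow> ('x \<Rightarrow> complex) set) \<Rightarrow> 'g \<Rightarrow> ('x \<Rightarrow> complex) set" where
  "right_mult g = S.componentwise (\<lambda>_. cl_mult M g) (\<lambda>\<gamma>. \<gamma>)"

definition right_shift :: "'g \<Rightarrow> ('g \<Rightarrow> ('x \<Rightarrow> complex) set) \<Rightarrow> 'g \<Rightarrow> ('x \<Rightarrow> complex) set" where
  "right_shift \<delta> = S.componentwise (\<lambda>_. \<alpha> \<delta>) (\<lambda>\<gamma>. \<gamma> \<otimes> \<delta>)"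

section \<open>The generators and the operators that commute with them\<close>

lemma bij_left_mult: "\<delta> \<in> carrier G \<Longrightarrow> bij_betw (\<lambda>\<gamma>. \<delta> \<otimes> \<gamma>) (carrier G) (carrier G)"
  by (rule bij_betw_byWitness[where f' = "\<lambda>\<gamma>. inv \<delta> \<otimes> \<gamma>"]) (auto simp: m_assoc[symmetric])

lemma bij_right_mult: "\<delta> \<in> carrier G \<Longrightarrow> bij_betw (\<lambda>\<gamma>. \<gamma> \<otimes> \<delta>) (carrier G) (carrier G)"
  by (rule bij_betw_byWitness[where f' = "\<lambda>\<gamma>. \<gamma> \<otimes> inv \<delta>"]) (auto simp: m_assoc)

lemma bij_inv: "bij_betw (\<lambda>\<gamma>. inv \<gamma>) (carrier G) (carrier G)"
  by (rule bij_betw_byWitness[where f' = "\<lambda>\<gamma>. inv \<gamma>"]) auto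

lemma bij_id: "bij_betw (\<lambda>\<gamma>. \<gamma>) (carrier G) (carrier G)"
  by (auto simp: bij_betw_def)

lemma cp_pi_bop:
  assumes f: "f \<in> Linf M"
  shows "cp_pi G M T f \<in> bop S.K"
proof -
  obtain b where b: "Linf_bound M b f" using f by (auto simp: Linf_iff)
  show ?thesis unfolding cp_pi_eq
  proof (rule S.componentwise_in_bop[OF bij_id])
    fix \<gamma> x assume "\<gamma> \<in> carrier G" "x \<in> carrier (L2 M)"
    then show "vnorm (L2 M) (cl_mult M (\<alpha> (inv \<gamma>) f) x) \<le> \<bar>b\<bar> * vnorm (L2 M) x"
      using b by (intro vnorm_cl_mult_le act_Linf_bound) auto
  qed (use f in \<open>auto simp: cl_mult_L2 act_Linf cl_mult_add cl_mult_smult\<close>)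
qed

lemma cp_U_bop: "\<delta> \<in> carrier G \<Longrightarrow> cp_U G M \<delta> \<in> bop S.K"
  unfolding cp_U_eq by (rule S.componentwise_in_bop[where c = 1]) (auto simp: bij_left_mult)

lemma right_mult_bop:
  assumes g: "g \<in> Linf M"
  shows "right_mult g \<in> bop S.K"
proof -
  obtain b where b: "Linf_bound M b g" using g by (auto simp: Linf_iff)
  show ?thesis unfolding right_mult_def
  proof (rule S.componentwise_in_bop[OF bij_id])
    fix x assume "x \<in> carrier (L2 M)"
    then show "vnorm (L2 M) (cl_mult M g x) \<le> \<bar>b\<bar> * vnorm (L2 M) x"
      using b by (intro vnorm_cl_mult_le) auto
  qed (use g in \<open>auto simp: cl_mult_L2 cl_mult_add cl_mult_smult\<close>)
qed

lemma right_shift_bop: "\<delta> \<in> carrier G \<Longrightarrow> right_shift \<delta> \<in> bop S.K"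
  unfolding right_shift_def
  by (rule S.componentwise_in_bop[where c = 1])
    (auto simp: bij_right_mult act_L2 act_add act_smult vnorm_act)

lemma generators_bop: "generators \<subseteq> bop S.K"
  using cp_pi_bop cp_U_bop by auto

lemma cp_pi_apply [simp]:
  "\<lbrakk>\<xi> \<in> carrier S.K; \<gamma> \<in> carrier G\<rbrakk> \<Longrightarrow> cp_pi G M T f \<xi> \<gamma> = cl_mult M (\<alpha> (inv \<gamma>) f) (\<xi> \<gamma>)"
  by (simp add: cp_pi_eq)

lemma cp_U_apply [simp]:
  "\<lbrakk>\<xi> \<in> carrier S.K; \<gamma> \<in> carrier G\<rbrakk> \<Longrightarrow> cp_U G M \<delta> \<xi> \<gamma> = \<xi> (inv \<delta> \<otimes> \<gamma>)"
  by (simp add: cp_U_eq)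

lemma right_mult_apply [simp]:
  "\<lbrakk>\<xi> \<in> carrier S.K; \<gamma> \<in> carrier G\<rbrakk> \<Longrightarrow> right_mult g \<xi> \<gamma> = cl_mult M g (\<xi> \<gamma>)"
  by (simp add: right_mult_def)

lemma right_shift_apply [simp]:
  "\<lbrakk>\<xi> \<in> carrier S.K; \<gamma> \<in> carrier G\<rbrakk> \<Longrightarrow> right_shift \<delta> \<xi> \<gamma> = \<alpha> \<delta> (\<xi> (\<gamma> \<otimes> \<delta>))"
  by (simp add: right_shift_def)

lemma adj_cp_pi:
  assumes f: "f \<in> Linf M"
  shows "adj S.K (cp_pi G M T f) = cp_pi G M T (cl_cnj M f)"
  unfolding cp_pi_eq
proof (rule S.adj_componentwise[OF bij_id])
  show "S.componentwise (\<lambda>\<gamma>. cl_mult M (\<alpha> (inv \<gamma>) (cl_cnj M f))) (\<lambda>\<gamma>. \<gamma>) \<in> bop S.K"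
    using cp_pi_bop[OF cl_cnj_Linf[OF f]] by (simp add: cp_pi_eq)
qed (use f in \<open>auto simp: act_cl_cnj cinner_cl_mult act_Linf\<close>)

lemma adj_cp_U:
  assumes \<delta>: "\<delta> \<in> carrier G"
  shows "adj S.K (cp_U G M \<delta>) = cp_U G M (inv \<delta>)"
  unfolding cp_U_eq
proof (rule S.adj_componentwise)
  show "S.componentwise (\<lambda>_ x. x) (\<lambda>\<gamma>. inv (inv \<delta>) \<otimes> \<gamma>) \<in> bop S.K"
    using cp_U_bop[of "inv \<delta>"] \<delta> by (simp add: cp_U_eq)
qed (use \<delta> in \<open>auto simp: bij_left_mult m_assoc[symmetric]\<close>)

lemma vna_crossed_product: "von_neumann_algebra S.K \<N>"
proof (rule K.von_neumann_algebra_bicommutant[OF generators_bop])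
  fix A assume "A \<in> generators"
  then show "adj S.K A \<in> generators"
    by (auto simp: adj_cp_pi adj_cp_U intro: cl_cnj_Linf)
qed

lemma N_bop: "A \<in> \<N> \<Longrightarrow> A \<in> bop S.K"
  using K.commutant_subset_bop by blast

lemma generators_in_N: "A \<in> generators \<Longrightarrow> A \<in> \<N>"
  using K.subset_bicommutant[OF generators_bop] by blast

lemma right_mult_in_commutant:
  assumes g: "g \<in> Linf M"
  shows "right_mult g \<in> commutant S.K generators"
proof (rule K.commutantI[OF right_mult_bop[OF g] generators_bop])
  fix A \<xi> assume A: "A \<in> generators" and \<xi>: "\<xi> \<in> carrier S.K"
  have [simp]: "right_mult g \<xi> \<in> carrier S.K" using right_mult_bop[OF g] \<xi> by (rule K.bop_closed)
  have Ab: "A \<in> bop S.K" using A generators_bop by auto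
  then have [simp]: "A \<xi> \<in> carrier S.K" using \<xi> by (rule K.bop_closed)
  show "A (right_mult g \<xi>) = right_mult g (A \<xi>)"
  proof (rule S.carrier_sum_eqI)
    fix \<gamma> assume "\<gamma> \<in> carrier G"
    then show "A (right_mult g \<xi>) \<gamma> = right_mult g (A \<xi>) \<gamma>"
      using A \<xi> g by (auto simp: act_Linf cl_mult_left_commute[of g] S.component_closed)
  qed (use Ab right_mult_bop[OF g] in \<open>auto intro: K.bop_closed\<close>)
qed

lemma right_shift_in_commutant:
  assumes \<delta>: "\<delta> \<in> carrier G"
  shows "right_shift \<delta> \<in> commutant S.K generators"
proof (rule K.commutantI[OF right_shift_bop[OF \<delta>] generators_bop])
  fix A \<xi> assume A: "A \<in> generators" and \<xi>: "\<xi> \<in> carrier S.K"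
  have [simp]: "right_shift \<delta> \<xi> \<in> carrier S.K" using right_shift_bop[OF \<delta>] \<xi> by (rule K.bop_closed)
  have Ab: "A \<in> bop S.K" using A generators_bop by auto
  then have [simp]: "A \<xi> \<in> carrier S.K" using \<xi> by (rule K.bop_closed)
  show "A (right_shift \<delta> \<xi>) = right_shift \<delta> (A \<xi>)"
  proof (rule S.carrier_sum_eqI)
    fix \<gamma> assume \<gamma>: "\<gamma> \<in> carrier G"
    \<comment> \<open>This is why the shift carries the twist by \<open>\<alpha> \<delta>\<close>:
      it restores the coefficient that \<open>cp_pi\<close> uses at \<gamma>. For
      \<open>cp_U\<close> the point is that left and right translations commute.\<close>
    have "\<delta> \<otimes> inv (\<gamma> \<otimes> \<delta>) = inv \<gamma>"
      using \<gamma> \<delta> by (simp add: inv_mult_group m_assoc[symmetric])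
    then show "A (right_shift \<delta> \<xi>) \<gamma> = right_shift \<delta> (A \<xi>) \<gamma>"
      using A \<xi> \<delta> \<gamma>
      by (auto simp: act_Linf act_cl_mult act_act S.component_closed m_assoc)
  qed (use Ab right_shift_bop[OF \<delta>] in \<open>auto intro: K.bop_closed\<close>)
qed

text \<open>The shift carries the constant 1, which the action fixes, from the unit to \<gamma>, and
  the multiplication turns it into \<open>g\<close>. An operator of the crossed product passes
  through both, so its value here is determined by its value at \<Omega>.\<close>

lemma single_eq_right:
  assumes \<gamma>: "\<gamma> \<in> carrier G" and g: "g \<in> Linf M"
  shows "S.single \<gamma> g = right_mult g (right_shift (inv \<gamma>) \<Omega>)"
proof (rule S.carrier_sum_eqI)
  show 1: "S.single \<gamma> g \<in> carrier S.K" using g by (simp add: S.single_closed)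
  have 2: "right_shift (inv \<gamma>) \<Omega> \<in> carrier S.K" using \<gamma> right_shift_bop by (auto intro: K.bop_closed)
  then show "right_mult g (right_shift (inv \<gamma>) \<Omega>) \<in> carrier S.K"
    using right_mult_bop[OF g] by (auto intro: K.bop_closed)
  fix \<gamma>' assume \<gamma>': "\<gamma>' \<in> carrier G"
  have "\<gamma>' \<otimes> inv \<gamma> = \<one> \<longleftrightarrow> \<gamma>' = \<gamma>" using \<gamma> \<gamma>' by (metis inv_equality inv_inv r_inv inv_closed)
  then show "S.single \<gamma> g \<gamma>' = right_mult g (right_shift (inv \<gamma>) \<Omega>) \<gamma>'"
    using \<gamma> \<gamma>' g 2 by (simp add: act_const act_zero cl_mult_one cl_mult_zero)
qed

text \<open>\<open>cp_pi\<close> comes before the translation because only at the unit is its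
  coefficient \<open>g\<close> itself rather than a translate of it.\<close>

lemma single_eq_left:
  assumes \<gamma>: "\<gamma> \<in> carrier G" and g: "g \<in> Linf M"
  shows "S.single \<gamma> g = cp_U G M \<gamma> (cp_pi G M T g \<Omega>)"
proof (rule S.carrier_sum_eqI)
  show 1: "S.single \<gamma> g \<in> carrier S.K" using g by (simp add: S.single_closed)
  have 2: "cp_pi G M T g \<Omega> \<in> carrier S.K" using cp_pi_bop[OF g] by (auto intro: K.bop_closed)
  then show "cp_U G M \<gamma> (cp_pi G M T g \<Omega>) \<in> carrier S.K"
    using cp_U_bop[OF \<gamma>] by (auto intro: K.bop_closed)
  fix \<gamma>' assume \<gamma>': "\<gamma>' \<in> carrier G"
  have "inv \<gamma> \<otimes> \<gamma>' = \<one> \<longleftrightarrow> \<gamma>' = \<gamma>" using \<gamma> \<gamma>' by (metis inv_closed inv_equality inv_inv l_inv)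
  then show "S.single \<gamma> g \<gamma>' = cp_U G M \<gamma> (cp_pi G M T g \<Omega>) \<gamma>'"
    using \<gamma> \<gamma>' g 2 by (auto simp: act_one cl_mult_one cl_mult_zero act_Linf)
qed

text \<open>A commutant is closed under sums, so one-component bounded vectors are enough by
  \<open>dense_in_sumI\<close>. Stated for any \<open>X\<close>, it serves the crossed product and
  its commutant alike.\<close>

lemma cyclic_commutantI:
  assumes X: "X \<subseteq> bop S.K"
    and single: "\<And>\<gamma> g. \<lbrakk>\<gamma> \<in> carrier G; g \<in> Linf M\<rbrakk> \<Longrightarrow> \<exists>A\<in>commutant S.K X. S.single \<gamma> g = A \<Omega>"
  shows "cyclic S.K (commutant S.K X) \<Omega>"
  unfolding cyclic_def
proof (intro conjI Omega_closed S.dense_in_sumI[OF _ _ _ dense_Linf])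
  show "{A \<Omega> | A. A \<in> commutant S.K X} \<subseteq> carrier S.K"
  proof clarify
    fix A assume "A \<in> commutant S.K X"
    then have "A \<in> bop S.K" by (rule subsetD[OF K.commutant_subset_bop])
    then show "A \<Omega> \<in> carrier S.K" using Omega_closed by (rule K.bop_closed)
  qed
  have "op_scale S.K 0 (op_id S.K) \<in> commutant S.K X"
    using X by (intro K.op_scale_in_commutant K.op_id_in_commutant)
  moreover have "op_scale S.K 0 (op_id S.K) \<Omega> = \<zero>\<^bsub>S.K\<^esub>"
    using K.zero_eq_smult[OF Omega_closed] by simp
  ultimately show "\<zero>\<^bsub>S.K\<^esub> \<in> {A \<Omega> | A. A \<in> commutant S.K X}" by (auto intro!: exI[of _ "op_scale S.K 0 (op_id S.K)"])
  fix \<xi> \<eta> assume "\<xi> \<in> {A \<Omega> | A. A \<in> commutant S.K X}" "\<eta> \<in> {A \<Omega> | A. A \<in> commutant S.K X}"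
  then obtain A B where "A \<in> commutant S.K X" "\<xi> = A \<Omega>" "B \<in> commutant S.K X" "\<eta> = B \<Omega>" by auto
  then have "op_add S.K A B \<in> commutant S.K X" "\<xi> \<oplus>\<^bsub>S.K\<^esub> \<eta> = op_add S.K A B \<Omega>"
    using X by (auto intro: K.op_add_in_commutant)
  then show "\<xi> \<oplus>\<^bsub>S.K\<^esub> \<eta> \<in> {A \<Omega> | A. A \<in> commutant S.K X}" by blast
next
  fix \<gamma> g assume "\<gamma> \<in> carrier G" "g \<in> Linf M"
  then show "S.single \<gamma> g \<in> {A \<Omega> | A. A \<in> commutant S.K X}" using single by blast
qed

lemma cyclic_crossed_product: "cyclic S.K \<N> \<Omega>"
proof (rule cyclic_commutantI[OF K.commutant_subset_bop])
  fix \<gamma> g assume \<gamma>: "\<gamma> \<in> carrier G" and g: "g \<in> Linf M"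
  show "\<exists>A\<in>\<N>. S.single \<gamma> g = A \<Omega>"
  proof
    show "op_mult S.K (cp_U G M \<gamma>) (cp_pi G M T g) \<in> \<N>"
      using \<gamma> g by (intro K.op_mult_in_commutant[OF K.commutant_subset_bop] generators_in_N) auto
  qed (simp add: single_eq_left \<gamma> g)
qed

lemma separating_crossed_product: "separating S.K \<N> \<Omega>"
proof (rule K.separating_if_cyclic_for_commutant)
  show "\<N> \<subseteq> bop S.K" by (rule K.commutant_subset_bop)
  show "cyclic S.K (commutant S.K \<N>) \<Omega>"
    \<comment> \<open>By the triple commutant law the commutant of \<open>\<N>\<close> is that of
      the generators, where \<open>right_mult\<close> and \<open>right_shift\<close> were
      placed.\<close>
    unfolding K.commutant_bicommutant[OF generators_bop]
  proof (rule cyclic_commutantI[OF generators_bop])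
    fix \<gamma> g assume \<gamma>: "\<gamma> \<in> carrier G" and g: "g \<in> Linf M"
    show "\<exists>A\<in>commutant S.K generators. S.single \<gamma> g = A \<Omega>"
    proof
      show "op_mult S.K (right_mult g) (right_shift (inv \<gamma>)) \<in> commutant S.K generators"
        using \<gamma> g by (intro K.op_mult_in_commutant[OF generators_bop] right_mult_in_commutant
            right_shift_in_commutant) auto
    qed (simp add: single_eq_right \<gamma> g)
  qed
qed

text \<open>Pull the two commuting operators of \<open>single_eq_right\<close> in front of
  \<open>A\<close> and read off a component. Only bounded \<open>g\<close> are reached in this way;
  \<open>N_single\<close> extends the formula to all of L^2.\<close>

lemma N_single_Linf:
  assumes A: "A \<in> \<N>" and \<gamma>: "\<gamma> \<in> carrier G" "\<gamma>' \<in> carrier G" and g: "g \<in> Linf M"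
  shows "A (S.single \<gamma> g) \<gamma>' = cl_mult M g (\<alpha> (inv \<gamma>) (A \<Omega> (\<gamma>' \<otimes> inv \<gamma>)))"
proof -
  have V: "right_shift (inv \<gamma>) \<in> commutant S.K generators" "right_shift (inv \<gamma>) \<in> bop S.K"
    using \<gamma> right_shift_in_commutant right_shift_bop by auto
  have A\<Omega>: "A \<Omega> \<in> carrier S.K" using N_bop[OF A] by (auto intro: K.bop_closed)
  have "A (S.single \<gamma> g) = right_mult g (A (right_shift (inv \<gamma>) \<Omega>))"
    using K.commutantD[OF A right_mult_in_commutant[OF g], of "right_shift (inv \<gamma>) \<Omega>"] V(2)
    by (simp add: single_eq_right \<gamma> g K.bop_closed)
  also have "A (right_shift (inv \<gamma>) \<Omega>) = right_shift (inv \<gamma>) (A \<Omega>)"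
    using K.commutantD[OF A V(1)] by simp
  finally show ?thesis using \<gamma> A\<Omega> V(2) by (simp add: K.bop_closed)
qed

text \<open>In column \<open>\<one>\<close> the previous lemma says that \<open>A\<close> multiplies
  \<open>A \<Omega> \<gamma>\<close> by the bounded function \<open>g\<close>. So a bound for
  \<open>A\<close> is one for this multiplication, which is the criterion for being essentially
  bounded.\<close>

lemma N_Omega_Linf:
  assumes A: "A \<in> \<N>" and \<gamma>: "\<gamma> \<in> carrier G"
  shows "A \<Omega> \<gamma> \<in> Linf M"
proof -
  have A\<Omega>: "A \<Omega> \<in> carrier S.K" using N_bop[OF A] by (auto intro: K.bop_closed)
  obtain b where b: "\<And>x. x \<in> carrier S.K \<Longrightarrow> vnorm S.K (A x) \<le> b * vnorm S.K x"
    using K.bop_bound[OF N_bop[OF A]] by blast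
  show ?thesis
  proof (rule Linf_if_multiplication_bounded)
    show "A \<Omega> \<gamma> \<in> carrier (L2 M)" using A\<Omega> \<gamma> by auto
    fix g assume g: "g \<in> Linf M"
    have "vnorm (L2 M) (cl_mult M g (A \<Omega> \<gamma>)) = vnorm (L2 M) (A (S.single \<one> g) \<gamma>)"
      using N_single_Linf[OF A one_closed \<gamma> g] A\<Omega> \<gamma> by (simp add: act_one S.component_closed)
    also have "\<dots> \<le> vnorm S.K (A (S.single \<one> g))"
      using g \<gamma> by (intro S.vnorm_component_le K.bop_closed[OF N_bop[OF A]] S.single_closed) auto
    also have "\<dots> \<le> b * vnorm (L2 M) g"
      using b[of "S.single \<one> g"] g by (simp add: S.single_closed S.vnorm_single)
    finally show "vnorm (L2 M) (cl_mult M g (A \<Omega> \<gamma>)) \<le> b * vnorm (L2 M) g" .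
  qed
qed

text \<open>Both sides are bounded in \<open>F\<close> and agree on the dense set of bounded
  functions. Boundedness of the right-hand side rests on \<open>N_Omega_Linf\<close>.\<close>

lemma N_single:
  assumes A: "A \<in> \<N>" and \<gamma>: "\<gamma> \<in> carrier G" "\<gamma>' \<in> carrier G" and F: "F \<in> carrier (L2 M)"
  shows "A (S.single \<gamma> F) \<gamma>' = cl_mult M (\<alpha> (inv \<gamma>) (A \<Omega> (\<gamma>' \<otimes> inv \<gamma>))) F"
proof -
  define a where "a = \<alpha> (inv \<gamma>) (A \<Omega> (\<gamma>' \<otimes> inv \<gamma>))"
  have a: "a \<in> Linf M" unfolding a_def using \<gamma> by (intro act_Linf N_Omega_Linf A) auto
  have AB: "A \<in> bop S.K" using N_bop[OF A] .
  \<comment> \<open>Restricted to the carrier because members of \<open>bop\<close> are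
    extensional.\<close>
  define P where "P = (\<lambda>F\<in>carrier (L2 M). A (S.single \<gamma> F) \<gamma>')"
  define Q where "Q = (\<lambda>F\<in>carrier (L2 M). cl_mult M a F)"
  have closed: "A (S.single \<gamma> F) \<in> carrier S.K" if "F \<in> carrier (L2 M)" for F
    using that by (intro K.bop_closed[OF AB] S.single_closed)
  obtain b where b: "\<And>x. x \<in> carrier S.K \<Longrightarrow> vnorm S.K (A x) \<le> b * vnorm S.K x"
    using K.bop_bound[OF AB] by blast
  have "P \<in> bop (L2 M)"
  proof (rule L2.bopI)
    fix F assume F: "F \<in> carrier (L2 M)"
    have "vnorm (L2 M) (A (S.single \<gamma> F) \<gamma>') \<le> vnorm S.K (A (S.single \<gamma> F))"
      using closed[OF F] \<gamma> by (intro S.vnorm_component_le)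
    also have "\<dots> \<le> b * vnorm (L2 M) F"
      using b[of "S.single \<gamma> F"] F \<gamma> by (simp add: S.single_closed S.vnorm_single)
    finally show "vnorm (L2 M) (P F) \<le> b * vnorm (L2 M) F" using F by (simp add: P_def)
  qed (use \<gamma> closed AB in \<open>auto simp: P_def S.single_add S.single_smult K.bop_add K.bop_smult S.single_closed\<close>)
  moreover have "Q \<in> bop (L2 M)"
  proof -
    obtain c where c: "Linf_bound M c a" using a by (auto simp: Linf_iff)
    show ?thesis
    proof (rule L2.bopI)
      fix F assume F: "F \<in> carrier (L2 M)"
      show "vnorm (L2 M) (Q F) \<le> \<bar>c\<bar> * vnorm (L2 M) F"
        using vnorm_cl_mult_le[OF c F] F by (simp add: Q_def)
    qed (use a in \<open>auto simp: Q_def cl_mult_L2 cl_mult_add cl_mult_smult\<close>)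
  qed
  ultimately have "P = Q"
  proof (rule L.bop_eq_on_dense[OF _ _ dense_Linf])
    fix g assume g: "g \<in> Linf M"
    show "P g = Q g"
      using N_single_Linf[OF A \<gamma> g] g by (simp add: P_def Q_def a_def cl_mult_commute[of _ g])
  qed
  then have "P F = Q F" by simp
  then show ?thesis using F by (simp add: P_def Q_def a_def)
qed

text \<open>Existence of the associated function is \<open>N_single\<close>. Uniqueness holds since
  column \<open>\<one>\<close> applied to the constant 1 returns the function itself.\<close>

lemma associated_iff:
  assumes A: "A \<in> \<N>"
  shows "associated G M T A a \<longleftrightarrow> a = A \<Omega>"
proof
  have A\<Omega>: "A \<Omega> \<in> carrier S.K" using N_bop[OF A] by (auto intro: K.bop_closed)
  then have ext: "A \<Omega> \<in> extensional (carrier G)" by (auto simp: S.in_carrier_sum_iff PiE_def)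
  show "associated G M T A a" if "a = A \<Omega>"
    using that ext N_Omega_Linf[OF A] N_single[OF A]
    by (auto simp: associated_def mat_entry_def cp_embed_eq PiE_iff)
  assume a: "associated G M T A a"
  show "a = A \<Omega>"
  proof (rule PiE_ext)
    show "a \<in> carrier G \<rightarrow>\<^sub>E Linf M" using a by (simp add: associated_def)
    show "A \<Omega> \<in> carrier G \<rightarrow>\<^sub>E Linf M" using ext N_Omega_Linf[OF A] by (simp add: PiE_iff)
    fix \<gamma> assume \<gamma>: "\<gamma> \<in> carrier G"
    have a\<gamma>: "a \<gamma> \<in> Linf M" using a \<gamma> by (auto simp: associated_def)
    have "A \<Omega> \<gamma> = cl_mult M (\<alpha> (inv \<one>) (a (\<gamma> \<otimes> inv \<one>))) unit_class"
      using a \<gamma> one_Linf Linf_L2 one_closed unfolding associated_def mat_entry_def cp_embed_eq by metis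
    then show "a \<gamma> = A \<Omega> \<gamma>" using \<gamma> a\<gamma> by (simp add: act_one cl_mult_one)
  qed
qed

text \<open>The row form of \<open>S_entry\<close>: in row \<gamma> only the column
  \<open>inv \<gamma>\<close> contributes, and its twist is
  \<open>\<alpha> (inv \<gamma>)\<close>.\<close>

definition J :: "('g \<Rightarrow> ('x \<Rightarrow> complex) set) \<Rightarrow> 'g \<Rightarrow> ('x \<Rightarrow> complex) set" where
  "J = S.componentwise (\<lambda>\<gamma> F. \<alpha> (inv \<gamma>) (cl_cnj M F)) (\<lambda>\<gamma>. inv \<gamma>)"

lemma J_apply [simp]:
  "\<lbrakk>\<xi> \<in> carrier S.K; \<gamma> \<in> carrier G\<rbrakk> \<Longrightarrow> J \<xi> \<gamma> = \<alpha> (inv \<gamma>) (cl_cnj M (\<xi> (inv \<gamma>)))"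
  by (simp add: J_def)

lemma vnorm_cl_cnj: "F \<in> carrier (L2 M) \<Longrightarrow> vnorm (L2 M) (cl_cnj M F) = vnorm (L2 M) F"
  by (simp add: vnorm_def cinner_cl_cnj)

lemma J_closed: "\<xi> \<in> carrier S.K \<Longrightarrow> J \<xi> \<in> carrier S.K"
  unfolding J_def
  by (rule S.componentwise_closed[where c = 1]) (auto simp: bij_inv act_L2 cl_cnj_L2 vnorm_act vnorm_cl_cnj)

text \<open>Component \<gamma> of \<open>adj S.K A \<Omega>\<close> is found by pairing with
  \<open>S.single \<gamma> F\<close>: moving the adjoint over leaves the inner product with
  \<Omega>, which sees only component \<open>\<one>\<close> of
  \<open>A (S.single \<gamma> F)\<close>.\<close>

lemma J_Omega:
  assumes A: "A \<in> \<N>"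
  shows "J (A \<Omega>) = adj S.K A \<Omega>"
proof -
  have AB: "A \<in> bop S.K" "adj S.K A \<in> bop S.K" using N_bop[OF A] K.adj_in_bop by auto
  have closed: "A \<Omega> \<in> carrier S.K" "adj S.K A \<Omega> \<in> carrier S.K" using AB by (auto intro: K.bop_closed)
  show ?thesis
  proof (rule S.carrier_sum_eqI)
    show "J (A \<Omega>) \<in> carrier S.K" "adj S.K A \<Omega> \<in> carrier S.K" using closed J_closed by auto
    fix \<gamma> assume \<gamma>: "\<gamma> \<in> carrier G"
    \<comment> \<open>The multiplier in row \<open>\<one>\<close> and column \<gamma> of the matrix
      of \<open>A\<close>.\<close>
    define a where "a = \<alpha> (inv \<gamma>) (A \<Omega> (inv \<gamma>))"
    have a: "a \<in> Linf M" unfolding a_def using \<gamma> by (intro act_Linf N_Omega_Linf A) auto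
    have "adj S.K A \<Omega> \<gamma> = cl_cnj M a"
    proof (rule L2.cinner_eqI)
      show "adj S.K A \<Omega> \<gamma> \<in> carrier (L2 M)" using closed \<gamma> by auto
      show "cl_cnj M a \<in> carrier (L2 M)" using a by (auto intro: cl_cnj_L2)
      fix F assume F: "F \<in> carrier (L2 M)"
      have "cinner (L2 M) F (adj S.K A \<Omega> \<gamma>) = cinner S.K (S.single \<gamma> F) (adj S.K A \<Omega>)"
        using F \<gamma> closed by (simp add: S.cinner_single_left)
      also have "\<dots> = cinner S.K (A (S.single \<gamma> F)) \<Omega>"
        using AB F by (simp add: K.cinner_adj_right S.single_closed)
      also have "\<dots> = cnj (cinner S.K \<Omega> (A (S.single \<gamma> F)))"
        using F by (intro K.cinner_commute[OF K.bop_closed[OF AB(1)] Omega_closed] S.single_closed)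
      also have "cinner S.K \<Omega> (A (S.single \<gamma> F)) = cinner (L2 M) unit_class (cl_mult M a F)"
        using AB F \<gamma> N_single[OF A \<gamma> one_closed F]
        by (simp add: S.cinner_single_left S.single_closed K.bop_closed one_Linf a_def)
      also have "\<dots> = cinner (L2 M) (cl_cnj M a) F"
        using a F by (simp add: cinner_cl_mult one_Linf cl_mult_one cl_cnj_Linf)
      also have "cnj \<dots> = cinner (L2 M) F (cl_cnj M a)"
        using a F L2.cinner_commute[OF F cl_cnj_L2[OF Linf_L2[OF a]]] by simp
      finally show "cinner (L2 M) F (adj S.K A \<Omega> \<gamma>) = cinner (L2 M) F (cl_cnj M a)" .
    qed
    then show "J (A \<Omega>) \<gamma> = adj S.K A \<Omega> \<gamma>"
      using \<gamma> closed by (simp add: a_def act_cl_cnj S.component_closed)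
  qed
qed

text \<open>Antiunitarity combines three facts: conjugation swaps the slots of the inner product,
  the action preserves it, and inversion only permutes the terms of the sum. In
  \<open>J (J \<xi>)\<close> the twists by \<gamma> and its inverse cancel.\<close>

sublocale V: tracial_vector S.K \<N> \<Omega> J
proof
  show "cinner S.K \<Omega> \<Omega> = 1"
    by (simp add: S.cinner_single_left one_Linf cinner_L2_class prob_space)
next
  fix \<xi> \<eta> assume \<xi>: "\<xi> \<in> carrier S.K" and \<eta>: "\<eta> \<in> carrier S.K"
  show "J (\<xi> \<oplus>\<^bsub>S.K\<^esub> \<eta>) = J \<xi> \<oplus>\<^bsub>S.K\<^esub> J \<eta>"
    by (rule S.carrier_sum_eqI)
      (use \<xi> \<eta> J_closed S.add_sum_closed in \<open>auto simp: cl_cnj_add act_add cl_cnj_L2 S.component_closed\<close>)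
  have "cinner S.K (J \<xi>) (J \<eta>) = (\<Sum>\<^sub>\<infinity>\<gamma>\<in>carrier G. cinner (L2 M) (\<eta> (inv \<gamma>)) (\<xi> (inv \<gamma>)))"
    unfolding S.cinner_sum
    by (rule infsum_cong) (use \<xi> \<eta> in \<open>auto simp: cinner_act cinner_cl_cnj cl_cnj_L2 S.component_closed\<close>)
  also have "\<dots> = cinner S.K \<eta> \<xi>"
    unfolding S.cinner_sum by (rule infsum_reindex_bij_betw[OF bij_inv])
  finally show "cinner S.K (J \<xi>) (J \<eta>) = cinner S.K \<eta> \<xi>" .
next
  fix \<xi> c assume \<xi>: "\<xi> \<in> carrier S.K"
  show "J (c \<odot>\<^bsub>S.K\<^esub> \<xi>) = cnj c \<odot>\<^bsub>S.K\<^esub> J \<xi>"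
    by (rule S.carrier_sum_eqI)
      (use \<xi> J_closed S.smult_sum_closed in \<open>auto simp: cl_cnj_smult act_smult cl_cnj_L2 S.component_closed\<close>)
  show "J (J \<xi>) = \<xi>"
    by (rule S.carrier_sum_eqI)
      (use \<xi> J_closed in \<open>auto simp: act_cl_cnj[symmetric] cl_cnj_cl_cnj act_act act_one act_L2
        cl_cnj_L2 S.component_closed\<close>)
qed (auto intro: J_closed J_Omega vna_crossed_product cyclic_crossed_product separating_crossed_product)

end

section \<open>Ergodicity, freeness and factoriality\<close>

context pmp_action begin

lemma image_T_sets: "\<lbrakk>\<gamma> \<in> carrier G; A \<in> sets M\<rbrakk> \<Longrightarrow> T \<gamma> ` A \<in> sets M"
  using aut_action by (simp add: aut_action_def measure_aut_def)

lemma T_inv_T: "\<lbrakk>\<gamma> \<in> carrier G; x \<in> space M\<rbrakk> \<Longrightarrow> T (inv \<gamma>) (T \<gamma> x) = x"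
  by (simp add: T_mult[symmetric] T_one)

lemma T_T_inv: "\<lbrakk>\<gamma> \<in> carrier G; x \<in> space M\<rbrakk> \<Longrightarrow> T \<gamma> (T (inv \<gamma>) x) = x"
  by (simp add: T_mult[symmetric] T_one)

lemma T_space: "\<lbrakk>\<gamma> \<in> carrier G; x \<in> space M\<rbrakk> \<Longrightarrow> T \<gamma> x \<in> space M"
  using bij_T by (rule bij_betw_apply)

lemma image_T_iff:
  assumes "\<gamma> \<in> carrier G" "A \<subseteq> space M" "x \<in> space M"
  shows "x \<in> T \<gamma> ` A \<longleftrightarrow> T (inv \<gamma>) x \<in> A"
proof
  assume "x \<in> T \<gamma> ` A"
  then show "T (inv \<gamma>) x \<in> A" using assms T_inv_T by auto
next
  assume "T (inv \<gamma>) x \<in> A"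
  then show "x \<in> T \<gamma> ` A" using T_T_inv[OF assms(1,3)] by (metis imageI)
qed

text \<open>The set where \<open>k\<close> lies below its mean is invariant, hence trivial; either way
  \<open>k\<close> minus its mean has a sign and integral zero.\<close>

lemma ergodic_invariant_const:
  fixes k :: "'x \<Rightarrow> real"
  assumes erg: "ergodic_action G M T" and k: "integrable M k"
    and inv: "\<And>\<gamma>. \<gamma> \<in> carrier G \<Longrightarrow> AE x in M. k (T (inv \<gamma>) x) = k x"
  shows "AE x in M. k x = (\<integral>x. k x \<partial>M)"
proof -
  define c where "c = (\<integral>x. k x \<partial>M)"
  have [measurable]: "k \<in> borel_measurable M" using k by (rule borel_measurable_integrable)
  define Y where "Y = {x \<in> space M. k x < c}"
  have Y [measurable]: "Y \<in> sets M" unfolding Y_def by measurable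
  have "measure M (sym_diff (T \<gamma> ` Y) Y) = 0" if \<gamma>: "\<gamma> \<in> carrier G" for \<gamma>
  proof -
    \<comment> \<open>Membership in the image of \<open>Y\<close> is a condition on
      \<open>k (T (inv \<gamma>) x)\<close>, and this value is almost everywhere
      \<open>k x\<close>.\<close>
    have "AE x in M. x \<notin> sym_diff (T \<gamma> ` Y) Y"
      using inv[OF \<gamma>] AE_space
    proof eventually_elim
      case (elim x)
      then show ?case
        using image_T_iff[OF \<gamma>, of Y x] T_space[of "inv \<gamma>" x] \<gamma> by (auto simp: Y_def)
    qed
    moreover have "sym_diff (T \<gamma> ` Y) Y \<in> sets M" using image_T_sets[OF \<gamma> Y] Y by auto
    ultimately show ?thesis by (simp add: prob_eq_0)
  qed
  then have "measure M Y = 0 \<or> measure M (space M - Y) = 0"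
    using erg Y by (auto simp: ergodic_action_def)
  then show ?thesis
  proof
    assume "measure M Y = 0"
    then have "AE x in M. x \<notin> Y" by (simp add: prob_eq_0)
    then have "AE x in M. 0 \<le> k x - c" using AE_space by eventually_elim (auto simp: Y_def)
    moreover have "(\<integral>x. k x - c \<partial>M) = 0" using k by (simp add: c_def prob_space)
    ultimately have "AE x in M. k x - c = 0"
      using k by (subst (asm) integral_nonneg_eq_0_iff_AE) auto
    then show ?thesis by (simp add: c_def)
  next
    assume "measure M (space M - Y) = 0"
    then have "AE x in M. x \<notin> space M - Y" by (subst (asm) prob_eq_0) auto
    then have "AE x in M. 0 \<le> c - k x" using AE_space by eventually_elim (auto simp: Y_def)
    moreover have "(\<integral>x. c - k x \<partial>M) = 0" using k by (simp add: c_def prob_space)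
    ultimately have "AE x in M. c - k x = 0"
      using k by (subst (asm) integral_nonneg_eq_0_iff_AE) auto
    then show ?thesis by eventually_elim (simp add: c_def)
  qed
qed

text \<open>The argument by sublevel sets needs an ordered range, so it is applied to the real and
  imaginary parts separately.\<close>

lemma ergodic_fixed_class:
  assumes erg: "ergodic_action G M T" and F: "F \<in> carrier (L2 M)"
    and fixed: "\<And>\<gamma>. \<gamma> \<in> carrier G \<Longrightarrow> \<alpha> \<gamma> F = F"
  obtains c where "F = ae_class M (\<lambda>_. c)"
proof -
  obtain f where f: "square_integrable M f" "f \<in> borel_measurable M" "F = ae_class M f"
    using F by (rule carrier_L2_measurableE)
  have int: "integrable M f" using f(1) by (rule square_integrable_imp_integrable)
  have inv: "AE x in M. f (T (inv \<gamma>) x) = f x" if \<gamma>: "\<gamma> \<in> carrier G" for \<gamma>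
    using fixed[OF \<gamma>] \<gamma> f(2) by (intro ae_class_eqD) (auto simp: f(3) act_class comp_T_measurable)
  have "AE x in M. Re (f x) = (\<integral>x. Re (f x) \<partial>M)"
  proof (rule ergodic_invariant_const[OF erg])
    fix \<gamma> assume "\<gamma> \<in> carrier G"
    from inv[OF this] show "AE x in M. Re (f (T (inv \<gamma>) x)) = Re (f x)" by eventually_elim simp
  qed (use int in simp)
  moreover have "AE x in M. Im (f x) = (\<integral>x. Im (f x) \<partial>M)"
  proof (rule ergodic_invariant_const[OF erg])
    fix \<gamma> assume "\<gamma> \<in> carrier G"
    from inv[OF this] show "AE x in M. Im (f (T (inv \<gamma>) x)) = Im (f x)" by eventually_elim simp
  qed (use int in simp)
  ultimately have "AE x in M. f x = Complex (\<integral>x. Re (f x) \<partial>M) (\<integral>x. Im (f x) \<partial>M)"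
    by eventually_elim (simp add: complex_eq_iff)
  then show thesis by (intro that) (simp only: f(3) ae_class_eqI)
qed

text \<open>Test the relation on indicators of the countably many separating sets, so that one null
  set covers them all. Outside it, where \<open>f x\<close> is nonzero, no separating set
  distinguishes \<open>x\<close> from \<open>T (inv \<gamma>) x\<close>, although freeness keeps
  these points apart.\<close>

lemma free_on_Linf_if_countably_separated:
  assumes sep: "countably_separated M" and free: "free_action G M T"
  shows "free_on_Linf G M T"
  unfolding free_on_Linf_def
proof (intro ballI impI)
  fix \<gamma> F assume \<gamma>: "\<gamma> \<in> carrier G" "\<gamma> \<noteq> \<one>" and F: "F \<in> Linf M"
    and comm: "\<forall>g\<in>Linf M. cl_mult M F g = cl_mult M (\<alpha> \<gamma> g) F"
  have inv: "inv \<gamma> \<in> carrier G" "inv \<gamma> \<noteq> \<one>" using \<gamma> by (simp_all add: inv_eq_1_iff)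
  obtain f where f [measurable]: "f \<in> borel_measurable M" and F_eq: "F = ae_class M f"
    using F by (rule LinfE)
  obtain D Z where D: "countable D" "D \<subseteq> sets M" and Z: "Z \<in> null_sets M"
    and sep: "\<forall>x\<in>space M - Z. \<forall>y\<in>space M - Z. x \<noteq> y \<longrightarrow> (\<exists>A\<in>D. (x \<in> A) \<noteq> (y \<in> A))"
    using sep unfolding countably_separated_def by blast
  have "AE x in M. f x * indicator A x = indicator A (T (inv \<gamma>) x) * f x" if "A \<in> D" for A
  proof (rule ae_class_eqD)
    have A [measurable]: "A \<in> sets M" using that D by auto
    have ind: "(indicator A :: 'x \<Rightarrow> complex) \<in> borel_measurable M" by measurable
    show "(\<lambda>x. f x * indicator A x) \<in> borel_measurable M" by measurable
    have "ae_class M (indicator A) \<in> Linf M"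
      by (rule LinfI[of _ _ 1]) (auto simp: indicator_def)
    then have "cl_mult M F (ae_class M (indicator A)) = cl_mult M (\<alpha> \<gamma> (ae_class M (indicator A))) F"
      using comm by blast
    then show "ae_class M (\<lambda>x. f x * indicator A x) = ae_class M (\<lambda>x. indicator A (T (inv \<gamma>) x) * f x)"
      using \<gamma> inv by (simp add: F_eq act_class cl_mult_class ind comp_T_measurable)
  qed
  then have "AE x in M. \<forall>A\<in>D. f x * indicator A x = indicator A (T (inv \<gamma>) x) * f x"
    unfolding AE_ball_countable[OF D(1)] by blast
  moreover have "AE x in M. T (inv \<gamma>) x \<noteq> x" using free inv by (auto simp: free_action_def)
  moreover have "AE x in M. x \<notin> Z" using Z by (rule AE_not_in)
  \<comment> \<open>Separation is available only when both points avoid \<open>Z\<close>.\<close>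
  moreover have "AE x in M. T (inv \<gamma>) x \<notin> Z" using AE_T[OF inv(1) AE_not_in[OF Z]] .
  ultimately have "AE x in M. f x = 0"
    using AE_space
  proof eventually_elim
    case (elim x)
    then have "T (inv \<gamma>) x \<in> space M" using inv T_space by auto
    then obtain A where "A \<in> D" "(x \<in> A) \<noteq> (T (inv \<gamma>) x \<in> A)" using sep elim by blast
    then show "f x = 0" using elim(1) by (auto simp: indicator_def split: if_splits)
  qed
  then show "F = ae_class M (\<lambda>_. 0)" unfolding F_eq by (rule ae_class_eqI)
qed

text \<open>Since \<Omega> is separating, it suffices to find \<open>A \<Omega>\<close>. Each
  commutation relation is evaluated at \<Omega> and in one component: those with
  \<open>cp_pi\<close> kill the components away from the unit, those with \<open>cp_U\<close> make
  the remaining one invariant.\<close>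

lemma center_crossed_product:
  assumes erg: "ergodic_action G M T" and free: "free_on_Linf G M T"
    and A: "A \<in> \<N>" "A \<in> commutant S.K \<N>"
  shows "\<exists>c. A = op_scale S.K c (op_id S.K)"
proof -
  have AB: "A \<in> bop S.K" using N_bop[OF A(1)] .
  have A\<Omega>: "A \<Omega> \<in> carrier S.K" using AB Omega_closed by (rule K.bop_closed)
  have a: "A \<Omega> \<gamma> \<in> Linf M" if "\<gamma> \<in> carrier G" for \<gamma> using N_Omega_Linf[OF A(1) that] .
  have off: "A \<Omega> \<gamma> = \<zero>\<^bsub>L2 M\<^esub>" if \<gamma>: "\<gamma> \<in> carrier G" "\<gamma> \<noteq> \<one>" for \<gamma>
  proof -
    have "cl_mult M (A \<Omega> \<gamma>) f = cl_mult M (\<alpha> (inv \<gamma>) f) (A \<Omega> \<gamma>)" if f: "f \<in> Linf M" for f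
    proof -
      have pi: "cp_pi G M T f \<in> \<N>" using f by (intro generators_in_N) auto
      have "cp_pi G M T f \<Omega> = S.single \<one> f"
        by (rule S.carrier_sum_eqI)
          (use f K.bop_closed[OF cp_pi_bop[OF f] Omega_closed] in
            \<open>auto simp: S.single_closed act_one cl_mult_one cl_mult_zero act_Linf\<close>)
      then have "A (S.single \<one> f) \<gamma> = cp_pi G M T f (A \<Omega>) \<gamma>"
        using K.commutantD[OF A(2) pi Omega_closed] by simp
      then show ?thesis
        using N_single[OF A(1) one_closed \<gamma>(1) Linf_L2[OF f]] \<gamma> A\<Omega> a
        by (simp add: act_one)
    qed
    \<comment> \<open>Freeness is used for the inverse of \<gamma>, since component \<gamma> of
      \<open>cp_pi\<close> is twisted by that inverse.\<close>
    moreover have "inv \<gamma> \<in> carrier G" "inv \<gamma> \<noteq> \<one>" using \<gamma> by (simp_all add: inv_eq_1_iff)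
    ultimately show ?thesis
      using free a[OF \<gamma>(1)] unfolding free_on_Linf_def zero_L2 by blast
  qed
  have fixed: "\<alpha> \<gamma> (A \<Omega> \<one>) = A \<Omega> \<one>" if \<gamma>: "\<gamma> \<in> carrier G" for \<gamma>
  proof -
    \<comment> \<open>At component \<open>inv \<gamma>\<close> the two orders give the diagonal
      entry of \<open>A\<close> in that column, which is
      \<open>\<alpha> \<gamma> (A \<Omega> \<one>)\<close>, and the translate of
      \<open>A \<Omega>\<close>, which is \<open>A \<Omega> \<one>\<close>.\<close>
    have U: "cp_U G M (inv \<gamma>) \<in> \<N>" using \<gamma> by (intro generators_in_N) auto
    have "cp_U G M (inv \<gamma>) \<Omega> = S.single (inv \<gamma>) unit_class"
    proof (rule S.carrier_sum_eqI)
      fix \<gamma>' assume \<gamma>': "\<gamma>' \<in> carrier G"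
      have "\<gamma> \<otimes> \<gamma>' = \<one> \<longleftrightarrow> \<gamma>' = inv \<gamma>" using \<gamma> \<gamma>' by (metis inv_closed inv_equality inv_inv l_inv)
      then show "cp_U G M (inv \<gamma>) \<Omega> \<gamma>' = S.single (inv \<gamma>) unit_class \<gamma>'"
        using \<gamma> \<gamma>' by simp
    qed (use \<gamma> K.bop_closed[OF cp_U_bop Omega_closed] in \<open>auto simp: S.single_closed one_Linf\<close>)
    then have "A (S.single (inv \<gamma>) unit_class) (inv \<gamma>) = cp_U G M (inv \<gamma>) (A \<Omega>) (inv \<gamma>)"
      using K.commutantD[OF A(2) U Omega_closed] by simp
    moreover have "A (S.single (inv \<gamma>) unit_class) (inv \<gamma>) = \<alpha> \<gamma> (A \<Omega> \<one>)"
      using N_single[OF A(1) _ _ Linf_L2[OF one_Linf], of "inv \<gamma>" "inv \<gamma>"] \<gamma> a[OF one_closed]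
      by (simp add: cl_mult_one act_Linf)
    ultimately show ?thesis using \<gamma> A\<Omega> by simp
  qed
  obtain c where c: "A \<Omega> \<one> = ae_class M (\<lambda>_. c)"
    using ergodic_fixed_class[OF erg _ fixed] a[OF one_closed] by auto
  have sc: "op_scale S.K c (op_id S.K) \<in> \<N>" using V.N_op_scale[OF V.N_op_id] .
  have "A \<Omega> = op_scale S.K c (op_id S.K) \<Omega>"
  proof (rule S.carrier_sum_eqI)
    fix \<gamma> assume "\<gamma> \<in> carrier G"
    then show "A \<Omega> \<gamma> = op_scale S.K c (op_id S.K) \<Omega> \<gamma>"
      using off c by (auto simp: smult_L2_class L2.smult_zero)
  qed (use A\<Omega> in auto)
  then have "A = op_scale S.K c (op_id S.K)" by (rule V.separatingD[OF A(1) sc])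
  then show ?thesis by blast
qed

lemma factor_crossed_product:
  assumes erg: "ergodic_action G M T" and free: "free_on_Linf G M T"
  shows "factor S.K \<N>"
  unfolding factor_def
proof (intro conjI vna_crossed_product subset_antisym subsetI)
  fix A assume "A \<in> \<N> \<inter> commutant S.K \<N>"
  then show "A \<in> {op_scale S.K c (op_id S.K) | c. True}"
    using center_crossed_product[OF erg free] by auto
next
  fix A assume "A \<in> {op_scale S.K c (op_id S.K) | c. True}"
  then obtain c where A: "A = op_scale S.K c (op_id S.K)" by auto
  have "A \<in> \<N>" using V.N_op_scale[OF V.N_op_id] by (simp add: A)
  moreover have "A \<in> commutant S.K \<N>"
    unfolding A using K.commutant_subset_bop by (intro K.op_scale_in_commutant K.op_id_in_commutant)
  ultimately show "A \<in> \<N> \<inter> commutant S.K \<N>" by simp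
qed

text \<open>At most one term, the one at \<open>inv \<gamma>'\<close>, is nonzero, so every finite
  partial sum that includes it already equals the limit.\<close>

lemma has_vsum_S_entry:
  assumes \<xi>: "\<xi> \<in> carrier S.K" and \<gamma>': "\<gamma>' \<in> carrier G"
  shows "has_vsum (L2 M) (\<lambda>\<gamma>. S_entry G M T \<gamma>' \<gamma> (\<xi> \<gamma>)) (carrier G) (J \<xi> \<gamma>')"
proof -
  define f where "f = (\<lambda>\<gamma>. S_entry G M T \<gamma>' \<gamma> (\<xi> \<gamma>))"
  have J: "J \<xi> \<gamma>' \<in> carrier (L2 M)" using J_closed[OF \<xi>] \<gamma>' by auto
  have f_eq: "f \<gamma> = (if inv \<gamma>' = \<gamma> then J \<xi> \<gamma>' else \<zero>\<^bsub>L2 M\<^esub>)" if \<gamma>: "\<gamma> \<in> carrier G" for \<gamma>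
    using \<gamma> \<gamma>' \<xi> by (auto simp: f_def S_entry_def)
  have fin: "finsum (L2 M) f F = J \<xi> \<gamma>'" if F: "finite F" "inv \<gamma>' \<in> F" "F \<subseteq> carrier G" for F
  proof -
    have "finsum (L2 M) f F = finsum (L2 M) (\<lambda>\<gamma>. if inv \<gamma>' = \<gamma> then J \<xi> \<gamma>' else \<zero>\<^bsub>L2 M\<^esub>) F"
      by (rule L2.finsum_cong') (use F f_eq J in auto)
    also have "\<dots> = J \<xi> \<gamma>'"
      by (rule L2.finsum_singleton[OF F(2,1)]) (use J in auto)
    finally show ?thesis .
  qed
  have "\<exists>F0. finite F0 \<and> F0 \<subseteq> carrier G \<and>
      (\<forall>F. finite F \<and> F0 \<subseteq> F \<and> F \<subseteq> carrier G \<longrightarrow> vdist (L2 M) (finsum (L2 M) f F) (J \<xi> \<gamma>') < e)"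
    if "e > 0" for e :: real
    using \<gamma>' that J by (intro exI[of _ "{inv \<gamma>'}"]) (auto simp: fin)
  then show ?thesis unfolding has_vsum_def f_def[symmetric] using f_eq J by auto
qed

end

theorem theorem3p7:
  fixes M :: "'x measure" and G :: "('g, 'b) monoid_scheme" and T :: "'g \<Rightarrow> 'x \<Rightarrow> 'x"
    and \<H> :: "('x \<Rightarrow> complex) set hilbert"
    and \<K> :: "('g \<Rightarrow> ('x \<Rightarrow> complex) set) hilbert"
    and \<N> :: "(('g \<Rightarrow> ('x \<Rightarrow> complex) set) \<Rightarrow> 'g \<Rightarrow> ('x \<Rightarrow> complex) set) set"
    and \<Omega> :: "'g \<Rightarrow> ('x \<Rightarrow> complex) set"
    and S :: "(('g \<Rightarrow> ('x \<Rightarrow> complex) set) \<times> ('g \<Rightarrow> ('x \<Rightarrow> complex) set)) set"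
  assumes "prob_space M" and "separable_measure M"
    and "group G" and "countable (carrier G)" and "infinite (carrier G)"
    and "aut_action G M T" and "measure_preserving_action G M T"
    and "free_action G M T" and "ergodic_action G M T"
    and \<H>: "\<H> = L2 M" and \<K>: "\<K> = cp_space G M" and \<N>: "\<N> = crossed_product G M T"
    and \<Omega>: "\<Omega> = cp_Omega G M" and S: "S = tomita \<K> \<N> \<Omega>"
  shows "cyclic \<K> \<N> \<Omega> \<and> separating \<K> \<N> \<Omega> \<and>
    antilinear_isometry \<K> S \<and>
    (\<forall>\<Delta> J. modular_objects \<K> \<N> \<Omega> \<Delta> J \<longleftrightarrow> \<Delta> = Id_on (carrier \<K>) \<and> J = S) \<and>
    (\<forall>N\<in>\<N>. \<exists>!A. associated G M T N A) \<and>
    {N \<Omega> | N. N \<in> \<N>} = {A. \<exists>N\<in>\<N>. associated G M T N A} \<and>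
    dense_in \<K> {N \<Omega> | N. N \<in> \<N>} \<and>
    (\<forall>\<xi>\<in>{N \<Omega> | N. N \<in> \<N>}. \<exists>\<eta>. (\<xi>, \<eta>) \<in> S \<and>
       (\<forall>\<gamma>'\<in>carrier G. has_vsum \<H> (\<lambda>\<gamma>. S_entry G M T \<gamma>' \<gamma> (\<xi> \<gamma>)) (carrier G) (\<eta> \<gamma>'))) \<and>
    tracial_state \<K> \<N> (vector_state \<K> \<Omega>) \<and>
    finite_vna \<K> \<N> \<and>
    (countably_separated M \<or> free_on_Linf G M T \<longrightarrow> factor \<K> \<N>)"
proof -
  interpret pmp_action M G T
    using assms by (intro pmp_action.intro pmp_action_axioms.intro)
  have K_eq: "\<K> = S.K" by (simp add: \<K> cp_space_def)
  have N_eq: "\<N> = commutant S.K (commutant S.K generators)"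
    by (simp add: \<N> crossed_product_def cp_space_def)
  have \<Omega>_eq: "\<Omega> = S.single \<one>\<^bsub>G\<^esub> unit_class" by (simp add: \<Omega> cp_Omega_eq)
  note eqs = K_eq N_eq \<Omega>_eq
  have "\<exists>\<eta>. (\<xi>, \<eta>) \<in> S \<and>
      (\<forall>\<gamma>'\<in>carrier G. has_vsum \<H> (\<lambda>\<gamma>. S_entry G M T \<gamma>' \<gamma> (\<xi> \<gamma>)) (carrier G) (\<eta> \<gamma>'))"
    if "\<xi> \<in> {N \<Omega> | N. N \<in> \<N>}" for \<xi>
  \<comment> \<open>The partner of \<open>\<xi>\<close> is \<open>J \<xi>\<close>, because the graph
    of \<open>J\<close> is the Tomita operator.\<close>
  proof (intro exI conjI ballI)
    have \<xi>: "\<xi> \<in> carrier S.K"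
      using that V.dense_N_Omega unfolding eqs dense_in_def by blast
    then show "(\<xi>, J \<xi>) \<in> S" unfolding S eqs V.tomita_eq by blast
    show "has_vsum \<H> (\<lambda>\<gamma>. S_entry G M T \<gamma>' \<gamma> (\<xi> \<gamma>)) (carrier G) (J \<xi> \<gamma>')"
      if "\<gamma>' \<in> carrier G" for \<gamma>'
      unfolding \<H> using \<xi> that by (rule has_vsum_S_entry)
  qed
  moreover have "{N \<Omega> | N. N \<in> \<N>} = {A. \<exists>N\<in>\<N>. associated G M T N A}"
    unfolding eqs using associated_iff by auto
  moreover have "\<forall>N\<in>\<N>. \<exists>!A. associated G M T N A"
    unfolding eqs using associated_iff by simp
  moreover have "countably_separated M \<or> free_on_Linf G M T \<longrightarrow> factor \<K> \<N>"
    unfolding eqs using factor_crossed_product free_on_Linf_if_countably_separated assms(8,9) by blast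
  ultimately show ?thesis
    using V.cyclic V.separating V.antilinear_isometry_tomita V.modular_objects_iff V.dense_N_Omega
      V.tracial_state_vector_state V.finite_vna
    unfolding S eqs by blast
qed

end
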